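(* Let $\mathbf{w}$ be a $\mathcal{C}$-adic word with directive sequence $(c_{i_n})_{n\in\mathbb{N}}\in\mathcal{C}^{\mathbb{N}}$. (i) There exists $k\ge1$ such that $p_{\mathbf{w}}(n)=k$ for all large enough $n$ if and only if $(c_{i_n})_{n\in\mathbb{N}}\in\{c_1,c_2\}^*\{c_1^{\mathbb{N}},c_2^{\mathbb{N}}\}$. (ii) There exists $k\ge1$ such that $p_{\mathbf{w}}(n)=n+k$ for all large enough $n$ if and only if $(c_{i_n})_{n\in\mathbb{N}}\in\left(\{c_1,c_2\}^*\{c_1^2,c_2^2\}^{\mathbb{N}}\right)\setminus\{c_1,c_2\}^*\{c_1^{\mathbb{N}},c_2^{\mathbb{N}}\}$. (iii) $p_{\mathbf{w}}(n)=2n+1$ for all $n$ if and only if $(c_{i_n})_{n\in\mathbb{N}}$ is primitive. In particular, this is also equivalent to the fact that $\mathbf{w}$ is a uniformly recurrent dendric word.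
   Context: Let $\mathcal{A}=\{1,2,3\}$ and $\mathcal{C}=\{c_1,c_2\}$, where $c_1,c_2$ are the endomorphisms of the free monoid $\mathcal{A}^*$ given by $c_1:1\mapsto1,\ 2\mapsto13,\ 3\mapsto2$ and $c_2:1\mapsto2,\ 2\mapsto13,\ 3\mapsto3$. An infinite word $\mathbf{w}\in\mathcal{A}^{\mathbb{N}}$ is $\mathcal{C}$-adic with directive sequence $(\sigma_n)_n\in\mathcal{C}^{\mathbb{N}}$ if there is a sequence of letters $(a_n)_n\in\mathcal{A}^{\mathbb{N}}$ such that $\lim_{n\to\infty}\sigma_0\sigma_1\cdots\sigma_{n-1}(a_n)$ exists and equals $\mathbf{w}$. Sequences of substitutions are regarded as infinite words over $\{c_1,c_2\}$: $\{c_1,c_2\}^*\{c_1^{\mathbb{N}},c_2^{\mathbb{N}}\}$ is the set of eventually constant sequences; $\{c_1,c_2\}^*\{c_1^2,c_2^2\}^{\mathbb{N}}$ is the set of sequences $(\sigma_n)_n$ for which there is $N\ge0$ with $\sigma_{N+2i}=\sigma_{N+2i+1}$ for all $i\in\mathbb{N}$. A sequence $(\sigma_n)_n$ is primitive if for all $r\in\mathbb{N}$ there is $s>r$ such that for all letters $a,b\in\mathcal{A}$, $a$ occurs in $\sigma_r\sigma_{r+1}\cdots\sigma_{s-1}(b)$. $\mathcal{L}_{\mathbf{w}}$ is the set of finite words (factors, including the empty word) occurring in $\mathbf{w}$; $p_{\mathbf{w}}(n)=\#(\mathcal{L}_{\mathbf{w}}\cap\mathcal{A}^n)$ is the factor complexity.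 $\mathbf{w}$ is uniformly recurrent if every factor occurs infinitely many times in $\mathbf{w}$ with bounded gaps between successive occurrences. For $u\in\mathcal{L}_{\mathbf{w}}$ let $E^-(u)=\{a\in\mathcal{A}: au\in\mathcal{L}_{\mathbf{w}}\}$, $E^+(u)=\{b\in\mathcal{A}: ub\in\mathcal{L}_{\mathbf{w}}\}$, $E(u)=\{(a,b)\in\mathcal{A}\times\mathcal{A}: aub\in\mathcal{L}_{\mathbf{w}}\}$. The word $u$ is bispecial if $\#E^-(u)>1$ and $\#E^+(u)>1$. The extension graph of $u$ is the undirected bipartite graph whose vertex set is the disjoint union of $E^-(u)$ and $E^+(u)$ and whose edge set is $E(u)$. A bispecial factor is dendric if its extension graph is a tree, and an infinite word is dendric if all its bispecial factors are dendric.
   Formalization: In (iii), the last equivalence also requires that all three letters occur in w: primitive iff w is uniformly recurrent, dendric and uses 1, 2 and 3. Without this it fails: for the constant sequence c_1, w = 111... is uniformly recurrent and dendric, but the sequence is not primitive. *)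

theory Defs
  imports Complex_Main "HOL-Library.Omega_Words_Fun"
begin

datatype letter = L1 | L2 | L3

instance letter :: finite
proof
  have "(UNIV :: letter set) = {L1, L2, L3}"
    by (auto intro: letter.exhaust)
  then show "finite (UNIV :: letter set)"
    by (rule ssubst) (intro finite.intros)
qed


section \<open>Directive sequences and \<open>\<C>\<close>-adic words\<close>

primrec c1_letter :: "letter \<Rightarrow> letter list" where
  "c1_letter L1 = [L1]"
| "c1_letter L2 = [L1, L3]"
| "c1_letter L3 = [L2]"

primrec c2_letter :: "letter \<Rightarrow> letter list" where
  "c2_letter L1 = [L2]"
| "c2_letter L2 = [L1, L3]"
| "c2_letter L3 = [L3]"

definition c1 :: "letter list \<Rightarrow> letter list" where
  "c1 u = concat (map c1_letter u)"

definition c2 :: "letter list \<Rightarrow> letter list" where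
  "c2 u = concat (map c2_letter u)"

definition \<C> :: "(letter list \<Rightarrow> letter list) set" where
  "\<C> = {c1, c2}"

text \<open>\<open>subst_prod \<sigma> r s\<close> is \<open>\<sigma> r \<circ> \<sigma> (r + 1) \<circ> \<dots> \<circ> \<sigma> (s - 1)\<close>, with \<open>\<sigma> (s - 1)\<close> applied first.\<close>

definition subst_prod :: "(nat \<Rightarrow> 'a list \<Rightarrow> 'a list) \<Rightarrow> nat \<Rightarrow> nat \<Rightarrow> 'a list \<Rightarrow> 'a list" where
  "subst_prod \<sigma> r s = foldr (\<circ>) (map \<sigma> [r..<s]) id"

text \<open>
  Convergence of finite words to an infinite word, in the usual topology on finite and infinite
  words: the lengths must tend to infinity.
\<close>

definition words_converge :: "(nat \<Rightarrow> 'a list) \<Rightarrow> 'a word \<Rightarrow> bool" where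
  "words_converge U w \<longleftrightarrow>
     (\<forall>k. eventually (\<lambda>n. k \<le> length (U n) \<and> take k (U n) = prefix k w) sequentially)"

definition \<C>_adic :: "(nat \<Rightarrow> letter list \<Rightarrow> letter list) \<Rightarrow> letter word \<Rightarrow> bool" where
  "\<C>_adic \<sigma> w \<longleftrightarrow>
     range \<sigma> \<subseteq> \<C> \<and> (\<exists>a. words_converge (\<lambda>n. subst_prod \<sigma> 0 n [a n]) w)"

text \<open>\<open>{c\<^sub>1,c\<^sub>2}\<^sup>*{c\<^sub>1\<^sup>\<nat>,c\<^sub>2\<^sup>\<nat>}\<close>\<close>

definition eventually_constant :: "(nat \<Rightarrow> letter list \<Rightarrow> letter list) set" where
  "eventually_constant = {\<sigma>. range \<sigma> \<subseteq> \<C> \<and> (\<exists>N. \<forall>n\<ge>N. \<sigma> n = \<sigma> N)}"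

text \<open>\<open>{c\<^sub>1,c\<^sub>2}\<^sup>*{c\<^sub>1\<^sup>2,c\<^sub>2\<^sup>2}\<^sup>\<nat>\<close>\<close>

definition eventually_squares :: "(nat \<Rightarrow> letter list \<Rightarrow> letter list) set" where
  "eventually_squares =
     {\<sigma>. range \<sigma> \<subseteq> \<C> \<and> (\<exists>N. \<forall>i. \<sigma> (N + 2 * i) = \<sigma> (N + 2 * i + 1))}"

definition primitive :: "(nat \<Rightarrow> 'a list \<Rightarrow> 'a list) \<Rightarrow> bool" where
  "primitive \<sigma> \<longleftrightarrow> (\<forall>r. \<exists>s>r. \<forall>a b. a \<in> set (subst_prod \<sigma> r s [b]))"


section \<open>Factors, complexity and uniform recurrence\<close>

definition language :: "'a word \<Rightarrow> 'a list set" where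
  "language w = {w [i \<rightarrow> j] | i j. i \<le> j}"

definition complexity :: "'a word \<Rightarrow> nat \<Rightarrow> nat" where
  "complexity w n = card {u \<in> language w. length u = n}"

definition occurrences :: "'a word \<Rightarrow> 'a list \<Rightarrow> nat set" where
  "occurrences w u = {i. w [i \<rightarrow> i + length u] = u}"

definition uniformly_recurrent :: "'a word \<Rightarrow> bool" where
  "uniformly_recurrent w \<longleftrightarrow>
     (\<forall>u \<in> language w. infinite (occurrences w u) \<and>
        (\<exists>g. \<forall>i \<in> occurrences w u. \<forall>j \<in> occurrences w u.
           i < j \<and> {i<..<j} \<inter> occurrences w u = {} \<longrightarrow> j - i \<le> g))"


section \<open>Extension graphs and dendric words\<close>

definition left_ext :: "'a word \<Rightarrow> 'a list \<Rightarrow> 'a set" where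
  "left_ext w u = {a. a # u \<in> language w}"

definition right_ext :: "'a word \<Rightarrow> 'a list \<Rightarrow> 'a set" where
  "right_ext w u = {b. u @ [b] \<in> language w}"

definition bi_ext :: "'a word \<Rightarrow> 'a list \<Rightarrow> ('a \<times> 'a) set" where
  "bi_ext w u = {(a, b). a # u @ [b] \<in> language w}"

definition bispecial :: "'a word \<Rightarrow> 'a list \<Rightarrow> bool" where
  "bispecial w u \<longleftrightarrow>
     u \<in> language w \<and> card (left_ext w u) > 1 \<and> card (right_ext w u) > 1"

text \<open>
  Undirected simple graphs are given by a vertex set and a set of two-element edges. The trees of
  \<open>Graph_Theory\<close> are not usable here: cycles there are directed, so that orienting all edges of a
  bipartite graph from left to right always gives a forest, whereas in a symmetric digraph every
  edge gives a cycle.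
\<close>

definition graph_connected :: "'v set \<Rightarrow> 'v set set \<Rightarrow> bool" where
  "graph_connected V E \<longleftrightarrow> V \<noteq> {} \<and> (\<forall>x\<in>V. \<forall>y\<in>V. (x, y) \<in> {(u, v). {u, v} \<in> E}\<^sup>*)"

definition graph_cycle :: "'v set set \<Rightarrow> 'v list \<Rightarrow> bool" where
  "graph_cycle E vs \<longleftrightarrow>
     length vs \<ge> 3 \<and> distinct vs \<and>
     (\<forall>i<length vs. {vs ! i, vs ! (Suc i mod length vs)} \<in> E)"

definition is_tree :: "'v set \<Rightarrow> 'v set set \<Rightarrow> bool" where
  "is_tree V E \<longleftrightarrow> graph_connected V E \<and> (\<nexists>vs. graph_cycle E vs)"

definition ext_graph_verts :: "'a word \<Rightarrow> 'a list \<Rightarrow> ('a + 'a) set" where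
  "ext_graph_verts w u = left_ext w u <+> right_ext w u"

definition ext_graph_edges :: "'a word \<Rightarrow> 'a list \<Rightarrow> ('a + 'a) set set" where
  "ext_graph_edges w u = {{Inl a, Inr b} | a b. (a, b) \<in> bi_ext w u}"

text \<open>
  No condition on the letters occurring in the word is built in: a constant word, which has no
  bispecial factor, and a Sturmian word over two letters of a larger alphabet are dendric.
\<close>

definition dendric :: "'a word \<Rightarrow> bool" where
  "dendric w \<longleftrightarrow>
     (\<forall>u. bispecial w u \<longrightarrow> is_tree (ext_graph_verts w u) (ext_graph_edges w u))"

end

theory Submission
  imports Defs "HOL-Library.Sublist"
begin

text \<open>
  A \<open>\<C>\<close>-adic word \<open>w\<close> is the first term of a sequence of infinite words, each of which is the
  image of the next under the corresponding substitution (\<open>word_chain_if_adic\<close>). Everything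
  afterwards concerns the languages \<open>L\<^sub>n\<close> of the words in this sequence: \<open>L\<^sub>n\<close> is the set of
  factors of the images of the words of \<open>L\<^bsub>n+1\<^esub>\<close>. Reversing words and exchanging the letters
  1 and 3 turns \<open>c\<^sub>1\<close> into \<open>c\<^sub>2\<close>, so that, for languages in which every word extends in both
  directions, only \<open>c\<^sub>1\<close> has to be studied.

  The directive sequences split into three classes: eventually constant ones, other sequences
  that end in squares, and the rest. Those in the rest are primitive, since the set of letters
  reached from a single letter stops at two letters only while the substitutions come in pairs
  of equals (\<open>not_squares_primitive\<close>). In each class the complexity is determined, and the
  three resulting behaviours exclude one another, which gives all the equivalences.

  For an eventually constant sequence, some \<open>L\<^sub>n\<close> belongs to a word that is constant from some
  position on, so \<open>w\<close> is eventually periodic.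

  For a sequence of squares that is not eventually constant, the letter 2 disappears at a certain
  level; the squares act on the two remaining letters as Sturmian substitutions, whose bispecial
  words all have a tree as extension graph, so the complexity is \<open>n + 1\<close> there. That the
  complexity eventually grows by one at each step is then carried up the finitely many remaining
  levels (\<open>unit_growth_img\<close>), by following the unique long right special word.

  For a primitive sequence the words are uniformly recurrent, and the extension graph of every
  bispecial word is a tree. Indeed a nonempty bispecial word of \<open>L\<^sub>n\<close> comes from a smaller
  bispecial word one or two levels below (\<open>bispecial_square\<close>, \<open>bispecial_mixed\<close>). After two equal
  substitutions the graph is the same. After two different ones it arises from the lower graph
  by merging two right extensions or by deleting one, and this preserves trees provided that the
  right extensions 1 and 2 have a common neighbour; together with its mirror image this
  side condition (\<open>good\<close>) is itself preserved. The induction starts at the empty word, where a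
  direct computation over three levels produces one of three trees up to mirror symmetry. A tree
  has one edge less than vertices, and summing this over all words of a given length says that
  the complexity has second difference zero (\<open>complexity_affine\<close>), hence equals \<open>2n + 1\<close>.

  Conversely, connected extension graphs make the complexity at least \<open>2n + 1\<close> for a recurrent
  word on three letters, which excludes the first two classes.
\<close>

section \<open>Counting edges of connected graphs\<close>

lemma graph_connected_cut:
  assumes "graph_connected V E" "x \<in> V" "x \<in> S" "y \<in> V" "y \<notin> S"
  obtains u v where "{u, v} \<in> E" "u \<in> S" "v \<notin> S"
proof -
  have "(x, y) \<in> {(u, v). {u, v} \<in> E}\<^sup>*"
    using assms unfolding graph_connected_def by blast
  then have "y \<notin> S \<Longrightarrow> \<exists>u v. {u, v} \<in> E \<and> u \<in> S \<and> v \<notin> S"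
    by (induction rule: rtrancl_induct) (use assms in auto)
  then show thesis using assms that by blast
qed

text \<open>
  A connected subgraph is grown one vertex at a time: as long as vertices are missing, some edge
  leaves the current vertex set, and it has not been used before.
\<close>
lemma graph_connected_card:
  assumes conn: "graph_connected V E" and fin: "finite V" "finite E" and sub: "E \<subseteq> Pow V"
  shows "card V \<le> card E + 1"
proof -
  have "\<exists>S F. S \<subseteq> V \<and> F \<subseteq> E \<and> card S = Suc k \<and> card F = k \<and> F \<subseteq> Pow S" if "Suc k \<le> card V" for k
    using that
  proof (induction k)
    case 0
    obtain x where "x \<in> V" using conn unfolding graph_connected_def by blast
    then show ?case by (intro exI[of _ "{x}"] exI[of _ "{}"]) auto
  next
    case (Suc k)
    then obtain S F where SF: "S \<subseteq> V" "F \<subseteq> E" "card S = Suc k" "card F = k" "F \<subseteq> Pow S"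
      by auto
    obtain x where x: "x \<in> S" using SF(3) by fastforce
    obtain y where y: "y \<in> V" "y \<notin> S" using SF Suc.prems
      by (metis Suc_n_not_le_n subsetI subset_antisym)
    obtain u v where uv: "{u, v} \<in> E" "u \<in> S" "v \<notin> S"
      using graph_connected_cut[OF conn _ x y(1,2)] x SF(1) by blast
    have "{u, v} \<notin> F" using SF(5) uv by blast
    then have "card (insert {u, v} F) = Suc k"
      using SF(2,4) finite_subset[OF _ fin(2)] by simp
    moreover have "card (insert v S) = Suc (Suc k)"
      using SF(1,3) uv(3) finite_subset[OF _ fin(1)] by simp
    ultimately show ?case using SF uv sub
      by (intro exI[of _ "insert v S"] exI[of _ "insert {u, v} F"]) auto
  qed
  moreover have "card V > 0"
    using conn fin unfolding graph_connected_def by (simp add: card_gt_0_iff)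
  ultimately obtain F where "F \<subseteq> E" "card F = card V - 1"
    by (metis Suc_pred' le_refl)
  then show ?thesis using card_mono[OF fin(2), of F] by linarith
qed

text \<open>
  Removing one edge of a cycle keeps a graph connected, and that would leave fewer edges than
  a connected graph must have.
\<close>
lemma is_tree_if_card:
  assumes conn: "graph_connected V E" and fin: "finite V" "finite E" and sub: "E \<subseteq> Pow V"
    and card: "card E + 1 = card V"
  shows "is_tree V E"
  unfolding is_tree_def
proof (intro conjI notI)
  assume "\<exists>vs. graph_cycle E vs"
  then obtain vs where vs: "length vs \<ge> 3" "distinct vs"
    "\<And>i. i < length vs \<Longrightarrow> {vs ! i, vs ! (Suc i mod length vs)} \<in> E"
    unfolding graph_cycle_def by blast
  define n where "n = length vs - 1"
  have n: "length vs = Suc n" "n \<ge> 2" using vs(1) by (auto simp: n_def)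
  define e where "e = {vs ! n, vs ! 0}"
  define R where "R = {(u, v). {u, v} \<in> E - {e}}"
  have eE: "e \<in> E" using vs(3)[of n] n by (simp add: e_def)
  have step: "(vs ! i, vs ! Suc i) \<in> R" if "i < n" for i
  proof -
    have "vs ! Suc i = vs ! 0 \<longleftrightarrow> Suc i = 0" "vs ! i = vs ! n \<longleftrightarrow> i = n" "vs ! i = vs ! 0 \<longleftrightarrow> i = 0"
      "vs ! Suc i = vs ! n \<longleftrightarrow> Suc i = n"
      using that n vs(2) by (auto simp: nth_eq_iff_index_eq)
    then have "{vs ! i, vs ! Suc i} \<noteq> e" using that n(2) by (auto simp: e_def doubleton_eq_iff)
    then show ?thesis using vs(3)[of i] that n(1) by (simp add: R_def)
  qed
  have path: "(vs ! 0, vs ! i) \<in> R\<^sup>*" if "i \<le> n" for i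
    using that
  proof (induction i)
    case (Suc i)
    then have "(vs ! 0, vs ! i) \<in> R\<^sup>*" "(vs ! i, vs ! Suc i) \<in> R" using step by auto
    then show ?case by (rule rtrancl_into_rtrancl)
  qed simp
  have "sym R" by (auto simp: R_def sym_def insert_commute)
  then have symR: "(a, b) \<in> R\<^sup>* \<Longrightarrow> (b, a) \<in> R\<^sup>*" for a b by (meson sym_rtrancl symE)
  have "{(u, v). {u, v} \<in> E} \<subseteq> R\<^sup>*"
  proof clarify
    fix u v assume uv: "{u, v} \<in> E"
    show "(u, v) \<in> R\<^sup>*"
    proof (cases "{u, v} = e")
      case True
      then have "(u = vs ! n \<and> v = vs ! 0) \<or> (u = vs ! 0 \<and> v = vs ! n)"
        by (auto simp: e_def doubleton_eq_iff)
      then show ?thesis using path[of n] symR by auto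
    next
      case False
      then show ?thesis using uv by (auto simp: R_def)
    qed
  qed
  then have "{(u, v). {u, v} \<in> E}\<^sup>* \<subseteq> R\<^sup>*" by (rule rtrancl_subset_rtrancl)
  then have "graph_connected V (E - {e})"
    using conn unfolding graph_connected_def R_def by blast
  then have "card V \<le> card (E - {e}) + 1" using graph_connected_card fin sub by blast
  moreover have "card (E - {e}) < card E" using eE fin(2) by (intro psubset_card_mono) auto
  ultimately show False using card by simp
qed (fact conn)

section \<open>Bipartite graphs as relations\<close>

definition rel_edges :: "('a \<times> 'b) set \<Rightarrow> ('a + 'b) set set" where
  "rel_edges E = {{Inl a, Inr b} | a b. (a, b) \<in> E}"

text \<open>
  Connectedness of the bipartite graph with edge set \<open>E\<close> and no isolated vertices, in the form
  that every partition of the two sides that is respected by all edges is trivial. In this form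
  it passes to images under maps of the two sides at once; \<open>rel_connected_iff_graph\<close> identifies
  it with connectedness by paths.
\<close>
definition rel_connected :: "('a \<times> 'b) set \<Rightarrow> bool" where
  "rel_connected E \<longleftrightarrow> E \<noteq> {} \<and>
     (\<forall>S T. (\<forall>(a, b)\<in>E. a \<in> S \<longleftrightarrow> b \<in> T) \<longrightarrow> (\<exists>(a, b)\<in>E. a \<in> S) \<longrightarrow> (\<forall>(a, b)\<in>E. a \<in> S))"

lemma rel_connectedD:
  assumes "rel_connected E" "\<And>a b. (a, b) \<in> E \<Longrightarrow> a \<in> S \<longleftrightarrow> b \<in> T"
    "(a0, b0) \<in> E" "a0 \<in> S" "(a, b) \<in> E"
  shows "a \<in> S" "b \<in> T"
proof -
  have "\<forall>(a, b)\<in>E. a \<in> S \<longleftrightarrow> b \<in> T" using assms(2) by blast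
  moreover have "\<exists>(a, b)\<in>E. a \<in> S" using assms(3,4) by blast
  ultimately have "\<forall>(a, b)\<in>E. a \<in> S" using assms(1) unfolding rel_connected_def by blast
  then show "a \<in> S" "b \<in> T" using assms by auto
qed

lemma rel_connectedI:
  assumes "E \<noteq> {}"
    "\<And>S T a0 b0 a b. (\<And>a b. (a, b) \<in> E \<Longrightarrow> a \<in> S \<longleftrightarrow> b \<in> T) \<Longrightarrow> (a0, b0) \<in> E \<Longrightarrow> a0 \<in> S
      \<Longrightarrow> (a, b) \<in> E \<Longrightarrow> a \<in> S"
  shows "rel_connected E"
  unfolding rel_connected_def
proof (intro conjI allI impI assms(1))
  fix S T assume a: "\<forall>(a, b)\<in>E. (a \<in> S) = (b \<in> T)" "\<exists>(a, b)\<in>E. a \<in> S"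
  then obtain a0 b0 where "(a0, b0) \<in> E" "a0 \<in> S" by blast
  then show "\<forall>(a, b)\<in>E. a \<in> S" using assms(2)[of S T a0 b0] a by blast
qed

lemma rel_connected_image:
  assumes "rel_connected E"
  shows "rel_connected (map_prod f g ` E)"
proof (rule rel_connectedI)
  show "map_prod f g ` E \<noteq> {}" using assms unfolding rel_connected_def by blast
next
  fix S T a0 b0 a b
  assume cut: "\<And>a b. (a, b) \<in> map_prod f g ` E \<Longrightarrow> (a \<in> S) = (b \<in> T)"
    and "(a0, b0) \<in> map_prod f g ` E" "a0 \<in> S" "(a, b) \<in> map_prod f g ` E"
  then obtain x0 y0 x y where xy: "(x0, y0) \<in> E" "(x, y) \<in> E" "a0 = f x0" "a = f x" by auto
  have "x \<in> f -` S"
    by (rule rel_connectedD[OF assms, of _ "g -` T" x0 y0 x y])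
      (use xy \<open>a0 \<in> S\<close> cut in force)+
  then show "a \<in> S" using xy by simp
qed

text \<open>
  From left to right, the partition is given by reachability from a fixed vertex; from right to
  left, a path between the two parts would have to cross the partition.
\<close>
lemma rel_connected_iff_graph:
  "rel_connected E \<longleftrightarrow> graph_connected (Domain E <+> Range E) (rel_edges E)"
proof
  assume conn: "rel_connected E"
  define R where "R = {(u, v). {u, v} \<in> rel_edges E}"
  have sym: "(x, y) \<in> R \<Longrightarrow> (y, x) \<in> R" for x y by (simp add: R_def insert_commute)
  have R: "(Inl a, Inr b) \<in> R" if "(a, b) \<in> E" for a b using that by (auto simp: R_def rel_edges_def)
  have "(x, y) \<in> R\<^sup>*" if x: "x \<in> Domain E <+> Range E" and y: "y \<in> Domain E <+> Range E" for x y
  proof -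
    define S where "S = {a. (x, Inl a) \<in> R\<^sup>*}"
    define T where "T = {b. (x, Inr b) \<in> R\<^sup>*}"
    have cut: "a \<in> S \<longleftrightarrow> b \<in> T" if "(a, b) \<in> E" for a b
      using R[OF that] sym[OF R[OF that]] unfolding S_def T_def
      by (auto intro: rtrancl_into_rtrancl)
    have "\<exists>a0 b0. (a0, b0) \<in> E \<and> a0 \<in> S"
    proof (cases x)
      case (Inl a)
      then show ?thesis using x by (auto simp: S_def)
    next
      case (Inr b)
      then obtain a where "(a, b) \<in> E" using x by auto
      moreover have "b \<in> T" using Inr by (simp add: T_def)
      ultimately show ?thesis using cut by blast
    qed
    then obtain a0 b0 where ab0: "(a0, b0) \<in> E" "a0 \<in> S" by blast
    show ?thesis using y rel_connectedD[OF conn cut ab0] by (auto simp: S_def T_def)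
  qed
  moreover have "Domain E <+> Range E \<noteq> {}" using conn unfolding rel_connected_def by auto
  ultimately show "graph_connected (Domain E <+> Range E) (rel_edges E)"
    unfolding graph_connected_def R_def by blast
next
  assume conn: "graph_connected (Domain E <+> Range E) (rel_edges E)"
  show "rel_connected E"
  proof (rule rel_connectedI)
    show "E \<noteq> {}" using conn unfolding graph_connected_def by auto
  next
    fix S T a0 b0 a b
    assume cut: "\<And>a b. (a, b) \<in> E \<Longrightarrow> (a \<in> S) = (b \<in> T)" and "(a0, b0) \<in> E" "a0 \<in> S" "(a, b) \<in> E"
    show "a \<in> S"
    proof (rule ccontr)
      assume "a \<notin> S"
      obtain u v where "{u, v} \<in> rel_edges E" "u \<in> S <+> T" "v \<notin> S <+> T"
        by (rule graph_connected_cut[OF conn, of "Inl a0" "S <+> T" "Inl a"])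
          (use \<open>(a0, b0) \<in> E\<close> \<open>a0 \<in> S\<close> \<open>(a, b) \<in> E\<close> \<open>a \<notin> S\<close> in auto)
      then show False using cut by (auto simp: rel_edges_def doubleton_eq_iff)
    qed
  qed
qed

lemma rel_edges_finite: "finite E \<Longrightarrow> finite (rel_edges E)"
  and card_rel_edges: "card (rel_edges E) = card E"
  and rel_edges_sub: "rel_edges E \<subseteq> Pow (Domain E <+> Range E)"
proof -
  have eq: "rel_edges E = (\<lambda>(a, b). {Inl a, Inr b}) ` E" by (auto simp: rel_edges_def)
  have "inj_on (\<lambda>(a, b). {Inl a, Inr b}) E" by (auto simp: inj_on_def doubleton_eq_iff)
  then show "card (rel_edges E) = card E" unfolding eq by (rule card_image)
  show "finite E \<Longrightarrow> finite (rel_edges E)" unfolding eq by simp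
  show "rel_edges E \<subseteq> Pow (Domain E <+> Range E)" by (auto simp: rel_edges_def)
qed

lemma rel_connected_card:
  assumes "rel_connected E" "finite E"
  shows "card (Domain E) + card (Range E) \<le> card E + 1"
proof -
  have "card (Domain E <+> Range E) \<le> card (rel_edges E) + 1"
    using assms rel_edges_finite rel_edges_sub
    by (intro graph_connected_card) (auto simp: rel_connected_iff_graph finite_Domain finite_Range)
  then show ?thesis using assms(2) by (simp add: card_rel_edges card_Plus finite_Domain finite_Range)
qed

definition rel_tree :: "('a \<times> 'b) set \<Rightarrow> bool" where
  "rel_tree E \<longleftrightarrow> rel_connected E \<and> card E + 1 = card (Domain E) + card (Range E)"

lemma is_tree_if_rel_tree:
  assumes "rel_tree E" "finite E"
  shows "is_tree (Domain E <+> Range E) (rel_edges E)"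
proof (rule is_tree_if_card)
  show "graph_connected (Domain E <+> Range E) (rel_edges E)"
    using assms(1) by (simp add: rel_tree_def rel_connected_iff_graph)
  show "finite (Domain E <+> Range E)" "finite (rel_edges E)" "rel_edges E \<subseteq> Pow (Domain E <+> Range E)"
    using assms(2) by (simp_all add: finite_Domain finite_Range rel_edges_finite rel_edges_sub)
  show "card (rel_edges E) + 1 = card (Domain E <+> Range E)"
    using assms by (simp add: rel_tree_def card_rel_edges card_Plus finite_Domain finite_Range)
qed

lemma rel_tree_image:
  assumes "rel_tree E" "finite E" "inj_on f (Domain E)" "inj_on g (Range E)"
  shows "rel_tree (map_prod f g ` E)"
proof -
  have "E \<subseteq> Domain E \<times> Range E" by auto
  then have "inj_on (map_prod f g) E" by (rule inj_on_subset[OF map_prod_inj_on[OF assms(3,4)]])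
  then have card: "card (map_prod f g ` E) = card E" by (rule card_image)
  have dom: "Domain (map_prod f g ` E) = f ` Domain E" unfolding Domain_fst by (simp add: image_image)
  have ran: "Range (map_prod f g ` E) = g ` Range E" unfolding Range_snd by (simp add: image_image)
  have "rel_connected (map_prod f g ` E)"
    using assms(1) unfolding rel_tree_def by (intro rel_connected_image) blast
  then show ?thesis
    using assms(1) unfolding rel_tree_def card dom ran card_image[OF assms(3)] card_image[OF assms(4)]
    by blast
qed

section \<open>Extension graphs over three letters\<close>

lemma finite_letter_set [simp, intro]: "finite (S :: letter set)" by (rule finite_subset[OF subset_UNIV]) simp
lemma finite_letter_rel [simp, intro]: "finite (E :: (letter \<times> letter) set)"
  by (rule finite_subset[OF subset_UNIV]) simp

lemma UNIV_letter: "UNIV = {L1, L2, L3}" by (auto intro: letter.exhaust)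
lemma card_UNIV_letter: "card (UNIV :: letter set) = 3" by (simp add: UNIV_letter)

text \<open>
  The functions \<open>last1\<close> and \<open>first1\<close> give the last and the first letter of the image of a letter
  under \<open>c1\<close>. The first is a bijection, the second identifies the letters 1 and 2: left
  extensions survive the substitution, while right extensions may merge.
\<close>
primrec last1 :: "letter \<Rightarrow> letter" where
  "last1 L1 = L1" | "last1 L2 = L3" | "last1 L3 = L2"

primrec first1 :: "letter \<Rightarrow> letter" where
  "first1 L1 = L1" | "first1 L2 = L1" | "first1 L3 = L2"

text \<open>
  Together with the reversal of words, this exchange of letters conjugates \<open>c1\<close> and \<open>c2\<close>.
\<close>
primrec mirror_letter :: "letter \<Rightarrow> letter" where
  "mirror_letter L1 = L3" | "mirror_letter L2 = L2" | "mirror_letter L3 = L1"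

lemma mirror_letter_invol [simp]: "mirror_letter (mirror_letter a) = a" by (cases a) auto
lemma inj_mirror_letter: "inj mirror_letter" by (metis injI mirror_letter_invol)
lemma inj_last1: "inj last1"
  by (rule injI) (metis last1.simps letter.distinct letter.exhaust)

text \<open>
  The invariant for extension graphs of bispecial words. The condition on the right extensions 1
  and 2 makes the graph survive an application of \<open>c1\<close>, which identifies these two. The condition
  on the left extensions 2 and 3 is its mirror image and does the same for \<open>c2\<close>.
\<close>
definition good :: "(letter \<times> letter) set \<Rightarrow> bool" where
  "good E \<longleftrightarrow> rel_tree E
     \<and> (L1 \<in> Range E \<longrightarrow> L2 \<in> Range E \<longrightarrow> (\<exists>a. (a, L1) \<in> E \<and> (a, L2) \<in> E))
     \<and> (L2 \<in> Domain E \<longrightarrow> L3 \<in> Domain E \<longrightarrow> (\<exists>b. (L2, b) \<in> E \<and> (L3, b) \<in> E))"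

definition mirror_rel :: "(letter \<times> letter) set \<Rightarrow> (letter \<times> letter) set" where
  "mirror_rel E = {(a, b). (mirror_letter b, mirror_letter a) \<in> E}"

lemma mirror_rel_invol [simp]: "mirror_rel (mirror_rel E) = E" by (simp add: mirror_rel_def)

lemma rel_tree_converse:
  assumes "rel_tree E" "finite E" shows "rel_tree (E\<inverse>)"
proof -
  have "rel_connected (E\<inverse>)"
  proof (rule rel_connectedI)
    show "E\<inverse> \<noteq> {}" using assms unfolding rel_tree_def rel_connected_def by auto
  next
    fix S T a0 b0 a b
    assume cut: "\<And>a b. (a, b) \<in> E\<inverse> \<Longrightarrow> (a \<in> S) = (b \<in> T)"
      and ab: "(a0, b0) \<in> E\<inverse>" "a0 \<in> S" "(a, b) \<in> E\<inverse>"
    show "a \<in> S"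
      by (rule rel_connectedD(2)[of E T S b0 a0 b a]) (use assms ab cut in \<open>auto simp: rel_tree_def\<close>)
  qed
  then show ?thesis using assms by (simp add: rel_tree_def card_inverse add.commute)
qed

lemma mirror_rel_altdef: "mirror_rel E = map_prod mirror_letter mirror_letter ` (E\<inverse>)"
proof (intro equalityI subrelI)
  fix a b assume "(a, b) \<in> mirror_rel E"
  then show "(a, b) \<in> map_prod mirror_letter mirror_letter ` (E\<inverse>)"
    by (intro image_eqI[of _ _ "(mirror_letter a, mirror_letter b)"]) (simp_all add: mirror_rel_def)
qed (auto simp: mirror_rel_def)

lemma rel_tree_mirror: assumes "rel_tree E" shows "rel_tree (mirror_rel E)"
  unfolding mirror_rel_altdef
  by (rule rel_tree_image[OF rel_tree_converse[OF assms finite_letter_rel] finite_letter_rel])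
    (rule inj_on_subset[OF inj_mirror_letter subset_UNIV])+

lemma good_mirror: assumes "good E" shows "good (mirror_rel E)"
proof -
  have "\<exists>a. (a, L1) \<in> mirror_rel E \<and> (a, L2) \<in> mirror_rel E"
    if "L1 \<in> Range (mirror_rel E)" "L2 \<in> Range (mirror_rel E)"
  proof -
    have "L3 \<in> Domain E" "L2 \<in> Domain E" using that by (auto simp: mirror_rel_def)
    then obtain b where "(L2, b) \<in> E" "(L3, b) \<in> E" using assms unfolding good_def by blast
    then show ?thesis by (intro exI[of _ "mirror_letter b"]) (simp add: mirror_rel_def)
  qed
  moreover have "\<exists>b. (L2, b) \<in> mirror_rel E \<and> (L3, b) \<in> mirror_rel E"
    if "L2 \<in> Domain (mirror_rel E)" "L3 \<in> Domain (mirror_rel E)"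
  proof -
    have "L1 \<in> Range E" "L2 \<in> Range E" using that by (auto simp: mirror_rel_def)
    then obtain a where "(a, L1) \<in> E" "(a, L2) \<in> E" using assms unfolding good_def by blast
    then show ?thesis by (intro exI[of _ "mirror_letter a"]) (simp add: mirror_rel_def)
  qed
  ultimately show ?thesis using assms rel_tree_mirror unfolding good_def by blast
qed

text \<open>
  Merging two right vertices with a common neighbour keeps the graph connected and loses one
  vertex. At least one edge is lost, and exactly one because a connected graph cannot have fewer
  edges. So the common neighbour is unique.
\<close>
lemma merge_columns:
  assumes t: "rel_tree E" and a: "(a, L1) \<in> E" "(a, L2) \<in> E"
  shows "rel_tree (map_prod last1 first1 ` E)"
    and "(a', L1) \<in> E \<Longrightarrow> (a', L2) \<in> E \<Longrightarrow> a' = a"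
proof -
  let ?M = "map_prod last1 first1 ` E"
  have dom: "Domain ?M = last1 ` Domain E" unfolding Domain_fst by (simp add: image_image)
  have ran: "Range ?M = first1 ` Range E" unfolding Range_snd by (simp add: image_image)
  have conn: "rel_connected ?M" using t by (intro rel_connected_image) (simp add: rel_tree_def)
  have cd: "card (Domain ?M) = card (Domain E)"
    unfolding dom by (intro card_image inj_on_subset[OF inj_last1] subset_UNIV)
  have "Range E = insert L2 (Range E - {L2})" "first1 ` Range E = first1 ` (Range E - {L2})"
    using a by (auto simp: image_iff) (metis DiffI Range.intros first1.simps(1,2) letter.distinct(1) singletonD)
  moreover have "inj_on first1 (Range E - {L2})"
    by (rule inj_onI) (metis DiffE first1.simps letter.distinct letter.exhaust singletonI)
  ultimately have cr: "card (Range E) = card (Range ?M) + 1"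
    unfolding ran by (metis card_Suc_Diff1 card_image finite_letter_set insertI1 Suc_eq_plus1)
  have le: "card (Domain E) + card (Range E) \<le> card ?M + 2"
    using rel_connected_card[OF conn] cd cr by simp
  \<comment> \<open>The edges at 2 whose left end is also joined to 1 have images that occur anyway.\<close>
  have drop: "card ?M \<le> card E - card X" if "X \<subseteq> {(x, L2) | x. (x, L1) \<in> E \<and> (x, L2) \<in> E}" for X
  proof -
    have "map_prod last1 first1 p \<in> map_prod last1 first1 ` (E - X)" if "p \<in> E" for p
    proof (cases "p \<in> X")
      case True
      then obtain x where "p = (x, L2)" "(x, L1) \<in> E" using \<open>X \<subseteq> _\<close> by auto
      moreover have "(x, L1) \<notin> X" using \<open>X \<subseteq> _\<close> by auto
      ultimately show ?thesis by (intro image_eqI[of _ _ "(x, L1)"]) auto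
    qed (use that in auto)
    then have "?M \<subseteq> map_prod last1 first1 ` (E - X)" by auto
    then have "card ?M \<le> card (E - X)"
      by (meson card_image_le card_mono finite_imageI finite_letter_rel le_trans)
    moreover have "X \<subseteq> E" using \<open>X \<subseteq> _\<close> by auto
    ultimately show ?thesis by (simp add: card_Diff_subset)
  qed
  have tc: "card E + 1 = card (Domain E) + card (Range E)" using t by (simp add: rel_tree_def)
  have "card E > 0" using a by (auto simp: card_gt_0_iff)
  then have "card ?M + 1 = card E" using drop[of "{(a, L2)}"] a le tc by simp
  then show "rel_tree ?M" using conn cd cr tc by (simp add: rel_tree_def)
  show "a' = a" if "(a', L1) \<in> E" "(a', L2) \<in> E"
  proof (rule ccontr)
    assume "a' \<noteq> a"
    then have "card {(a, L2), (a', L2)} = 2" by simp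
    moreover have "card {(a, L2), (a', L2)} \<le> card E" using a that by (intro card_mono) auto
    ultimately show False using drop[of "{(a, L2), (a', L2)}"] a that le tc by auto
  qed
qed

lemma rel_connected_two_columns:
  assumes conn: "rel_connected M" and ran: "Range M = {b, c}"
  shows "\<exists>x. (x, b) \<in> M \<and> (x, c) \<in> M"
proof (rule ccontr)
  assume no: "\<not> ?thesis"
  then have "b \<noteq> c" using ran by blast
  obtain x y where xy: "(x, b) \<in> M" "(y, c) \<in> M" using ran by blast
  have "c \<in> {b}"
    by (rule rel_connectedD(2)[OF conn, of "{x. (x, b) \<in> M}" _ x b y c])
      (use xy no ran in blast)+
  then show False using \<open>b \<noteq> c\<close> by simp
qed

text \<open>
  At most the two right vertices 1 and 2 remain, and in a connected graph two right vertices
  that exhaust their side have a common neighbour.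
\<close>
lemma good_merge_columns:
  assumes g: "good E"
  shows "good (map_prod last1 first1 ` E)"
proof -
  let ?M = "map_prod last1 first1 ` E"
  have tr: "rel_tree E" using g by (simp add: good_def)
  have M: "(x, y) \<in> ?M \<longleftrightarrow> (\<exists>a b. (a, b) \<in> E \<and> x = last1 a \<and> y = first1 b)" for x y by auto
  have f: "L1 = first1 b \<longleftrightarrow> b = L1 \<or> b = L2" "L2 = first1 b \<longleftrightarrow> b = L3" for b by (cases b; simp)+
  have l: "L1 = last1 b \<longleftrightarrow> b = L1" "L2 = last1 b \<longleftrightarrow> b = L3" "L3 = last1 b \<longleftrightarrow> b = L2" for b
    by (cases b; simp)+
  have tM: "rel_tree ?M"
  proof (cases "L1 \<in> Range E \<and> L2 \<in> Range E")
    case True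
    then show ?thesis using g merge_columns(1)[OF tr] unfolding good_def by blast
  next
    case False
    have "inj_on first1 (Range E)"
    proof (rule inj_onI)
      fix x y assume "x \<in> Range E" "y \<in> Range E" "first1 x = first1 y"
      then show "x = y" using False by - (cases x; cases y; simp)
    qed
    then show ?thesis
      using tr by (intro rel_tree_image inj_on_subset[OF inj_last1]) auto
  qed
  have "\<exists>x. (x, L1) \<in> ?M \<and> (x, L2) \<in> ?M" if both: "L1 \<in> Range ?M" "L2 \<in> Range ?M"
  proof (rule rel_connected_two_columns)
    show "rel_connected ?M" using tM by (simp add: rel_tree_def)
    have "first1 b \<in> {L1, L2}" for b by (cases b) auto
    then have "Range ?M \<subseteq> {L1, L2}" by auto
    then show "Range ?M = {L1, L2}" using both by (intro equalityI) (simp_all only: insert_subset empty_subsetI)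
  qed
  moreover have "\<exists>y. (L2, y) \<in> ?M \<and> (L3, y) \<in> ?M" if "L2 \<in> Domain ?M" "L3 \<in> Domain ?M"
  proof -
    have "L3 \<in> Domain E" "L2 \<in> Domain E" using that by (auto simp: l)
    then obtain b where "(L2, b) \<in> E" "(L3, b) \<in> E" using g unfolding good_def by blast
    then show ?thesis by (intro exI[of _ "first1 b"]) (force simp: M)
  qed
  ultimately show ?thesis using tM unfolding good_def by blast
qed

text \<open>
  Without the right vertex 3, all left vertices that keep an edge are joined to 1 or 2, which
  have exactly one common neighbour; hence a tree remains.
\<close>
lemma good_restrict_columns:
  assumes g: "good E" and r: "L1 \<in> Range E" "L2 \<in> Range E"
  shows "good (map_prod last1 (\<lambda>b. if b = L1 then L2 else L3) ` {p \<in> E. snd p \<noteq> L3})" (is "good ?M")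
proof -
  have tr: "rel_tree E" using g by (simp add: good_def)
  obtain a where a: "(a, L1) \<in> E" "(a, L2) \<in> E" using g r unfolding good_def by blast
  define D where "D b = {x. (x, b) \<in> E}" for b
  define E0 where "E0 = D L1 \<times> {L1} \<union> D L2 \<times> {L2}"
  have E0: "(x, b) \<in> E0 \<longleftrightarrow> (x, b) \<in> E \<and> b \<noteq> L3" for x b
    by (cases b) (auto simp: E0_def D_def)
  have conn: "rel_connected E0"
  proof (rule rel_connectedI)
    show "E0 \<noteq> {}" using a(1) E0 by blast
  next
    fix S T a0 b0 x b
    assume cut: "\<And>a b. (a, b) \<in> E0 \<Longrightarrow> (a \<in> S) = (b \<in> T)" and e: "(a0, b0) \<in> E0" "a0 \<in> S" "(x, b) \<in> E0"
    have "b0 \<in> {L1, L2}" "b \<in> {L1, L2}" using e by (auto simp: E0_def)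
    moreover have "L1 \<in> T \<longleftrightarrow> L2 \<in> T" using cut[of a L1] cut[of a L2] a E0 by simp
    ultimately show "x \<in> S" using cut[OF e(1)] cut[OF e(3)] e(2) by auto
  qed
  have "a' = a" if "a' \<in> D L1 \<inter> D L2" for a'
    using merge_columns(2)[OF tr a, of a'] that by (simp add: D_def)
  moreover have "a \<in> D L1 \<inter> D L2" using a by (simp add: D_def)
  ultimately have "D L1 \<inter> D L2 = {a}" by blast
  then have "card (D L1) + card (D L2) = card (D L1 \<union> D L2) + 1"
    using card_Un_Int[of "D L1" "D L2"] by simp
  moreover have "card E0 = card (D L1) + card (D L2)"
    unfolding E0_def by (subst card_Un_disjoint) auto
  moreover have "Domain E0 = D L1 \<union> D L2" "Range E0 = {L1, L2}"
    using a by (auto simp: E0_def D_def)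
  ultimately have t0: "rel_tree E0" using conn by (simp add: rel_tree_def)
  have M: "?M = map_prod last1 (\<lambda>b. if b = L1 then L2 else L3) ` E0"
    by (rule arg_cong[of _ _ "image _"]) (auto simp: E0)
  have tM: "rel_tree ?M"
    unfolding M by (rule rel_tree_image[OF t0 finite_letter_rel inj_on_subset[OF inj_last1]])
      (auto simp: E0_def inj_on_def)
  have "\<exists>y. (L2, y) \<in> ?M \<and> (L3, y) \<in> ?M" if dom: "L2 \<in> Domain ?M" "L3 \<in> Domain ?M"
  proof -
    have l: "L2 = last1 x \<longleftrightarrow> x = L3" "L3 = last1 x \<longleftrightarrow> x = L2" for x by (cases x; simp)+
    obtain b b' where b: "(L2, b) \<in> E" "b \<noteq> L3" "(L3, b') \<in> E" "b' \<noteq> L3"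
      using dom by (auto simp: l)
    obtain c where c: "(L2, c) \<in> E" "(L3, c) \<in> E" using b g unfolding good_def by blast
    have "\<exists>y. (L2, y) \<in> E \<and> (L3, y) \<in> E \<and> y \<noteq> L3"
    proof (rule ccontr)
      assume no: "\<not> ?thesis"
      then have "c = L3" "b \<noteq> b'" using b c by blast+
      moreover have "a \<noteq> L2" "a \<noteq> L3" using no a b by (metis letter.exhaust)+
      then have "a = L1" by (cases a) auto
      \<comment> \<open>Otherwise these edges form a cycle through all six vertices, and \<open>E\<close> has too many edges.\<close>
      ultimately have sub: "{(L1, L1), (L1, L2), (L2, b), (L3, b'), (L2, L3), (L3, L3)} \<subseteq> E"
        using a b c by auto
      have "card {(L1, L1), (L1, L2), (L2, b), (L3, b'), (L2, L3), (L3, L3)} = 6"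
        using b by simp
      then have "6 \<le> card E" using card_mono[OF _ sub] by simp
      moreover have "card (Domain E) \<le> 3" "card (Range E) \<le> 3"
        using card_mono[of "UNIV :: letter set"] by (auto simp: card_UNIV_letter)
      ultimately show False using tr by (simp add: rel_tree_def)
    qed
    then obtain y where "(L2, y) \<in> E" "(L3, y) \<in> E" "y \<noteq> L3" by blast
    then show ?thesis by (intro exI[of _ "if y = L1 then L2 else L3"]) force
  qed
  moreover have "L1 \<notin> Range ?M" by (auto split: if_splits)
  ultimately show ?thesis using tM unfolding good_def by blast
qed

section \<open>Extendable languages and their complexity\<close>

definition right_extendable :: "'a list set \<Rightarrow> bool" where
  "right_extendable L \<longleftrightarrow> [] \<in> L \<and> (\<forall>v\<in>L. \<forall>u. sublist u v \<longrightarrow> u \<in> L) \<and> (\<forall>u\<in>L. \<exists>b. u @ [b] \<in> L)"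

text \<open>
  The language of an infinite word is always closed under factors and extendable to the right;
  recurrence makes it extendable to the left as well, and only then is the notion symmetric under
  reversal.
\<close>
definition biextendable :: "'a list set \<Rightarrow> bool" where
  "biextendable L \<longleftrightarrow> right_extendable L \<and> (\<forall>u\<in>L. \<exists>a. a # u \<in> L)"

definition level :: "'a list set \<Rightarrow> nat \<Rightarrow> 'a list set" where
  "level L n = {u \<in> L. length u = n}"

definition lext :: "'a list set \<Rightarrow> 'a list \<Rightarrow> 'a set" where
  "lext L u = {a. a # u \<in> L}"

definition rext :: "'a list set \<Rightarrow> 'a list \<Rightarrow> 'a set" where
  "rext L u = {b. u @ [b] \<in> L}"

definition ext :: "'a list set \<Rightarrow> 'a list \<Rightarrow> ('a \<times> 'a) set" where
  "ext L u = {(a, b). a # u @ [b] \<in> L}"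

definition bispecial_in :: "'a list set \<Rightarrow> 'a list \<Rightarrow> bool" where
  "bispecial_in L u \<longleftrightarrow> card (lext L u) > 1 \<and> card (rext L u) > 1"

lemma biextendable_right [intro]: "biextendable L \<Longrightarrow> right_extendable L" by (simp add: biextendable_def)

lemma right_extendable_Nil: "right_extendable L \<Longrightarrow> [] \<in> L" by (simp add: right_extendable_def)

lemma right_extendable_sublist: "right_extendable L \<Longrightarrow> v \<in> L \<Longrightarrow> sublist u v \<Longrightarrow> u \<in> L"
  by (auto simp: right_extendable_def)

lemma right_extendable_append: "right_extendable L \<Longrightarrow> u @ v \<in> L \<Longrightarrow> u \<in> L \<and> v \<in> L"
  by (auto elim: right_extendable_sublist)

lemma right_extendable_Cons: "right_extendable L \<Longrightarrow> a # v \<in> L \<Longrightarrow> v \<in> L"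
  using right_extendable_append[of L "[a]" v] by simp

lemma right_extendable_ext: "right_extendable L \<Longrightarrow> u \<in> L \<Longrightarrow> \<exists>b. u @ [b] \<in> L"
  by (simp add: right_extendable_def)

lemma biextendable_left: "biextendable L \<Longrightarrow> u \<in> L \<Longrightarrow> \<exists>a. a # u \<in> L"
  by (simp add: biextendable_def)

lemma Domain_ext: "right_extendable L \<Longrightarrow> Domain (ext L u) = lext L u"
  using right_extendable_append[of L "_ # u" "[_]"] right_extendable_ext[of L "_ # u"]
  by (auto simp: ext_def lext_def Domain_iff)

lemma Range_ext: "biextendable L \<Longrightarrow> Range (ext L u) = rext L u"
  using right_extendable_Cons[of L] biextendable_left[of L "u @ [_]"]
  by (auto simp: ext_def rext_def Range_iff)

lemma finite_level [simp]: "finite (level (L :: 'a::finite list set) n)"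
proof -
  have "level L n \<subseteq> {u. set u \<subseteq> UNIV \<and> length u = n}" by (auto simp: level_def)
  then show ?thesis using finite_lists_length_eq[of "UNIV :: 'a set"] finite_subset finite by blast
qed

text \<open>
  The words of one length are counted through the words of another length that they extend.
\<close>
lemma card_level_fibres:
  fixes L :: "'a::finite list set" and X :: "'a list \<Rightarrow> 'b::finite set"
  assumes "inj (\<lambda>(u, x). f u x)" "\<And>v. v \<in> level L m \<longleftrightarrow> (\<exists>u\<in>level L n. \<exists>x\<in>X u. v = f u x)"
  shows "card (level L m) = (\<Sum>u\<in>level L n. card (X u))"
proof -
  have "level L m = (\<lambda>(u, x). f u x) ` Sigma (level L n) X" using assms(2) by force
  then have "card (level L m) = card (Sigma (level L n) X)"
    using card_image[OF inj_on_subset[OF assms(1) subset_UNIV]] by simp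
  then show ?thesis by simp
qed

lemma card_level_rext:
  assumes L: "right_extendable (L :: 'a::finite list set)"
  shows "card (level L (Suc n)) = (\<Sum>u\<in>level L n. card (rext L u))"
proof (rule card_level_fibres[where f = "\<lambda>u b. u @ [b]"])
  show "v \<in> level L (Suc n) \<longleftrightarrow> (\<exists>u\<in>level L n. \<exists>b\<in>rext L u. v = u @ [b])" for v
    using right_extendable_append[OF L, of _ "[_]"]
    by (cases v rule: rev_cases) (auto simp: level_def rext_def)
qed (auto simp: inj_def)

lemma card_level_lext:
  assumes L: "right_extendable (L :: 'a::finite list set)"
  shows "card (level L (Suc n)) = (\<Sum>u\<in>level L n. card (lext L u))"
proof (rule card_level_fibres[where f = "\<lambda>u a. a # u"])
  show "v \<in> level L (Suc n) \<longleftrightarrow> (\<exists>u\<in>level L n. \<exists>a\<in>lext L u. v = a # u)" for v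
    using right_extendable_Cons[OF L] by (cases v) (auto simp: level_def lext_def)
qed (auto simp: inj_def)

lemma card_level_ext:
  assumes L: "right_extendable (L :: 'a::finite list set)"
  shows "card (level L (Suc (Suc n))) = (\<Sum>u\<in>level L n. card (ext L u))"
proof (rule card_level_fibres[where f = "\<lambda>u (a, b). a # u @ [b]"])
  show "v \<in> level L (Suc (Suc n)) \<longleftrightarrow> (\<exists>u\<in>level L n. \<exists>x\<in>ext L u. v = (case x of (a, b) \<Rightarrow> a # u @ [b]))" for v
  proof
    assume v: "v \<in> level L (Suc (Suc n))"
    then obtain a v' where "v = a # v'" "v' \<noteq> []" by (cases v) (fastforce simp: level_def)+
    then obtain u b where "v = a # u @ [b]" by (cases v' rule: rev_cases) auto
    then show "\<exists>u\<in>level L n. \<exists>x\<in>ext L u. v = (case x of (a, b) \<Rightarrow> a # u @ [b])"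
      using v right_extendable_Cons[OF L, of a "u @ [b]"] right_extendable_append[OF L, of u "[b]"]
      by (intro bexI[of _ u] bexI[of _ "(a, b)"]) (auto simp: level_def ext_def)
  qed (auto simp: level_def ext_def)
qed (auto simp: inj_def)

lemma Domain_singleton: assumes "Domain E = {a}" shows "E = {a} \<times> Range E"
proof (intro equalityI subrelI)
  fix x y assume xy: "(x, y) \<in> E"
  then have "x \<in> Domain E" by (rule DomainI)
  then show "(x, y) \<in> {a} \<times> Range E" using RangeI[OF xy] unfolding assms by simp
next
  fix x y assume "(x, y) \<in> {a} \<times> Range E"
  then obtain x' where x': "(x', y) \<in> E" "x = a" by auto
  then have "x' \<in> Domain E" by (blast intro: DomainI)
  then show "(x, y) \<in> E" using x' unfolding assms by simp
qed

lemma Range_singleton: "Range E = {b} \<Longrightarrow> E = Domain E \<times> {b}"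
  using Domain_singleton[of "E\<inverse>" b] by auto

text \<open>
  For a word with a single left or right extension, the extension graph is a star.
\<close>
lemma card_ext_not_bispecial:
  fixes L :: "'a::finite list set"
  assumes L: "biextendable L" and u: "u \<in> L" and "\<not> bispecial_in L u"
  shows "card (ext L u) + 1 = card (lext L u) + card (rext L u)"
proof -
  note R = biextendable_right[OF L]
  have fin: "finite (lext L u)" "finite (rext L u)" by simp_all
  have ne: "lext L u \<noteq> {}" "rext L u \<noteq> {}"
    using L u by (auto simp: lext_def rext_def biextendable_def right_extendable_def)
  have "card (lext L u) > 0" "card (rext L u) > 0" using ne fin by (simp_all add: card_gt_0_iff)
  then consider "card (lext L u) = 1" | "card (rext L u) = 1"
    using assms(3) unfolding bispecial_in_def by linarith
  then show ?thesis
  proof cases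
    case 1
    then obtain a where "lext L u = {a}" by (rule card_1_singletonE)
    then have "ext L u = {a} \<times> Range (ext L u)" using Domain_ext[OF R, of u] by (intro Domain_singleton) simp
    then have "ext L u = {a} \<times> rext L u" unfolding Range_ext[OF L] .
    then show ?thesis using 1 by (simp add: card_cartesian_product)
  next
    case 2
    then obtain b where "rext L u = {b}" by (rule card_1_singletonE)
    then have "ext L u = Domain (ext L u) \<times> {b}" using Range_ext[OF L, of u] by (intro Range_singleton) simp
    then have "ext L u = lext L u \<times> {b}" unfolding Domain_ext[OF R] .
    then show ?thesis using 2 by (simp add: card_cartesian_product)
  qed
qed

text \<open>
  The words of length \<open>n + 1\<close> are counted by the left as well as by the right extensions of the
  words of length \<open>n\<close>, those of length \<open>n + 2\<close> by the edges of their extension graphs. So the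
  second difference of the complexity is the sum of edges minus vertices plus one over all words of
  length \<open>n\<close>, which vanishes for trees.
\<close>
lemma complexity_affine:
  fixes L :: "'a::finite list set"
  assumes L: "biextendable L"
    and tree: "\<And>u. bispecial_in L u \<Longrightarrow> card (ext L u) + 1 = card (lext L u) + card (rext L u)"
  shows "card (level L n) + n = n * card (level L 1) + 1"
proof -
  note R = biextendable_right[OF L]
  have diff: "card (level L (Suc (Suc n))) + card (level L n) = 2 * card (level L (Suc n))" for n
  proof -
    have "(\<Sum>u\<in>level L n. card (ext L u) + 1) = (\<Sum>u\<in>level L n. card (lext L u) + card (rext L u))"
      using tree card_ext_not_bispecial[OF L] by (intro sum.cong) (auto simp: level_def)
    then show ?thesis
      by (simp add: sum.distrib sum_Suc card_level_ext[OF R] flip: card_level_lext[OF R] card_level_rext[OF R])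
  qed
  have "level L 0 = {[]}" using right_extendable_Nil[OF R] by (auto simp: level_def)
  then have "card (level L 0) = 1" by simp
  then have "card (level L n) + n = n * card (level L 1) + 1
      \<and> card (level L (Suc n)) + Suc n = Suc n * card (level L 1) + 1" for n
  proof (induction n)
    case (Suc n)
    then show ?case using diff[of n] by (simp add: algebra_simps)
  qed simp
  then show ?thesis by blast
qed

text \<open>
  With connected graphs in place of trees, the second difference is nonnegative.
\<close>
lemma complexity_ge_affine:
  fixes L :: "'a::finite list set"
  assumes L: "biextendable L"
    and conn: "\<And>u. bispecial_in L u \<Longrightarrow> card (lext L u) + card (rext L u) \<le> card (ext L u) + 1"
  shows "n * card (level L 1) + 1 \<le> card (level L n) + n"
proof -
  note R = biextendable_right[OF L]
  have diff: "2 * card (level L (Suc n)) \<le> card (level L (Suc (Suc n))) + card (level L n)" for n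
  proof -
    have "(\<Sum>u\<in>level L n. card (lext L u) + card (rext L u)) \<le> (\<Sum>u\<in>level L n. card (ext L u) + 1)"
    proof (rule sum_mono)
      fix u assume "u \<in> level L n"
      then show "card (lext L u) + card (rext L u) \<le> card (ext L u) + 1"
        using conn[of u] card_ext_not_bispecial[OF L, of u] by (cases "bispecial_in L u") (auto simp: level_def)
    qed
    then show ?thesis
      by (simp add: sum.distrib sum_Suc card_level_ext[OF R] flip: card_level_lext[OF R] card_level_rext[OF R])
  qed
  have "level L 0 = {[]}" using right_extendable_Nil[OF R] by (auto simp: level_def)
  then have one: "card (level L 0) = 1" by simp
  have step: "card (level L n) + card (level L 1) \<le> card (level L (Suc n)) + 1" for n
  proof (induction n)
    case (Suc n)
    then show ?case using diff[of n] by simp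
  qed (use one in simp)
  show ?thesis
  proof (induction n)
    case (Suc n)
    then show ?case using step[of n] by simp
  qed (use one in simp)
qed

section \<open>Languages of infinite words and images under substitutions\<close>

lemma subsequence_append': "i \<le> j \<Longrightarrow> j \<le> k \<Longrightarrow> w [i \<rightarrow> k] = w [i \<rightarrow> j] @ w [j \<rightarrow> k]"
  unfolding subsequence_def by (metis le_add_diff_inverse map_append upt_add_eq_append)

lemma infix_of_prefix:
  assumes "w [0 \<rightarrow> k] = A @ u @ B"
  shows "u = w [length A \<rightarrow> length A + length u]" "length A + length u \<le> k"
proof -
  have len: "k = length A + length u + length B" using arg_cong[OF assms, of length] by simp
  have "u = take (length u) (drop (length A) (A @ u @ B))" by simp
  also have "\<dots> = w [length A \<rightarrow> length A + length u]" unfolding assms[symmetric] using len by simp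
  finally show "u = w [length A \<rightarrow> length A + length u]" .
  show "length A + length u \<le> k" using len by simp
qed

lemma language_iff: "u \<in> language w \<longleftrightarrow> (\<exists>k. sublist u (w [0 \<rightarrow> k]))"
proof
  assume "u \<in> language w"
  then obtain i j where "u = w [i \<rightarrow> j]" "i \<le> j" by (auto simp: language_def)
  then have "w [0 \<rightarrow> j] = w [0 \<rightarrow> i] @ u @ []" using subsequence_append'[of 0 i j w] by simp
  then show "\<exists>k. sublist u (w [0 \<rightarrow> k])" unfolding sublist_def by blast
next
  assume "\<exists>k. sublist u (w [0 \<rightarrow> k])"
  then obtain k A B where "w [0 \<rightarrow> k] = A @ u @ B" by (auto simp: sublist_def)
  from infix_of_prefix(1)[OF this] show "u \<in> language w" unfolding language_def by fastforce
qed

lemma prefix_in_language: "w [0 \<rightarrow> k] \<in> language w" by (auto simp: language_iff)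

lemma right_extendable_language: "right_extendable (language w)"
  unfolding right_extendable_def
proof (intro conjI ballI allI impI)
  show "[] \<in> language w" by (simp add: language_iff)
  fix u assume u: "u \<in> language w"
  show "v \<in> language w" if "sublist v u" for v
    using u that sublist_order.order_trans unfolding language_iff by blast
  obtain k A B where k: "w [0 \<rightarrow> k] = A @ u @ B" using u by (auto simp: language_iff sublist_def)
  have "w [0 \<rightarrow> Suc k] = A @ u @ B @ [w k]" using k by simp
  then have "w [0 \<rightarrow> Suc k] = A @ (u @ [hd (B @ [w k])]) @ tl (B @ [w k])" by (cases B) auto
  then show "\<exists>b. u @ [b] \<in> language w" unfolding language_iff sublist_def by blast
qed

lemma complexity_level: "complexity w n = card (level (language w) n)"
  by (simp add: complexity_def level_def)

definition morphism :: "('a list \<Rightarrow> 'b list) \<Rightarrow> bool" where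
  "morphism c \<longleftrightarrow> c [] = [] \<and> (\<forall>u v. c (u @ v) = c u @ c v) \<and> (\<forall>a. c [a] \<noteq> [])"

definition img :: "('a list \<Rightarrow> 'b list) \<Rightarrow> 'a list set \<Rightarrow> 'b list set" where
  "img c L = {u. \<exists>v\<in>L. sublist u (c v)}"

text \<open>
  The infinite word \<open>w\<close> is the image of \<open>w'\<close> under \<open>c\<close>; for nonerasing \<open>c\<close> the images of the prefixes
  determine it. As a relation this avoids infinite concatenations.
\<close>
definition word_image :: "('a list \<Rightarrow> 'b list) \<Rightarrow> 'a word \<Rightarrow> 'b word \<Rightarrow> bool" where
  "word_image c w' w \<longleftrightarrow> (\<forall>k. w [0 \<rightarrow> length (c (w' [0 \<rightarrow> k]))] = c (w' [0 \<rightarrow> k]))"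


lemma morphism_simps:
  assumes "morphism c"
  shows "c [] = []" "c (u @ v) = c u @ c v" "c [a] \<noteq> []"
  using assms by (auto simp: morphism_def)

lemma morphism_Cons: "morphism c \<Longrightarrow> c (a # u) = c [a] @ c u"
  using morphism_simps(2)[of c "[a]" u] by simp

lemma morphism_length: "morphism c \<Longrightarrow> length u \<le> length (c u)"
proof (induction u)
  case (Cons a u)
  then show ?case using morphism_simps(3)[of c a] by (cases "c [a]") (auto simp: morphism_Cons[of c a u])
qed simp

lemma morphism_eq_Nil: "morphism c \<Longrightarrow> c u = [] \<longleftrightarrow> u = []"
  using morphism_length[of c u] morphism_simps(1)[of c] by auto

lemma morphism_sublist: "morphism c \<Longrightarrow> sublist u v \<Longrightarrow> sublist (c u) (c v)"
  unfolding sublist_def by (metis morphism_simps(2))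

lemma morphism_comp: "morphism c \<Longrightarrow> morphism d \<Longrightarrow> morphism (c \<circ> d)"
  by (auto simp: morphism_def) (metis morphism_def morphism_eq_Nil)

lemma morphism_set: "morphism c \<Longrightarrow> set (c u) = (\<Union>a\<in>set u. set (c [a]))"
proof (induction u)
  case (Cons a u)
  then show ?case using morphism_Cons[of c a u] by simp
qed (simp add: morphism_simps)

lemma img_iff: "u \<in> img c L \<longleftrightarrow> (\<exists>v\<in>L. \<exists>A B. c v = A @ u @ B)"
  by (auto simp: img_def sublist_def)

lemma img_memI: "v \<in> L \<Longrightarrow> c v = A @ u @ B \<Longrightarrow> u \<in> img c L"
  by (auto simp: img_iff)

lemma img_comp:
  assumes "morphism c" shows "img c (img d L) = img (c \<circ> d) L"
proof (intro equalityI subsetI)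
  fix u assume "u \<in> img c (img d L)"
  then show "u \<in> img (c \<circ> d) L"
    unfolding img_def using morphism_sublist[OF assms] sublist_order.order_trans by fastforce
qed (auto simp: img_def)

lemma right_extendable_img:
  assumes c: "morphism c" and L: "right_extendable L"
  shows "right_extendable (img c L)"
  unfolding right_extendable_def
proof (intro conjI ballI allI impI)
  show "[] \<in> img c L" using right_extendable_Nil[OF L] by (auto simp: img_def)
  fix u assume u: "u \<in> img c L"
  show "v \<in> img c L" if "sublist v u" for v
    using u that sublist_order.order_trans unfolding img_def by blast
  obtain v A B where v: "v \<in> L" "c v = A @ u @ B" using u by (auto simp: img_iff)
  obtain b where b: "v @ [b] \<in> L" using right_extendable_ext[OF L v(1)] by blast
  have "c (v @ [b]) = A @ u @ (B @ c [b])" using v c by (simp add: morphism_simps)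
  also have "B @ c [b] = hd (B @ c [b]) # tl (B @ c [b])" using morphism_simps(3)[OF c] by simp
  finally have "c (v @ [b]) = A @ (u @ [hd (B @ c [b])]) @ tl (B @ c [b])" by simp
  then show "\<exists>b. u @ [b] \<in> img c L" using img_memI[OF b] by blast
qed

lemma biextendable_img:
  assumes c: "morphism c" and L: "biextendable L"
  shows "biextendable (img c L)"
  unfolding biextendable_def
proof (intro conjI ballI)
  show "right_extendable (img c L)" using c L by (intro right_extendable_img) auto
  fix u assume u: "u \<in> img c L"
  obtain v A B where v: "v \<in> L" "c v = A @ u @ B" using u by (auto simp: img_iff)
  obtain b where b: "b # v \<in> L" using biextendable_left[OF L v(1)] by blast
  have "c (b # v) = (c [b] @ A) @ u @ B" using v c by (simp add: morphism_Cons[of c b v])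
  also have "c [b] @ A = butlast (c [b] @ A) @ [last (c [b] @ A)]" using morphism_simps(3)[OF c] by simp
  finally have "c (b # v) = butlast (c [b] @ A) @ (last (c [b] @ A) # u) @ B" by simp
  then show "\<exists>a. a # u \<in> img c L" using img_memI[OF b] by blast
qed

text \<open>
  Nonerasing morphisms do not shorten words, so the images of prefixes cover all of \<open>w\<close>.
\<close>
lemma language_word_image:
  assumes c: "morphism c" and w: "word_image c w' w"
  shows "language w = img c (language w')"
proof (intro equalityI subsetI)
  fix u assume "u \<in> language w"
  then obtain k where k: "sublist u (w [0 \<rightarrow> k])" by (auto simp: language_iff)
  have "k \<le> length (c (w' [0 \<rightarrow> k]))" using morphism_length[OF c, of "w' [0 \<rightarrow> k]"] by simp
  then have "c (w' [0 \<rightarrow> k]) = w [0 \<rightarrow> k] @ w [k \<rightarrow> length (c (w' [0 \<rightarrow> k]))]"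
    using w unfolding word_image_def by (metis le0 subsequence_append')
  then have "sublist (w [0 \<rightarrow> k]) (c (w' [0 \<rightarrow> k]))" by (metis sublist_append_rightI)
  then show "u \<in> img c (language w')"
    using k prefix_in_language[of w' k] sublist_order.order_trans unfolding img_def by blast
next
  fix u assume "u \<in> img c (language w')"
  then obtain v k where "sublist u (c v)" "sublist v (w' [0 \<rightarrow> k])" by (auto simp: img_def language_iff)
  then have "sublist u (c (w' [0 \<rightarrow> k]))"
    using morphism_sublist[OF c] sublist_order.order_trans by blast
  then show "u \<in> language w" using w unfolding word_image_def language_iff by metis
qed

lemma word_image_comp:
  assumes "word_image c w' w" "word_image d w'' w'"
  shows "word_image (c \<circ> d) w'' w"
  unfolding word_image_def using assms by (metis comp_apply word_image_def)

section \<open>The substitutions and their mirror symmetry\<close>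

lemma c1_simps [simp]: "c1 [] = []" "c1 (a # u) = c1_letter a @ c1 u" "c1 (u @ v) = c1 u @ c1 v"
  by (simp_all add: c1_def)
lemma c2_simps [simp]: "c2 [] = []" "c2 (a # u) = c2_letter a @ c2 u" "c2 (u @ v) = c2 u @ c2 v"
  by (simp_all add: c2_def)

lemma morphism_c1: "morphism c1" unfolding morphism_def by auto (metis c1_letter.simps letter.exhaust list.discI)
lemma morphism_c2: "morphism c2" unfolding morphism_def by auto (metis c2_letter.simps letter.exhaust list.discI)

definition mirror :: "letter list \<Rightarrow> letter list" where
  "mirror u = map mirror_letter (rev u)"

lemma mirror_simps [simp]: "mirror [] = []" "mirror (u @ v) = mirror v @ mirror u" "mirror [a] = [mirror_letter a]"
  "mirror (a # u) = mirror u @ [mirror_letter a]" "mirror (mirror u) = u" "length (mirror u) = length u"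
  by (simp_all add: mirror_def rev_map comp_def)

lemma mirror_c1: "mirror (c1 u) = c2 (mirror u)"
proof (induction u)
  case (Cons a u) then show ?case by (cases a) auto
qed simp

lemma mirror_c2: "mirror (c2 u) = c1 (mirror u)"
  by (metis mirror_c1 mirror_simps(5))

definition mirror_lang :: "letter list set \<Rightarrow> letter list set" where
  "mirror_lang L = {u. mirror u \<in> L}"

lemma mirror_lang_invol [simp]: "mirror_lang (mirror_lang L) = L" by (simp add: mirror_lang_def)

lemma sublist_mirror: "sublist u v \<Longrightarrow> sublist (mirror u) (mirror v)"
  unfolding sublist_def by (metis append.assoc mirror_simps(2))

lemma biextendable_mirror:
  assumes L: "biextendable L" shows "biextendable (mirror_lang L)"
  unfolding biextendable_def right_extendable_def
proof (intro conjI ballI allI impI)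
  show "[] \<in> mirror_lang L" using right_extendable_Nil[OF biextendable_right[OF L]] by (simp add: mirror_lang_def)
  fix u assume u: "u \<in> mirror_lang L"
  then have m: "mirror u \<in> L" by (simp add: mirror_lang_def)
  show "v \<in> mirror_lang L" if "sublist v u" for v
    using right_extendable_sublist[OF biextendable_right[OF L] m] sublist_mirror[OF that] by (simp add: mirror_lang_def)
  show "\<exists>b. u @ [b] \<in> mirror_lang L"
  proof -
    obtain a where "a # mirror u \<in> L" using biextendable_left[OF L m] by blast
    then show ?thesis by (intro exI[of _ "mirror_letter a"]) (simp add: mirror_lang_def)
  qed
  show "\<exists>b. b # u \<in> mirror_lang L"
  proof -
    obtain a where "mirror u @ [a] \<in> L" using right_extendable_ext[OF biextendable_right[OF L] m] by blast
    then show ?thesis by (intro exI[of _ "mirror_letter a"]) (simp add: mirror_lang_def)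
  qed
qed

lemma ext_mirror: "ext (mirror_lang L) u = mirror_rel (ext L (mirror u))"
  by (auto simp: ext_def mirror_lang_def mirror_rel_def)

lemma bispecial_mirror: "bispecial_in (mirror_lang L) u \<longleftrightarrow> bispecial_in L (mirror u)"
proof -
  have "lext (mirror_lang L) u = mirror_letter ` rext L (mirror u)"
    "rext (mirror_lang L) u = mirror_letter ` lext L (mirror u)"
    by (auto simp: lext_def rext_def mirror_lang_def image_iff) (metis mirror_letter_invol)+
  then show ?thesis
    by (auto simp: bispecial_in_def card_image inj_on_subset[OF inj_mirror_letter])
qed

lemma card_level_mirror: "card (level (mirror_lang L) n) = card (level L n)"
  by (rule bij_betw_same_card[of mirror], rule bij_betw_byWitness[of _ mirror])
    (auto simp: level_def mirror_lang_def)

lemma mirror_img_c1: "mirror_lang (img c1 L) = img c2 (mirror_lang L)"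
  and mirror_img_c2: "mirror_lang (img c2 L) = img c1 (mirror_lang L)"
proof -
  have *: "mirror_lang (img c L) \<subseteq> img d (mirror_lang L)" if "\<And>u. mirror (c u) = d (mirror u)" for c d L
  proof
    fix u assume "u \<in> mirror_lang (img c L)"
    then obtain v where v: "v \<in> L" "sublist (mirror u) (c v)" by (auto simp: mirror_lang_def img_def)
    then have "sublist u (d (mirror v))" using sublist_mirror[OF v(2)] that by simp
    moreover have "mirror v \<in> mirror_lang L" using v by (simp add: mirror_lang_def)
    ultimately show "u \<in> img d (mirror_lang L)" unfolding img_def by blast
  qed
  have mono: "A \<subseteq> B \<Longrightarrow> mirror_lang A \<subseteq> mirror_lang B" for A B by (auto simp: mirror_lang_def)
  show "mirror_lang (img c1 L) = img c2 (mirror_lang L)"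
    using *[of c1 c2 L, OF mirror_c1] mono[OF *[of c2 c1 "mirror_lang L", OF mirror_c2]] by simp
  show "mirror_lang (img c2 L) = img c1 (mirror_lang L)"
    using *[of c2 c1 L, OF mirror_c2] mono[OF *[of c1 c2 "mirror_lang L", OF mirror_c1]] by simp
qed

section \<open>Parsing the images of words\<close>

lemma c1_letter_eq: "c1_letter a = (if a = L2 then [L1, L3] else [first1 a])" by (cases a) auto

lemma hd_c1: "c1 u = y # B \<Longrightarrow> \<exists>b v. u = b # v \<and> first1 b = y"
  by (cases u) (auto simp: c1_letter_eq split: if_splits)

lemma first1_not_L3 [simp]: "first1 a \<noteq> L3" "L3 \<noteq> first1 a" by (cases a; simp)+

lemma c1_not_L3: "c1 u \<noteq> L3 # B" using hd_c1[of u L3 B] by auto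

lemma last_c1: "c1 u = A @ [x] \<Longrightarrow> \<exists>a v. u = v @ [a] \<and> last1 a = x"
proof (cases u rule: rev_cases)
  case (snoc v a)
  then show "c1 u = A @ [x] \<Longrightarrow> ?thesis" by (cases a) auto
qed simp

text \<open>
  The letter 3 occurs only as the second letter of the image of 2, so a cut in front of it
  falls inside that image, and any other cut falls between the images of two letters
  (\<open>c1_split\<close>).
\<close>
lemma c1_split_L3:
  assumes "c1 v = A @ L3 # B"
  obtains v1 v2 where "v = v1 @ L2 # v2" "A = c1 v1 @ [L1]" "B = c1 v2"
  using assms
proof (induction v arbitrary: A thesis)
  case (Cons a v)
  show ?case
  proof (cases "\<exists>A'. A = c1_letter a @ A'")
    case True
    then obtain A' where A': "A = c1_letter a @ A'" by blast
    then have "c1 v = A' @ L3 # B" using Cons.prems(2) by simp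
    then obtain v1 v2 where "v = v1 @ L2 # v2" "A' = c1 v1 @ [L1]" "B = c1 v2"
      using Cons.IH[of A'] by blast
    then show ?thesis using A' Cons.prems(1)[of "a # v1" v2] by simp
  next
    case False
    then have "a = L2 \<and> A = [L1] \<and> B = c1 v" using Cons.prems(2)
      by (cases a; cases A; cases "tl A") (auto simp: c1_letter_eq split: if_splits)
    then show ?thesis using Cons.prems(1)[of "[]" v] by simp
  qed
qed simp

lemma c1_split:
  assumes "c1 v = A @ B" "\<And>B'. B \<noteq> L3 # B'"
  obtains v1 v2 where "v = v1 @ v2" "A = c1 v1" "B = c1 v2"
  using assms
proof (induction v arbitrary: A thesis)
  case (Cons a v)
  show ?case
  proof (cases "\<exists>A'. A = c1_letter a @ A'")
    case True
    then obtain A' where A': "A = c1_letter a @ A'" by blast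
    then have "c1 v = A' @ B" using Cons.prems(2) by simp
    then obtain v1 v2 where "v = v1 @ v2" "A' = c1 v1" "B = c1 v2"
      using Cons.IH[of A'] Cons.prems(3) by blast
    then show ?thesis using A' Cons.prems(1)[of "a # v1" v2] by simp
  next
    case False
    then have "A = []" using Cons.prems(2,3)
      by (cases a; cases A; cases "tl A") (auto simp: c1_letter_eq split: if_splits)
    then show ?thesis using Cons.prems(1)[of "[]" "a # v"] Cons.prems(2) by simp
  qed
qed simp

lemma c1_inject: "c1 u = c1 v \<Longrightarrow> u = v"
proof (induction u arbitrary: v)
  case Nil
  then show ?case using morphism_eq_Nil[OF morphism_c1, of v] by simp
next
  case (Cons a u)
  then obtain b v' where v: "v = b # v'"
    using morphism_eq_Nil[OF morphism_c1, of "a # u"] by (cases v) auto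
  have no: "c1 u \<noteq> L3 # B" "L3 # B \<noteq> c1 u" for u B using c1_not_L3[of u B] by metis+
  have "a = b \<and> c1 u = c1 v'" using Cons.prems unfolding v
    by (cases a; cases b) (auto simp: no)
  then show ?case using Cons.IH v by blast
qed

text \<open>
  Synchronization: an occurrence of \<open>c1 u\<close> that has a left neighbour and is not followed by 3 can
  only arise from an occurrence of \<open>u\<close>.
\<close>
lemma c1_parse:
  assumes "c1 v = A @ x # c1 u @ R" "\<And>R'. R \<noteq> L3 # R'"
  obtains v1 a v2 where "v = v1 @ a # u @ v2" "last1 a = x" "c1 v2 = R"
proof -
  have "c1 u @ R \<noteq> L3 # B'" for B'
    using assms(2) c1_not_L3[of u] by (cases "c1 u") auto
  then obtain w1 w2 where w: "v = w1 @ w2" "A @ [x] = c1 w1" "c1 u @ R = c1 w2"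
    using c1_split[of v "A @ [x]" "c1 u @ R"] assms(1) by auto
  obtain a v1 where a: "w1 = v1 @ [a]" "last1 a = x" using last_c1[OF w(2)[symmetric]] by blast
  obtain w3 w4 where w3: "w2 = w3 @ w4" "c1 u = c1 w3" "R = c1 w4"
    using c1_split[OF w(3)[symmetric] assms(2)] by blast
  then show thesis using that[of v1 a w4] w a c1_inject by simp
qed

text \<open>
  The extension graph of \<open>c1 u\<close>, apart from the right extension 3, is the image of the
  extension graph of \<open>u\<close> under \<open>last1\<close> and \<open>first1\<close>.
\<close>
lemma img_c1_iff:
  assumes L: "right_extendable L" and y: "y \<noteq> L3"
  shows "x # c1 u @ [y] \<in> img c1 L \<longleftrightarrow> (\<exists>a b. a # u @ [b] \<in> L \<and> last1 a = x \<and> first1 b = y)"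
proof
  assume "x # c1 u @ [y] \<in> img c1 L"
  then obtain v A B where v: "v \<in> L" "c1 v = A @ x # c1 u @ (y # B)" by (auto simp: img_iff)
  obtain v1 a v2 where p: "v = v1 @ a # u @ v2" "last1 a = x" "c1 v2 = y # B"
    by (rule c1_parse[OF v(2)]) (use y in auto)
  obtain b v3 where "v2 = b # v3" "first1 b = y" using hd_c1[OF p(3)] by blast
  then show "\<exists>a b. a # u @ [b] \<in> L \<and> last1 a = x \<and> first1 b = y"
    using p right_extendable_append[OF L, of v1 "a # u @ b # v3"]
      right_extendable_append[OF L, of "a # u @ [b]" v3] v(1) by auto
next
  assume "\<exists>a b. a # u @ [b] \<in> L \<and> last1 a = x \<and> first1 b = y"
  then obtain a b where ab: "a # u @ [b] \<in> L" "last1 a = x" "first1 b = y" by blast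
  have "c1_letter a = butlast (c1_letter a) @ [x]" using ab(2) by (cases a) auto
  moreover have "c1_letter b = y # tl (c1_letter b)" using ab(3) by (cases b) auto
  ultimately have "c1 (a # u @ [b]) = butlast (c1_letter a) @ (x # c1 u @ [y]) @ tl (c1_letter b)"
    by simp
  then show "x # c1 u @ [y] \<in> img c1 L" by (rule img_memI[OF ab(1)])
qed

text \<open>
  The right extension 3 of \<open>c1 u @ [L1]\<close> comes from the right extension 2 of \<open>u\<close>.
\<close>
lemma img_c1_L3_iff:
  assumes L: "right_extendable L"
  shows "x # c1 u @ [L1, L3] \<in> img c1 L \<longleftrightarrow> (\<exists>a. a # u @ [L2] \<in> L \<and> last1 a = x)"
proof
  assume "x # c1 u @ [L1, L3] \<in> img c1 L"
  then obtain v A B where v: "v \<in> L" "c1 v = A @ x # c1 u @ (L1 # L3 # B)" by (auto simp: img_iff)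
  obtain v1 a v2 where p: "v = v1 @ a # u @ v2" "last1 a = x" "c1 v2 = [L1] @ L3 # B"
    by (rule c1_parse[OF v(2)]) auto
  obtain w1 w2 where w: "v2 = w1 @ L2 # w2" "[L1] = c1 w1 @ [L1]" by (rule c1_split_L3[OF p(3)])
  then have "w1 = []" using morphism_eq_Nil[OF morphism_c1, of w1] by simp
  then show "\<exists>a. a # u @ [L2] \<in> L \<and> last1 a = x"
    using p w right_extendable_append[OF L, of v1 "a # u @ L2 # w2"]
      right_extendable_append[OF L, of "a # u @ [L2]" w2] v(1) by auto
next
  assume "\<exists>a. a # u @ [L2] \<in> L \<and> last1 a = x"
  then obtain a where a: "a # u @ [L2] \<in> L" "last1 a = x" by blast
  have "c1_letter a = butlast (c1_letter a) @ [x]" using a(2) by (cases a) auto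
  then have "c1 (a # u @ [L2]) = butlast (c1_letter a) @ (x # c1 u @ [L1, L3]) @ []" by simp
  then show "x # c1 u @ [L1, L3] \<in> img c1 L" by (rule img_memI[OF a(1)])
qed

lemma before_L3:
  assumes "x # L3 # u \<in> img c1 L" shows "x = L1"
proof -
  obtain v A B where "c1 v = (A @ [x]) @ L3 # u @ B" using assms by (auto simp: img_iff)
  then obtain v1 v2 where "A @ [x] = c1 v1 @ [L1]" by (rule c1_split_L3)
  then show ?thesis by simp
qed

lemma lext_sub:
  assumes "right_extendable L" shows "lext L (y # u) \<subseteq> {x. [x, y] \<in> L}"
  using right_extendable_append[OF assms, of "[_, y]" u] by (auto simp: lext_def)

lemma rext_sub:
  assumes "right_extendable L" shows "rext L (u @ [x]) \<subseteq> {y. [x, y] \<in> L}"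
  using right_extendable_append[OF assms, of u "[x, _]"] by (auto simp: rext_def)

lemma bispecial_not_sub:
  assumes "bispecial_in (L :: letter list set) u" shows "\<not> lext L u \<subseteq> {a}" "\<not> rext L u \<subseteq> {a}"
  using assms card_mono[of "{a}" "lext L u"] card_mono[of "{a}" "rext L u"]
  by (auto simp: bispecial_in_def)

section \<open>Bispecial words in images under the square of a substitution\<close>

text \<open>
  The square of \<open>c1\<close> maps 1, 2, 3 to 1, 12, 13, so in every pair of adjacent letters of the
  image one is 1.
\<close>
lemma square_pairs:
  assumes L: "right_extendable L"
  shows "[x, y] \<in> img c1 (img c1 L) \<Longrightarrow> y \<noteq> L1 \<Longrightarrow> x = L1"
    and "[x, y] \<in> img c1 (img c1 L) \<Longrightarrow> x \<noteq> L1 \<Longrightarrow> y = L1"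
proof -
  have R: "right_extendable (img c1 L)" using right_extendable_img[OF morphism_c1 L] .
  show "x = L1" if xy: "[x, y] \<in> img c1 (img c1 L)" "y \<noteq> L1" for x y
  proof (cases "y = L3")
    case True then show ?thesis using before_L3[of x "[]"] xy by simp
  next
    case False
    then obtain a b where "[a, b] \<in> img c1 L" "last1 a = x" "first1 b = y"
      using img_c1_iff[OF R False, of x "[]"] xy by auto
    moreover have "b = L3" using \<open>first1 b = y\<close> xy(2) by (cases b) auto
    ultimately show ?thesis using before_L3[of a "[]" L] by auto
  qed
  then show "y = L1" if "[x, y] \<in> img c1 (img c1 L)" "x \<noteq> L1" for x y using that by blast
qed

text \<open>
  Each image of a letter under the square of \<open>c1\<close> begins with 1 and ends with the letter itself.
  Hence \<open>c1 (c1 u) @ [L1]\<close> has the same left extensions as \<open>u\<close>, and the letter after it is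
  the right extension of \<open>u\<close>.
\<close>
lemma square_iff:
  assumes L: "right_extendable L"
  shows "x # c1 (c1 u) @ [L1, y] \<in> img c1 (img c1 L) \<longleftrightarrow> x # u @ [y] \<in> L"
proof
  assume "x # c1 (c1 u) @ [L1, y] \<in> img c1 (img c1 L)"
  then have "x # c1 (c1 u) @ [L1, y] \<in> img (c1 \<circ> c1) L" by (simp add: img_comp[OF morphism_c1])
  then obtain v A B where v: "v \<in> L" "c1 (c1 v) = A @ x # c1 (c1 u) @ (L1 # y # B)"
    by (auto simp: img_iff)
  obtain v1 a v2 where p: "c1 v = v1 @ a # c1 u @ v2" "last1 a = x" "c1 v2 = L1 # y # B"
    by (rule c1_parse[OF v(2)]) auto
  have "v2 \<noteq> L3 # R" for R using p(3) by auto
  then obtain w1 a' w2 where q: "v = w1 @ a' # u @ w2" "last1 a' = a" "c1 w2 = v2"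
    using c1_parse[OF p(1)] by blast
  have "a' = x" using q(2) p(2) by (cases a') auto
  moreover obtain b w3 where "w2 = b # w3" "b = y"
  proof -
    have e: "c1 (c1 w2) = L1 # y # B" using q(3) p(3) by simp
    then obtain b w3 where w: "w2 = b # w3" by (cases w2) auto
    have "b = y"
    proof (cases b)
      case L1
      then have "c1 (c1 w3) = y # B" using e w by simp
      then obtain b' t where "c1 w3 = b' # t" "first1 b' = y" using hd_c1 by blast
      moreover have "b' \<noteq> L3" using c1_not_L3[of w3] calculation(1) by auto
      ultimately show ?thesis using L1 by (cases b') auto
    qed (use e w in auto)
    then show thesis using that w by blast
  qed
  ultimately show "x # u @ [y] \<in> L"
    using q v(1) right_extendable_append[OF L, of w1 "x # u @ y # w3"]
      right_extendable_append[OF L, of "x # u @ [y]" w3] by auto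
next
  assume "x # u @ [y] \<in> L"
  then obtain b where b: "x # u @ [y, b] \<in> L" using right_extendable_ext[OF L, of "x # u @ [y]"] by auto
  have "c1 (c1_letter x) = butlast (c1 (c1_letter x)) @ [x]" by (cases x) auto
  moreover have "c1 (c1_letter y) @ c1 (c1_letter b) = L1 # y # tl (tl (c1 (c1_letter y) @ c1 (c1_letter b)))"
    by (cases y; cases b) auto
  ultimately have "(c1 \<circ> c1) (x # u @ [y, b]) = butlast (c1 (c1_letter x)) @ (x # c1 (c1 u) @ [L1, y])
      @ tl (tl (c1 (c1_letter y) @ c1 (c1_letter b)))" by simp
  then have "x # c1 (c1 u) @ [L1, y] \<in> img (c1 \<circ> c1) L" by (rule img_memI[OF b])
  then show "x # c1 (c1 u) @ [L1, y] \<in> img c1 (img c1 L)" by (simp add: img_comp[OF morphism_c1])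
qed

text \<open>
  A bispecial word must begin and end with 1, because the other letters have only one neighbour
  on either side; then it parses into full images followed by a final 1.
\<close>
lemma bispecial_square:
  assumes L: "biextendable L" and X: "X = img c1 (img c1 L)"
    and U: "bispecial_in X U" "U \<noteq> []"
  obtains z where "U = c1 (c1 z) @ [L1]" "ext X U = ext L z"
proof -
  note R = biextendable_right[OF L]
  have R1: "right_extendable (img c1 L)" and RX: "right_extendable X"
    unfolding X using R right_extendable_img morphism_c1 by blast+
  have hdU: "hd U = L1"
  proof (rule ccontr)
    assume "hd U \<noteq> L1"
    then have "lext X U \<subseteq> {L1}"
      using lext_sub[OF RX, of "hd U" "tl U"] square_pairs(1)[OF R, of _ "hd U"] U(2) unfolding X by auto
    then show False using bispecial_not_sub[OF U(1)] by blast
  qed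
  have lastU: "last U = L1"
  proof (rule ccontr)
    assume "last U \<noteq> L1"
    then have "rext X U \<subseteq> {L1}"
      using rext_sub[OF RX, of "butlast U" "last U"] square_pairs(2)[OF R, of "last U"] U(2) unfolding X by auto
    then show False using bispecial_not_sub[OF U(1)] by blast
  qed
  define W where "W = butlast U"
  have UW: "U = W @ [L1]" using lastU U(2) unfolding W_def by (metis append_butlast_last_id)
  have W3: "W @ L1 # B \<noteq> L3 # B'" for B B' using hdU unfolding UW by (cases W) auto
  have "U \<in> X"
    using bispecial_not_sub(1)[OF U(1)] right_extendable_Cons[OF RX] by (auto simp: lext_def)
  then obtain a b where "a # U @ [b] \<in> X"
    using biextendable_left[OF biextendable_img[OF morphism_c1 biextendable_img[OF morphism_c1 L]]]
      right_extendable_ext[OF RX] unfolding X by (metis append_Cons)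
  then have "a # U @ [b] \<in> img (c1 \<circ> c1) L" by (simp add: X img_comp[OF morphism_c1])
  then obtain v A B where v: "c1 (c1 v) = (A @ [a]) @ (W @ L1 # b # B)" by (auto simp: img_iff UW)
  obtain v1 v2 where v2: "c1 v = v1 @ v2" "A @ [a] = c1 v1" "W @ L1 # b # B = c1 v2"
    by (rule c1_split[OF v W3])
  obtain v3 v4 where v3: "v2 = v3 @ v4" "W = c1 v3" "L1 # b # B = c1 v4"
    by (rule c1_split[OF v2(3)[symmetric]]) auto
  have v4: "v4 \<noteq> L3 # t" for t using v3(3) by auto
  have "v3 @ v4 \<noteq> L3 # t" for t
    using v4 hdU v3(2) unfolding UW by (cases v3) auto
  then obtain w1 w2 where w: "v = w1 @ w2" "v3 @ v4 = c1 w2"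
    using c1_split[OF v2(1)[unfolded v3(1)]] by blast
  obtain z z' where "w2 = z @ z'" "v3 = c1 z" by (rule c1_split[OF w(2)[symmetric] v4])
  then have z: "U = c1 (c1 z) @ [L1]" using UW v3(2) by simp
  then have "ext X U = ext L z" using square_iff[OF R, of _ z] by (auto simp: ext_def X)
  then show thesis using that z by blast
qed

lemma ext_square_Nil:
  assumes L: "biextendable L"
  shows "ext (img c1 (img c1 L)) [] = {(x, L1) | x. [x] \<in> L} \<union> {(L1, y) | y. [y] \<in> L \<and> y \<noteq> L1}"
    (is "ext ?X [] = ?E")
proof -
  note R = biextendable_right[OF L]
  have R1: "right_extendable (img c1 L)" and RX: "right_extendable ?X"
    using R right_extendable_img morphism_c1 by blast+
  have "[x, y] \<in> ?X \<longleftrightarrow> (x, y) \<in> ?E" for x y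
  proof
    assume xy: "[x, y] \<in> ?X"
    show "(x, y) \<in> ?E"
    proof (cases "y = L1")
      case True
      then obtain a b where ab: "[a, b] \<in> img c1 L" "last1 a = x" "first1 b = y"
        using img_c1_iff[OF R1, of y x "[]"] xy by auto
      have "b \<noteq> L3" using ab(3) True by auto
      then obtain a' b' where "[a', b'] \<in> L" "last1 a' = a" using img_c1_iff[OF R, of b a "[]"] ab by auto
      then show ?thesis using right_extendable_append[OF R, of "[a']" "[b']"] ab True by (cases a') auto
    next
      case False
      then have x: "x = L1" using square_pairs(1)[OF R xy] by simp
      have "[y] \<in> L"
      proof -
        obtain v A B where v: "v \<in> L" "c1 (c1 v) = A @ x # y # B"
          using xy by (auto simp: img_comp[OF morphism_c1] img_iff)
        have "y \<in> set (c1 (c1 v))" using v by simp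
        then obtain b where b: "b \<in> set v" "y \<in> set (c1 (c1 [b]))"
          using morphism_set[OF morphism_comp[OF morphism_c1 morphism_c1], of v] by auto
        have "y = b" using b(2) False by (cases b) auto
        moreover obtain s t where "v = s @ [b] @ t" using b(1) by (metis append_Cons append_Nil split_list)
        ultimately show ?thesis using right_extendable_append[OF R] v(1) by metis
      qed
      then show ?thesis using x False by simp
    qed
  next
    assume "(x, y) \<in> ?E"
    then consider "y = L1" "[x] \<in> L" | "x = L1" "[y] \<in> L" "y \<noteq> L1" by auto
    then show "[x, y] \<in> ?X"
    proof cases
      case 1
      then obtain b where b: "[x, b] \<in> L" using right_extendable_ext[OF R, of "[x]"] by auto
      have "(c1 \<circ> c1) [x, b] = butlast (c1 (c1_letter x)) @ [x, y] @ tl (c1 (c1_letter b))"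
        using 1 by (cases x; cases b) auto
      then have "[x, y] \<in> img (c1 \<circ> c1) L" by (rule img_memI[OF b])
      then show ?thesis by (simp add: img_comp[OF morphism_c1])
    next
      case 2
      then have "(c1 \<circ> c1) [y] = [] @ [x, y] @ []" by (cases y) auto
      then have "[x, y] \<in> img (c1 \<circ> c1) L" by (rule img_memI[OF 2(2)])
      then show ?thesis by (simp add: img_comp[OF morphism_c1])
    qed
  qed
  then show ?thesis by (auto simp: ext_def)
qed

section \<open>Bispecial words in images under alternating substitutions\<close>

lemma mem_image_map_prod: "(x, y) \<in> map_prod f g ` E \<longleftrightarrow> (\<exists>a b. (a, b) \<in> E \<and> x = f a \<and> y = g b)"
  by auto

lemma rel_eqI: "(\<And>x y. (x, y) \<in> E \<longleftrightarrow> (x, y) \<in> F) \<Longrightarrow> E = F" by auto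

text \<open>
  A word cannot be bispecial if its extensions are images of too few extensions below.
\<close>
lemma bispecial_ext_image:
  fixes L :: "letter list set"
  assumes L: "biextendable L" and X: "biextendable X"
    and e: "ext X U = map_prod f g ` E" "E \<subseteq> ext L u" and U: "bispecial_in X U"
  shows "bispecial_in L u"
proof -
  have "lext X U \<subseteq> f ` lext L u" "rext X U \<subseteq> g ` rext L u"
    using e unfolding Range_ext[OF L, symmetric] Range_ext[OF X, symmetric] Domain_ext[OF biextendable_right[OF L], symmetric]
      Domain_ext[OF biextendable_right[OF X], symmetric] by force+
  then have "card (lext X U) \<le> card (lext L u)" "card (rext X U) \<le> card (rext L u)"
    by (meson card_image_le card_mono finite_imageI finite_letter_set le_trans)+
  then show ?thesis using U unfolding bispecial_in_def by linarith
qed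

text \<open>
  Let 1 be followed only by 3 below, as in images under \<open>c2\<close>. A bispecial word \<open>U\<close> that can be
  followed by 3 ends with 1 and has the form \<open>c1 u @ [L1]\<close>: the final 1 comes either from a letter 2
  after \<open>u\<close>, and is then followed by 3, or from a letter 1 after \<open>u\<close>, and is then followed by
  the image 2 of the letter 3. So the right extensions 1 and 2 of \<open>u\<close> become 2 and 3,
  and its right extension 3 disappears. If \<open>U\<close> cannot be followed by 3, then \<open>U = c1 u\<close> and the
  right extensions 1 and 2 of \<open>u\<close> merge.
\<close>
lemma bispecial_mixed:
  assumes L: "biextendable L" and X: "X = img c1 L"
    and mixed: "\<And>b. [L1, b] \<in> L \<Longrightarrow> b = L3"
    and U: "bispecial_in X U" "U \<noteq> []"
  obtains u where "bispecial_in L u" "U = c1 u \<or> U = c1 u @ [L1]" "good (ext L u) \<Longrightarrow> good (ext X U)"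
proof -
  note R = biextendable_right[OF L]
  have BX: "biextendable X" unfolding X by (rule biextendable_img[OF morphism_c1 L])
  note RX = biextendable_right[OF BX]
  have hdU: "U \<noteq> L3 # U'" for U'
  proof
    assume "U = L3 # U'"
    then have "lext X U \<subseteq> {L1}" using before_L3 by (auto simp: lext_def X)
    then show False using bispecial_not_sub[OF U(1)] by blast
  qed
  have ne: "\<exists>a b. a # U @ [b] \<in> X \<and> (L3 \<in> rext X U \<longrightarrow> b = L3)"
  proof (cases "L3 \<in> rext X U")
    case True
    then have "\<exists>a. a # U @ [L3] \<in> X" using biextendable_left[OF BX, of "U @ [L3]"] by (simp add: rext_def)
    then show ?thesis by blast
  next
    case False
    have "U \<in> X" using bispecial_not_sub(1)[OF U(1)] right_extendable_Cons[OF RX] by (auto simp: lext_def)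
    then show ?thesis
      using biextendable_left[OF BX] right_extendable_ext[OF RX] False by (metis append_Cons)
  qed
  then obtain a b where ab: "a # U @ [b] \<in> X" "L3 \<in> rext X U \<longrightarrow> b = L3" by blast
  have bU: "b \<in> rext X U" using right_extendable_Cons[OF RX ab(1)] by (simp add: rext_def)
  show thesis
  proof (cases "L3 \<in> rext X U")
    case True
    obtain v A B where v: "c1 v = (A @ [a] @ U) @ L3 # B"
      using ab True by (auto simp: X img_iff)
    obtain v1 v2 where v1: "A @ [a] @ U = c1 v1 @ [L1]" by (rule c1_split_L3[OF v])
    define W where "W = butlast U"
    have W: "U = W @ [L1]" using v1 U(2) unfolding W_def
      by (metis append.assoc append_butlast_last_id last_appendR last_snoc snoc_eq_iff_butlast)
    have "W \<noteq> L3 # t" for t using hdU[of "t @ [L1]"] W by auto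
    moreover have "c1 v1 = (A @ [a]) @ W" using v1 W by simp
    ultimately obtain u where u: "W = c1 u" by (metis c1_split)
    define f where "f b = (if b = L1 then L2 else L3)" for b
    have E: "ext X U = map_prod last1 f ` {p \<in> ext L u. snd p \<noteq> L3}"
    proof -
      have "x # U @ [y] \<in> X \<longleftrightarrow> (\<exists>a b. a # u @ [b] \<in> L \<and> b \<noteq> L3 \<and> x = last1 a \<and> y = f b)" for x y
      proof (cases "y = L3")
        case True
        have "x # U @ [y] \<in> X \<longleftrightarrow> (\<exists>a. a # u @ [L2] \<in> L \<and> last1 a = x)"
          using img_c1_L3_iff[OF R, of x u] True by (simp add: X W u)
        moreover have "b \<noteq> L3 \<and> y = f b \<longleftrightarrow> b = L2" for b using True by (cases b) (auto simp: f_def)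
        ultimately show ?thesis by metis
      next
        case False
        have "x # U @ [y] \<in> X \<longleftrightarrow> (\<exists>a b. a # (u @ [L1]) @ [b] \<in> L \<and> last1 a = x \<and> first1 b = y)"
          using img_c1_iff[OF R False, of x "u @ [L1]"] by (simp add: X W u)
        moreover have "b = L3" if "a # (u @ [L1]) @ [b] \<in> L" for a b
          using right_extendable_append[OF R, of "a # u" "[L1, b]"] that by (intro mixed) auto
        moreover have "a # u @ [L1] \<in> L \<longleftrightarrow> (\<exists>b. a # (u @ [L1]) @ [b] \<in> L)" for a
          using right_extendable_ext[OF R, of "a # u @ [L1]"] right_extendable_append[OF R, of "a # u @ [L1]"] by auto
        ultimately have "x # U @ [y] \<in> X \<longleftrightarrow> (\<exists>a. a # u @ [L1] \<in> L \<and> last1 a = x \<and> first1 L3 = y)"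
          by metis
        moreover have "b \<noteq> L3 \<and> y = f b \<longleftrightarrow> b = L1 \<and> first1 L3 = y" for b
          using False by (cases b) (auto simp: f_def)
        ultimately show ?thesis by metis
      qed
      then show ?thesis by (intro rel_eqI) (simp add: ext_def mem_image_map_prod)
    qed
    have b: "bispecial_in L u" by (rule bispecial_ext_image[OF L BX E _ U(1)]) auto
    have "L1 \<in> Range (ext L u) \<and> L2 \<in> Range (ext L u)"
    proof -
      have "\<not> rext X U \<subseteq> {L2}" "\<not> rext X U \<subseteq> {L3}" using bispecial_not_sub[OF U(1)] by blast+
      then obtain p q where "p \<in> rext X U" "q \<in> rext X U" "p \<noteq> L2" "q \<noteq> L3" by blast
      then obtain a b a' b' where "(a, b) \<in> ext L u" "b \<noteq> L3" "f b \<noteq> L2" "(a', b') \<in> ext L u" "b' \<noteq> L3" "f b' \<noteq> L3"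
        unfolding Range_ext[OF BX, symmetric] E by auto
      moreover have "b = L2" "b' = L1" using calculation by (cases b; cases b'; simp add: f_def)+
      ultimately show ?thesis by blast
    qed
    then have "good (ext L u) \<Longrightarrow> good (ext X U)"
      unfolding E f_def by (intro good_restrict_columns) auto
    then show thesis using that b u W by blast
  next
    case False
    obtain v A B where v: "c1 v = A @ a # U @ (b # B)"
      using ab by (auto simp: X img_iff)
    have "b \<noteq> L3" using False bU by blast
    then obtain v1 v2 where v2: "U @ b # B = c1 v2"
      using c1_split[of v "A @ [a]" "U @ b # B"] v hdU U(2) by (cases U) auto
    obtain u where u: "U = c1 u" using c1_split[OF v2[symmetric]] \<open>b \<noteq> L3\<close> by blast
    have E: "ext X U = map_prod last1 first1 ` ext L u"
    proof -
      have "x # U @ [y] \<in> X \<longleftrightarrow> (\<exists>a b. a # u @ [b] \<in> L \<and> x = last1 a \<and> y = first1 b)" for x y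
      proof (cases "y = L3")
        case True
        have "x # U @ [y] \<notin> X" using False True right_extendable_Cons[OF RX] by (auto simp: rext_def)
        then show ?thesis using True by auto
      next
        case False
        then show ?thesis using img_c1_iff[OF R False, of x u] by (auto simp: X u)
      qed
      then show ?thesis by (intro rel_eqI) (simp add: ext_def mem_image_map_prod)
    qed
    have b: "bispecial_in L u" by (rule bispecial_ext_image[OF L BX E _ U(1)]) auto
    have "good (ext L u) \<Longrightarrow> good (ext X U)" unfolding E by (rule good_merge_columns)
    then show thesis using that b u by blast
  qed
qed

lemma image_map_prod: "map_prod f g ` map_prod f' g' ` E = map_prod (f \<circ> f') (g \<circ> g') ` E"
  by (intro rel_eqI) (simp add: mem_image_map_prod, metis)

lemma converse_map_prod: "(map_prod f g ` E)\<inverse> = map_prod g f ` (E\<inverse>)"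
  by (intro rel_eqI) (simp add: mem_image_map_prod, metis)

lemma mem_mirror_lang: "u \<in> mirror_lang L \<longleftrightarrow> mirror u \<in> L" by (simp add: mirror_lang_def)

section \<open>The extension graph of the empty word\<close>

text \<open>
  Two adjacent letters of the image lie either at the border of two images of letters or within
  the image 13 of the letter 2.
\<close>
lemma ext_c1_Nil:
  assumes L: "biextendable L" and two: "[L2] \<in> L"
  shows "ext (img c1 L) [] = insert (L1, L3) (map_prod last1 first1 ` ext L [])"
proof -
  note R = biextendable_right[OF L]
  have "[x, y] \<in> img c1 L \<longleftrightarrow> (x, y) = (L1, L3) \<or> (\<exists>a b. [a, b] \<in> L \<and> x = last1 a \<and> y = first1 b)" for x y
  proof (cases "y = L3")
    case True
    have "c1 [L2] = [] @ [L1, L3] @ []" by simp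
    then have "[L1, L3] \<in> img c1 L" by (rule img_memI[OF two])
    then show ?thesis using True before_L3[of x "[]" L] by auto
  next
    case False
    then show ?thesis using img_c1_iff[OF R False, of x "[]"] by auto
  qed
  then show ?thesis by (intro rel_eqI) (simp add: ext_def mem_image_map_prod)
qed

lemma ext_c2_Nil:
  assumes L: "biextendable L" and two: "[L2] \<in> L"
  shows "ext (img c2 L) [] = insert (L1, L3) (map_prod (mirror_letter \<circ> first1 \<circ> mirror_letter)
    (mirror_letter \<circ> last1 \<circ> mirror_letter) ` ext L [])"
proof -
  have "ext (mirror_lang (img c2 L)) [] = insert (L1, L3) (map_prod last1 first1 ` mirror_rel (ext L []))"
    using ext_c1_Nil[OF biextendable_mirror[OF L]] two ext_mirror[of L "[]"]
    by (simp add: mirror_img_c2 mem_mirror_lang)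
  then have "mirror_rel (ext (img c2 L) []) = insert (L1, L3) (map_prod last1 first1 ` mirror_rel (ext L []))"
    by (simp add: ext_mirror)
  then have "ext (img c2 L) [] = mirror_rel (insert (L1, L3) (map_prod last1 first1 ` mirror_rel (ext L [])))"
    by (metis mirror_rel_invol)
  moreover have "mirror_rel (insert (L1, L3) E) = insert (L1, L3) (mirror_rel E)" for E
  proof -
    have "(insert (L1, L3) E)\<inverse> = insert (L3, L1) (E\<inverse>)" by auto
    then show ?thesis by (simp add: mirror_rel_altdef)
  qed
  moreover have "mirror_rel (map_prod last1 first1 ` mirror_rel E) =
      map_prod (mirror_letter \<circ> first1 \<circ> mirror_letter) (mirror_letter \<circ> last1 \<circ> mirror_letter) ` E" for E
    unfolding mirror_rel_altdef converse_map_prod image_map_prod by (simp add: comp_assoc)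
  ultimately show ?thesis by simp
qed

text \<open>
  Adding an edge at a vertex of a connected graph; explicit trees are built in this way.
\<close>
lemma rel_connected_insert:
  assumes E: "rel_connected E" and ab: "a \<in> Domain E \<or> b \<in> Range E"
  shows "rel_connected (insert (a, b) E)"
proof (rule rel_connectedI)
  fix S T a0 b0 x y
  assume cut: "\<And>x y. (x, y) \<in> insert (a, b) E \<Longrightarrow> (x \<in> S) = (y \<in> T)"
    and e: "(a0, b0) \<in> insert (a, b) E" "a0 \<in> S" "(x, y) \<in> insert (a, b) E"
  obtain a' b' where ab': "(a', b') \<in> E" "a' = a \<or> b' = b" using ab by auto
  have ca: "a \<in> S \<longleftrightarrow> b \<in> T" by (rule cut) simp
  have cE: "x \<in> S \<longleftrightarrow> y \<in> T" if "(x, y) \<in> E" for x y by (rule cut) (simp add: that)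
  have S: "a \<in> S \<longleftrightarrow> a' \<in> S" using ab'(2) ca cE[OF ab'(1)] by blast
  obtain a1 b1 where a1: "(a1, b1) \<in> E" "a1 \<in> S" using e(1,2) S ab'(1) by blast
  have all: "x \<in> S" if "(x, y) \<in> E" for x y
    by (rule rel_connectedD(1)[OF E cE a1 that])
  show "x \<in> S" using e(3) all all[OF ab'(1)] S by blast
qed simp

lemma rel_connected_single: "rel_connected {(a, b)}"
  by (rule rel_connectedI) auto

text \<open>
  These three graphs are the extension graphs of the empty word, as computed in
  \<open>good_ext_Nil\<close>, if the first substitution is \<open>c1\<close>.
\<close>
lemma good_star: "good {(L1, L2), (L1, L3), (L1, L1), (L2, L1), (L3, L1)}" (is "good ?E")
  and good_path1: "good {(L1, L3), (L1, L2), (L3, L2), (L3, L1), (L2, L1)}" (is "good ?F")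
  and good_path2: "good {(L1, L3), (L1, L2), (L3, L2), (L2, L1), (L2, L2)}" (is "good ?G")
proof -
  have "rel_connected ?E" "rel_connected ?F" "rel_connected ?G"
    by (simp_all add: rel_connected_insert rel_connected_single)
  then show "good ?E" "good ?F" "good ?G" by (auto simp: good_def rel_tree_def card_insert_if)
qed

definition full_language :: "letter list set \<Rightarrow> bool" where
  "full_language L \<longleftrightarrow> biextendable L \<and> (\<forall>a. [a] \<in> L)"

lemma full_ext_Nil: "full_language L \<Longrightarrow> Domain (ext L []) = UNIV" "full_language L \<Longrightarrow> Range (ext L []) = UNIV"
  by (simp_all add: full_language_def Domain_ext Range_ext biextendable_right lext_def rext_def)

lemma map_prod_const: "map_prod f (\<lambda>_. c) ` E = f ` Domain E \<times> {c}"
  by (intro rel_eqI) (auto simp: mem_image_map_prod)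

lemma map_prod_const': "map_prod (\<lambda>_. c) f ` E = {c} \<times> f ` Range E"
  by (intro rel_eqI) (auto simp: mem_image_map_prod)

text \<open>
  Each substitution merges two right or two left extensions of the empty word and adds the
  edge (1,3). After at most three levels one of the two sides has been merged to a single
  letter, and then the graph no longer depends on the deepest level.
\<close>
lemma good_ext_Nil:
  assumes M: "full_language M0" "full_language M1" "full_language M2" "full_language M3"
    and i: "M0 = img c1 M1" "M1 = img c1 M2 \<or> M1 = img c2 M2" "M2 = img c1 M3 \<or> M2 = img c2 M3"
  shows "good (ext M0 [])"
proof -
  have B: "biextendable M1" "biextendable M2" "biextendable M3"
    and two: "[L2] \<in> M1" "[L2] \<in> M2" "[L2] \<in> M3"
    using M by (simp_all add: full_language_def)
  let ?m = mirror_letter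
  let ?l = "?m \<circ> first1 \<circ> ?m" and ?f = "?m \<circ> last1 \<circ> ?m"
  have U: "(UNIV :: letter set) = {L1, L2, L3}" by (rule UNIV_letter)
  consider "M1 = img c1 M2" | "M1 = img c2 M2" "M2 = img c1 M3" | "M1 = img c2 M2" "M2 = img c2 M3"
    using i by blast
  then show ?thesis
  proof cases
    case 1
    have "ext M0 [] = {(x, L1) | x. x \<in> UNIV} \<union> {(L1, y) | y. y \<in> UNIV \<and> y \<noteq> L1}"
      using M ext_square_Nil[OF B(2)] unfolding i(1) 1 by (simp add: full_language_def)
    also have "\<dots> = {(L1, L2), (L1, L3), (L1, L1), (L2, L1), (L3, L1)}"
      unfolding U by auto
    finally show ?thesis using good_star by simp
  next
    case 2
    have f: "first1 \<circ> (?f \<circ> first1) = (\<lambda>_. L1)"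
    proof
      fix x show "(first1 \<circ> (?f \<circ> first1)) x = L1" by (cases x) auto
    qed
    have "ext M0 [] = insert (L1, L3) (insert (L1, L2) (insert (L3, L2)
        (map_prod (last1 \<circ> (?l \<circ> last1)) (first1 \<circ> (?f \<circ> first1)) ` ext M3 [])))"
      unfolding i(1) ext_c1_Nil[OF B(1) two(1)] unfolding 2(1) ext_c2_Nil[OF B(2) two(2)]
      unfolding 2(2) ext_c1_Nil[OF B(3) two(3)]
      by (simp add: image_map_prod comp_assoc)
    also have "\<dots> = {(L1, L3), (L1, L2), (L3, L2), (L3, L1), (L2, L1)}"
      unfolding f map_prod_const full_ext_Nil[OF M(4)] unfolding U by auto
    finally show ?thesis using good_path1 by simp
  next
    case 3
    have l: "?l \<circ> ?l = (\<lambda>_. L3)"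
    proof
      fix x show "(?l \<circ> ?l) x = L3" by (cases x) auto
    qed
    have f: "first1 \<circ> (?f \<circ> ?f) = first1"
    proof
      fix x show "(first1 \<circ> (?f \<circ> ?f)) x = first1 x" by (cases x) auto
    qed
    have "ext M0 [] = insert (L1, L3) (insert (L1, L2) (insert (L3, L2)
        (map_prod (last1 \<circ> (?l \<circ> ?l)) (first1 \<circ> (?f \<circ> ?f)) ` ext M3 [])))"
      unfolding i(1) ext_c1_Nil[OF B(1) two(1)] unfolding 3(1) ext_c2_Nil[OF B(2) two(2)]
      unfolding 3(2) ext_c2_Nil[OF B(3) two(3)]
      by (simp add: image_map_prod comp_assoc)
    also have "map_prod (last1 \<circ> (?l \<circ> ?l)) (first1 \<circ> (?f \<circ> ?f)) ` ext M3 [] = map_prod (\<lambda>_. L2) first1 ` ext M3 []"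
      unfolding f l by (simp add: comp_def)
    also have "insert (L1, L3) (insert (L1, L2) (insert (L3, L2) (map_prod (\<lambda>_. L2) first1 ` ext M3 [])))
        = {(L1, L3), (L1, L2), (L3, L2), (L2, L1), (L2, L2)}"
      unfolding map_prod_const' full_ext_Nil[OF M(4)] unfolding U by auto
    finally show ?thesis using good_path2 by simp
  qed
qed

section \<open>All bispecial words have good extension graphs\<close>

text \<open>
  A bispecial word and its ancestor may have the same length. With these weights for words at
  levels where \<open>c1\<close> is applied, and the mirrored weights 2, 4, 3 where \<open>c2\<close> is applied, the
  ancestor always has smaller weight.
\<close>
primrec weight_letter :: "letter \<Rightarrow> nat" where
  "weight_letter L1 = 3" | "weight_letter L2 = 4" | "weight_letter L3 = 2"

definition weight :: "letter list \<Rightarrow> nat" where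
  "weight u = sum_list (map weight_letter u)"

lemma weight_simps [simp]: "weight [] = 0" "weight (a # u) = weight_letter a + weight u"
  "weight (u @ v) = weight u + weight v"
  by (simp_all add: weight_def)

lemma weight_c1: "u \<noteq> [] \<Longrightarrow> weight (mirror u) < weight (c1 u)"
proof (induction u)
  case (Cons a u)
  then show ?case by (cases a; cases "u = []") auto
qed simp

lemma weight_c1_c1: "weight u \<le> weight (c1 (c1 u))" "weight (mirror u) \<le> weight (c1 (c1 u))"
proof (induction u)
  case (Cons a u)
  case 1 then show ?case using Cons by (cases a) auto
  case 2 then show ?case using Cons by (cases a) auto
qed auto

text \<open>
  The languages of the successive desubstitutions of an adic word, with all three letters
  occurring at each level.
\<close>
definition directed_chain :: "(nat \<Rightarrow> letter list \<Rightarrow> letter list) \<Rightarrow> (nat \<Rightarrow> letter list set) \<Rightarrow> bool" where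
  "directed_chain \<sigma> M \<longleftrightarrow> (\<forall>n. \<sigma> n \<in> \<C> \<and> full_language (M n) \<and> M n = img (\<sigma> n) (M (Suc n)))"

definition swap_c :: "(letter list \<Rightarrow> letter list) \<Rightarrow> letter list \<Rightarrow> letter list" where
  "swap_c f = mirror \<circ> f \<circ> mirror"

lemma c1_neq_c2: "c1 \<noteq> c2"
proof
  assume "c1 = c2"
  then have "c1 [L1] = c2 [L1]" by simp
  then show False by simp
qed

lemma swap_c_simps [simp]: "swap_c c1 = c2" "swap_c c2 = c1"
  by (auto simp: swap_c_def mirror_c1 mirror_c2)

lemma directed_chain_mirror:
  assumes "directed_chain \<sigma> M"
  shows "directed_chain (\<lambda>n. swap_c (\<sigma> n)) (\<lambda>n. mirror_lang (M n))"
  unfolding directed_chain_def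
proof (intro allI conjI)
  fix n
  have n: "\<sigma> n \<in> \<C>" "full_language (M n)" "M n = img (\<sigma> n) (M (Suc n))"
    using assms unfolding directed_chain_def by blast+
  show "swap_c (\<sigma> n) \<in> \<C>" using n(1) by (auto simp: \<C>_def)
  show "full_language (mirror_lang (M n))"
    using n(2) biextendable_mirror unfolding full_language_def by (simp add: mem_mirror_lang)
  show "mirror_lang (M n) = img (swap_c (\<sigma> n)) (mirror_lang (M (Suc n)))"
    using n(1) mirror_img_c1 mirror_img_c2 by (subst n(3)) (auto simp: \<C>_def)
qed

text \<open>
  Induction on the weight. By mirror symmetry the first substitution may be taken to be \<open>c1\<close>; the
  second one decides how the ancestor is found.
\<close>
lemma good_bispecial:
  assumes "directed_chain \<sigma> M" "bispecial_in (M n) U"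
    "weight (if \<sigma> n = c1 then U else mirror U) = k"
  shows "good (ext (M n) U)"
  using assms
proof (induction k arbitrary: \<sigma> M n U rule: less_induct)
  case (less k)
  have main: "good (ext (M n) U)" if ch: "directed_chain \<sigma> M" and U: "bispecial_in (M n) U"
    and n: "\<sigma> n = c1" and k: "weight U = k" for \<sigma> M U
  proof -
    have chn: "\<sigma> i = c1 \<or> \<sigma> i = c2" "full_language (M i)" "M i = img (\<sigma> i) (M (Suc i))" for i
      using ch unfolding directed_chain_def \<C>_def by blast+
    have bi: "biextendable (M i)" for i using chn(2) unfolding full_language_def by blast
    show ?thesis
    proof (cases "U = []")
      case True
      have "good (ext (M n) [])"
        by (rule good_ext_Nil[OF chn(2) chn(2)[of "Suc n"] chn(2)[of "Suc (Suc n)"] chn(2)[of "Suc (Suc (Suc n))"]])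
          (metis chn(1,3) n)+
      then show ?thesis using True by simp
    next
      case False
      show ?thesis
      proof (cases "\<sigma> (Suc n) = c1")
        case True
        have X: "M n = img c1 (img c1 (M (Suc (Suc n))))"
          using chn(3)[of n] chn(3)[of "Suc n"] n True by simp
        obtain z where z: "U = c1 (c1 z) @ [L1]" "ext (M n) U = ext (M (Suc (Suc n))) z"
          by (rule bispecial_square[OF bi X U False])
        have "bispecial_in (M (Suc (Suc n))) z"
          using U z(2) Domain_ext[OF biextendable_right[OF bi]] Range_ext[OF bi] unfolding bispecial_in_def by metis
        moreover have "weight (if \<sigma> (Suc (Suc n)) = c1 then z else mirror z) < k"
          using weight_c1_c1[of z] k unfolding z(1) by auto
        ultimately show ?thesis using less.IH[OF _ ch] z(2) by simp
      next
        case False2: False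
        then have c2: "\<sigma> (Suc n) = c2" using chn(1) by blast
        have mixed: "b = L3" if "[L1, b] \<in> M (Suc n)" for b
        proof -
          have "[mirror_letter b, L3] \<in> img c1 (mirror_lang (M (Suc (Suc n))))"
            using that chn(3)[of "Suc n"] unfolding c2 by (simp add: mirror_img_c2[symmetric] mem_mirror_lang)
          then have "mirror_letter b = L1" using before_L3[of _ "[]"] by blast
          then show ?thesis by (cases b) auto
        qed
        have X: "M n = img c1 (M (Suc n))" using chn(3)[of n] n by simp
        obtain u where u: "bispecial_in (M (Suc n)) u" "U = c1 u \<or> U = c1 u @ [L1]"
          "good (ext (M (Suc n)) u) \<Longrightarrow> good (ext (M n) U)"
          using bispecial_mixed[OF bi X mixed U False] by blast
        have "weight (mirror u) < weight U"
          using u(2) weight_c1[of u] False by (cases "u = []") auto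
        then have "weight (if \<sigma> (Suc n) = c1 then u else mirror u) < k"
          using k False2 by simp
        then show ?thesis using less.IH[OF _ ch u(1)] u(3) by blast
      qed
    qed
  qed
  show ?case
  proof (cases "\<sigma> n = c1")
    case True
    then show ?thesis using main less.prems by simp
  next
    case False
    then have c2: "\<sigma> n = c2" using less.prems(1) unfolding directed_chain_def \<C>_def by blast
    have "good (ext (mirror_lang (M n)) (mirror U))"
      by (rule main[OF directed_chain_mirror[OF less.prems(1)]])
        (use less.prems False c2 in \<open>simp_all add: bispecial_mirror\<close>)
    then show ?thesis using good_mirror[of "ext (mirror_lang (M n)) (mirror U)"] by (simp add: ext_mirror)
  qed
qed

section \<open>Desubstituting an adic word\<close>

text \<open>
  A weak form of convergence, along a subsequence that may depend on the prefix; it suffices for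
  desubstitution and is obtained below by a compactness argument.
\<close>
definition adherent :: "(nat \<Rightarrow> 'a list) \<Rightarrow> 'a word \<Rightarrow> bool" where
  "adherent U w \<longleftrightarrow> (\<forall>k. \<exists>\<^sub>\<infinity>n. k \<le> length (U n) \<and> take k (U n) = w [0 \<rightarrow> k])"

lemma adherent_if_converge: "words_converge U w \<Longrightarrow> adherent U w"
  unfolding words_converge_def adherent_def
  by (auto simp: INFM_nat eventually_sequentially) (metis le_less_linear less_Suc_eq_le nat_le_linear order.strict_trans2)

text \<open>
  The word \<open>w'\<close> is constructed letter by letter, as in Koenig's lemma: a prefix is kept if it begins
  infinitely many of the \<open>U n\<close> whose images agree with \<open>w\<close> up to any prescribed length, and since
  there are finitely many letters one of them continues it. The bound \<open>K\<close> ensures that the \<open>U n\<close>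
  themselves become long.
\<close>
lemma adherent_desubstitute:
  fixes c :: "'a::finite list \<Rightarrow> 'b list"
  assumes c: "morphism c" and K: "\<And>u. length (c u) \<le> K * length u"
    and ad: "adherent (\<lambda>n. c (U n)) w"
  obtains w' where "adherent U w'" "word_image c w' w"
proof -
  define Q where "Q m v n \<longleftrightarrow> m \<le> length (U n) \<and> m \<le> length (c (U n)) \<and> take m (c (U n)) = w [0 \<rightarrow> m]
    \<and> take (length v) (U n) = v" for m v n
  have Q_mono: "Q m v n" if "Q m' v n" "m \<le> m'" for m m' v n
  proof -
    have "take m (c (U n)) = take m (take m' (c (U n)))" using that(2) by (simp add: min_absorb1)
    also have "\<dots> = w [0 \<rightarrow> m]" using that unfolding Q_def by simp
    finally show ?thesis using that unfolding Q_def by auto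
  qed
  define P where "P v \<longleftrightarrow> (\<forall>m. \<exists>\<^sub>\<infinity>n. Q m v n)" for v
  have P0: "P []"
    unfolding P_def
  proof
    fix m
    \<comment> \<open>An image of length greater than \<open>K * m\<close> comes from a word of length greater than \<open>m\<close>.\<close>
    have "\<exists>\<^sub>\<infinity>n. Suc (m + K * m) \<le> length (c (U n)) \<and> take (Suc (m + K * m)) (c (U n)) = w [0 \<rightarrow> Suc (m + K * m)]"
      using ad unfolding adherent_def by blast
    then show "\<exists>\<^sub>\<infinity>n. Q m [] n"
    proof (rule INFM_mono)
      fix n assume n: "Suc (m + K * m) \<le> length (c (U n)) \<and> take (Suc (m + K * m)) (c (U n)) = w [0 \<rightarrow> Suc (m + K * m)]"
      then have "K * m < K * length (U n)" using K[of "U n"] by linarith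
      then have "m \<le> length (U n)" by simp
      moreover have "take m (c (U n)) = take m (take (Suc (m + K * m)) (c (U n)))" by (simp add: min_absorb1)
      then have "take m (c (U n)) = w [0 \<rightarrow> m]" using n by simp
      ultimately show "Q m [] n" using n by (auto simp: Q_def)
    qed
  qed
  have step: "\<exists>a. P (v @ [a])" if v: "P v" for v
  proof (rule ccontr)
    assume "\<not> ?thesis"
    then have "\<forall>a. \<exists>m. finite {n. Q m (v @ [a]) n}" by (auto simp: P_def INFM_iff_infinite)
    then obtain M where M: "\<And>a. finite {n. Q (M a) (v @ [a]) n}" by metis
    define m where "m = Suc (length v) + Max (range M)"
    have "{n. Q m v n} \<subseteq> (\<Union>a. {n. Q (M a) (v @ [a]) n})"
    proof
      fix n assume "n \<in> {n. Q m v n}"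
      then have n: "Q m v n" by simp
      define a where "a = U n ! length v"
      have "length v < length (U n)" using n by (simp add: Q_def m_def)
      then have "take (Suc (length v)) (U n) = v @ [a]"
        using n by (simp add: take_Suc_conv_app_nth a_def Q_def)
      then have "Q m (v @ [a]) n" using n by (simp add: Q_def)
      moreover have "M a \<le> Max (range M)" by (rule Max_ge) auto
      then have "M a \<le> m" unfolding m_def by linarith
      ultimately show "n \<in> (\<Union>a. {n. Q (M a) (v @ [a]) n})" using Q_mono by blast
    qed
    then have "finite {n. Q m v n}" using M by (meson finite finite_UN_I finite_subset)
    then show False using v by (auto simp: P_def INFM_iff_infinite)
  qed
  have "\<exists>f. \<forall>k. (P (f k) \<and> length (f k) = k) \<and> (\<exists>a. f (Suc k) = f k @ [a])"
  proof (rule dependent_nat_choice)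
    show "\<exists>v. P v \<and> length v = 0" using P0 by auto
    show "\<exists>y. (P y \<and> length y = Suc k) \<and> (\<exists>a. y = v @ [a])" if "P v \<and> length v = k" for v k
      using step[of v] that by auto
  qed
  then obtain f where f: "\<And>k. P (f k)" "\<And>k. length (f k) = k" "\<And>k. \<exists>a. f (Suc k) = f k @ [a]" by blast
  \<comment> \<open>The words \<open>f k\<close> are nested, so their last letters spell the limit.\<close>
  define w' where "w' k = last (f (Suc k))" for k
  have w': "w' [0 \<rightarrow> k] = f k" for k
  proof (induction k)
    case (Suc k)
    then show ?case using f(3)[of k] by (auto simp: w'_def)
  qed (use f(2)[of 0] in simp)
  have "adherent U w'"
    unfolding adherent_def
  proof
    fix k
    have "\<exists>\<^sub>\<infinity>n. Q k (f k) n" using f(1)[of k] by (auto simp: P_def)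
    then show "\<exists>\<^sub>\<infinity>n. k \<le> length (U n) \<and> take k (U n) = w' [0 \<rightarrow> k]"
      by (rule INFM_mono) (simp add: Q_def f(2) w')
  qed
  moreover have "word_image c w' w"
    unfolding word_image_def
  proof
    fix k
    define m where "m = length (c (f k))"
    have "\<exists>\<^sub>\<infinity>n. Q m (f k) n" using f(1)[of k] by (auto simp: P_def)
    then obtain n where n: "Q m (f k) n" by (auto dest: INFM_EX)
    then have "U n = f k @ drop k (U n)" by (metis Q_def append_take_drop_id f(2))
    then have "c (U n) = c (f k) @ c (drop k (U n))" by (metis c morphism_simps(2))
    then have "take m (c (U n)) = c (f k)" by (simp add: m_def)
    then show "w [0 \<rightarrow> length (c (w' [0 \<rightarrow> k]))] = c (w' [0 \<rightarrow> k])"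
      using n by (simp add: Q_def m_def w')
  qed
  ultimately show thesis using that by blast
qed

lemma subst_prod_refl: "subst_prod \<sigma> r r = id" by (simp add: subst_prod_def)

lemma subst_prod_Cons: "r < s \<Longrightarrow> subst_prod \<sigma> r s = \<sigma> r \<circ> subst_prod \<sigma> (Suc r) s"
  by (simp add: subst_prod_def upt_conv_Cons)

lemma foldr_comp_id: "foldr (\<circ>) fs g = foldr (\<circ>) fs id \<circ> g"
  by (induction fs) (simp_all add: comp_assoc)

lemma subst_prod_comp:
  assumes "r \<le> s" "s \<le> t"
  shows "subst_prod \<sigma> r t = subst_prod \<sigma> r s \<circ> subst_prod \<sigma> s t"
proof -
  have "[r..<t] = [r..<s] @ [s..<t]" using assms by (metis le_add_diff_inverse upt_add_eq_append)
  then show ?thesis unfolding subst_prod_def using foldr_comp_id[of "map \<sigma> [r..<s]"] by simp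
qed

lemma subst_prod_shift: "subst_prod (\<lambda>n. \<sigma> (n + k)) r s = subst_prod \<sigma> (r + k) (s + k)"
proof -
  have "map (\<lambda>n. n + k) [r..<s] = [r + k..<s + k]" by (induction s) auto
  from arg_cong[OF this, of "map \<sigma>"]
  have "map (\<lambda>n. \<sigma> (n + k)) [r..<s] = map \<sigma> [r + k..<s + k]" by (simp add: comp_def)
  then show ?thesis unfolding subst_prod_def by simp
qed

lemma morphism_subst_prod:
  assumes "\<And>n. morphism (\<sigma> n)" shows "morphism (subst_prod \<sigma> r s)"
proof -
  have "morphism (foldr (\<circ>) (map \<sigma> ns) id)" for ns
  proof (induction ns)
    case Nil
    then show ?case by (simp add: morphism_def)
  next
    case (Cons n ns)
    then show ?case using morphism_comp[OF assms[of n] Cons] by (simp add: comp_def)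
  qed
  then show ?thesis unfolding subst_prod_def by blast
qed

definition word_chain :: "(nat \<Rightarrow> 'a list \<Rightarrow> 'a list) \<Rightarrow> (nat \<Rightarrow> 'a word) \<Rightarrow> bool" where
  "word_chain \<sigma> ws \<longleftrightarrow> (\<forall>n. word_image (\<sigma> n) (ws (Suc n)) (ws n))"

lemma length_c: "length (c1 u) \<le> 2 * length u" "length (c2 u) \<le> 2 * length u"
proof (induction u)
  case (Cons a u)
  case 1 then show ?case using Cons by (cases a) auto
  case 2 then show ?case using Cons by (cases a) auto
qed auto

lemma morphism_\<C>: "c \<in> \<C> \<Longrightarrow> morphism c"
  by (auto simp: \<C>_def morphism_c1 morphism_c2)

lemma word_chain_if_adic:
  assumes "\<C>_adic \<sigma> w"
  obtains ws where "ws 0 = w" "word_chain \<sigma> ws"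
proof -
  have \<sigma>: "\<sigma> n \<in> \<C>" for n using assms by (auto simp: \<C>_adic_def)
  obtain a where a: "words_converge (\<lambda>n. subst_prod \<sigma> 0 n [a n]) w" using assms by (auto simp: \<C>_adic_def)
  have step: "\<exists>v'. adherent (\<lambda>n. subst_prod \<sigma> (Suc r) n [a n]) v' \<and> word_image (\<sigma> r) v' v"
    if "adherent (\<lambda>n. subst_prod \<sigma> r n [a n]) v" for r v
  proof -
    have ad: "adherent (\<lambda>n. \<sigma> r (subst_prod \<sigma> (Suc r) n [a n])) v"
      unfolding adherent_def
    proof
      fix k
      have "\<exists>\<^sub>\<infinity>n. k \<le> length (subst_prod \<sigma> r n [a n]) \<and> take k (subst_prod \<sigma> r n [a n]) = v [0 \<rightarrow> k]"
        using that unfolding adherent_def by blast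
      moreover have "\<forall>\<^sub>\<infinity>n. r < n" by (simp add: MOST_nat) blast
      ultimately have "\<exists>\<^sub>\<infinity>n. (k \<le> length (subst_prod \<sigma> r n [a n]) \<and> take k (subst_prod \<sigma> r n [a n]) = v [0 \<rightarrow> k]) \<and> r < n"
        by (rule INFM_conjI)
      then show "\<exists>\<^sub>\<infinity>n. k \<le> length (\<sigma> r (subst_prod \<sigma> (Suc r) n [a n]))
          \<and> take k (\<sigma> r (subst_prod \<sigma> (Suc r) n [a n])) = v [0 \<rightarrow> k]"
        by (rule INFM_mono) (auto simp: subst_prod_Cons)
    qed
    have len: "length (\<sigma> r u) \<le> 2 * length u" for u using \<sigma>[of r] length_c by (auto simp: \<C>_def)
    obtain v' where "adherent (\<lambda>n. subst_prod \<sigma> (Suc r) n [a n]) v'" "word_image (\<sigma> r) v' v"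
      by (rule adherent_desubstitute[OF morphism_\<C>[OF \<sigma>] len ad])
    then show ?thesis by blast
  qed
  have "\<exists>ws. \<forall>r. (adherent (\<lambda>n. subst_prod \<sigma> r n [a n]) (ws r) \<and> (r = 0 \<longrightarrow> ws r = w))
      \<and> word_image (\<sigma> r) (ws (Suc r)) (ws r)"
  proof (rule dependent_nat_choice)
    show "\<exists>v. adherent (\<lambda>n. subst_prod \<sigma> 0 n [a n]) v \<and> (0 = (0::nat) \<longrightarrow> v = w)"
      using adherent_if_converge[OF a] by blast
  qed (use step in auto)
  then show thesis using that unfolding word_chain_def by blast
qed

lemma word_chain_prod:
  assumes "word_chain \<sigma> ws" "r \<le> s"
  shows "word_image (subst_prod \<sigma> r s) (ws s) (ws r)"
  using assms(2)
proof (induction s rule: dec_induct)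
  case base
  then show ?case by (simp add: subst_prod_refl word_image_def)
next
  case (step s)
  have "subst_prod \<sigma> r (Suc s) = subst_prod \<sigma> r s \<circ> \<sigma> s"
    using subst_prod_comp[of r s "Suc s" \<sigma>] step.hyps by (simp add: subst_prod_Cons subst_prod_refl)
  then show ?case
    using word_image_comp[OF step.IH] assms(1) unfolding word_chain_def by metis
qed

lemma word_image_block:
  assumes c: "morphism c" and w: "word_image c w' w"
  shows "w [length (c (w' [0 \<rightarrow> m])) \<rightarrow> length (c (w' [0 \<rightarrow> Suc m]))] = c [w' m]"
proof -
  have D: "c (w' [0 \<rightarrow> Suc m]) = c (w' [0 \<rightarrow> m]) @ c [w' m]"
    using morphism_simps(2)[OF c] by simp
  have "w [0 \<rightarrow> length (c (w' [0 \<rightarrow> Suc m]))] = c (w' [0 \<rightarrow> m]) @ c [w' m] @ []"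
    using w[unfolded word_image_def, rule_format, of "Suc m"] unfolding D by simp
  from infix_of_prefix(1)[OF this] show ?thesis unfolding D by simp
qed

lemma word_chain_language:
  assumes "word_chain \<sigma> ws" "\<And>n. morphism (\<sigma> n)"
  shows "language (ws n) = img (\<sigma> n) (language (ws (Suc n)))"
  using assms unfolding word_chain_def by (intro language_word_image) auto

section \<open>Uniform recurrence of words with primitive directive sequences\<close>

text \<open>
  An occurrence in every window of a fixed length bounds the gaps and yields infinitely many
  occurrences.
\<close>
lemma uniformly_recurrentI:
  assumes "\<And>u. u \<in> language w \<Longrightarrow> \<exists>g. \<forall>i. \<exists>j\<in>occurrences w u. i \<le> j \<and> j \<le> i + g"
  shows "uniformly_recurrent w"
  unfolding uniformly_recurrent_def
proof (intro ballI conjI)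
  fix u assume "u \<in> language w"
  then obtain g where g: "\<And>i. \<exists>j\<in>occurrences w u. i \<le> j \<and> j \<le> i + g" using assms by blast
  show "infinite (occurrences w u)"
    unfolding infinite_nat_iff_unbounded_le using g by blast
  show "\<exists>g. \<forall>i\<in>occurrences w u. \<forall>j\<in>occurrences w u.
      i < j \<and> {i<..<j} \<inter> occurrences w u = {} \<longrightarrow> j - i \<le> g"
  proof (intro exI ballI impI)
    fix i j assume i: "i < j \<and> {i<..<j} \<inter> occurrences w u = {}"
    obtain k where k: "k \<in> occurrences w u" "Suc i \<le> k" "k \<le> Suc i + g" using g by blast
    have "k \<notin> {i<..<j}" using i k(1) by blast
    then have "\<not> k < j" using k(2) by simp
    then show "j - i \<le> Suc g" using k by simp
  qed
qed

lemma biextendable_if_recurrent: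
  assumes "uniformly_recurrent w" shows "biextendable (language w)"
  unfolding biextendable_def
proof (intro conjI ballI right_extendable_language)
  fix u assume "u \<in> language w"
  then have "infinite (occurrences w u)" using assms unfolding uniformly_recurrent_def by blast
  then obtain i where i: "i \<in> occurrences w u" "1 \<le> i" unfolding infinite_nat_iff_unbounded_le by blast
  then have "w [i - 1 \<rightarrow> i + length u] = w (i - 1) # u"
    using subsequence_append'[of "i - 1" i "i + length u" w] subsequence_singleton[of w "i - 1"]
    by (simp add: occurrences_def)
  then show "\<exists>a. a # u \<in> language w" unfolding language_def by (metis (mono_tags, lifting) diff_le_self le_add1 le_trans mem_Collect_eq)
qed

text \<open>
  Primitivity relative to a set of letters. A sequence of squares of the two substitutions is never
  primitive on all three letters, since 2 arises only from 2, but it may be on the letters 1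
  and 3.
\<close>
definition primitive_on :: "'a set \<Rightarrow> (nat \<Rightarrow> 'a list \<Rightarrow> 'a list) \<Rightarrow> bool" where
  "primitive_on B \<tau> \<longleftrightarrow> (\<forall>r. \<exists>s>r. \<forall>a\<in>B. \<forall>b\<in>B. a \<in> set (subst_prod \<tau> r s [b]))"

lemma morphism_length_two:
  assumes "morphism c" "x \<in> set u" "y \<in> set u" "x \<noteq> y"
  shows "length (c [x]) + length (c [y]) \<le> length (c u)"
proof -
  obtain p q where u: "u = p @ [x] @ q" using split_list[OF assms(2)] by auto
  have mem: "length (c [y]) \<le> length (c v)" if yv: "y \<in> set v" for v
  proof -
    obtain s t where "v = s @ [y] @ t" using split_list[OF yv] by auto
    then show ?thesis by (simp only: morphism_simps(2)[OF assms(1)]) simp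
  qed
  have "y \<in> set p \<or> y \<in> set q" using assms(3,4) u by auto
  then show ?thesis using mem unfolding u by (auto simp: morphism_simps(2)[OF assms(1)] simp del: append_Cons append_Nil intro: trans_le_add1 trans_le_add2)
qed

text \<open>
  By primitivity the images of letters grow, so each factor lies in the image of one
  letter from a certain level; again by primitivity, that letter occurs in the images of all letters
  of a deeper level, and the word is a concatenation of such images.
\<close>
lemma primitive_uniformly_recurrent:
  fixes ws :: "nat \<Rightarrow> 'a::finite word"
  assumes ch: "word_chain \<tau> ws" and mor: "\<And>n. morphism (\<tau> n)"
    and B: "\<And>n. range (ws n) \<subseteq> B" "x \<in> B" "y \<in> B" "x \<noteq> y" and prim: "primitive_on B \<tau>"
  shows "uniformly_recurrent (ws 0)" "range (ws 0) = B"
proof -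
  have mp: "morphism (subst_prod \<tau> r s)" for r s using mor by (rule morphism_subst_prod)
  have grow: "\<exists>s. \<forall>b\<in>B. k \<le> length (subst_prod \<tau> 0 s [b])" for k
  proof (induction k)
    case (Suc k)
    then obtain s where s: "\<forall>b\<in>B. k \<le> length (subst_prod \<tau> 0 s [b])" by blast
    obtain t where t: "t > s" "\<forall>a\<in>B. \<forall>b\<in>B. a \<in> set (subst_prod \<tau> s t [b])"
      using prim unfolding primitive_on_def by blast
    have "Suc k \<le> length (subst_prod \<tau> 0 t [b])" if "b \<in> B" for b
    proof -
      have "subst_prod \<tau> 0 t = subst_prod \<tau> 0 s \<circ> subst_prod \<tau> s t"
        using t(1) by (intro subst_prod_comp) auto
      moreover have "length (subst_prod \<tau> 0 s [x]) + length (subst_prod \<tau> 0 s [y])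
          \<le> length (subst_prod \<tau> 0 s (subst_prod \<tau> s t [b]))"
        using t(2) B that by (intro morphism_length_two mp) auto
      moreover have "length (subst_prod \<tau> 0 s [y]) \<ge> 1"
        using morphism_simps(3)[OF mp[of 0 s]] by (simp add: Suc_le_eq)
      ultimately show ?thesis using s B(2) by fastforce
    qed
    then show ?case by blast
  qed simp
  have block: "ws 0 [length (subst_prod \<tau> 0 t (ws t [0 \<rightarrow> m])) \<rightarrow> length (subst_prod \<tau> 0 t (ws t [0 \<rightarrow> Suc m]))]
      = subst_prod \<tau> 0 t [ws t m]" for t m
    by (rule word_image_block[OF mp word_chain_prod[OF ch le0]])
  have everywhere: "\<exists>t. \<forall>b\<in>B. sublist u (subst_prod \<tau> 0 t [b])" if mem: "u \<in> language (ws 0)" for u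
  proof -
    obtain k where k: "sublist u (ws 0 [0 \<rightarrow> k])" using mem by (auto simp: language_iff)
    obtain s where s: "\<forall>b\<in>B. k \<le> length (subst_prod \<tau> 0 s [b])" using grow by blast
    define b0 where "b0 = ws s 0"
    have b0: "b0 \<in> B" using B(1) by (auto simp: b0_def)
    have "ws 0 [0 \<rightarrow> length (subst_prod \<tau> 0 s [b0])] = subst_prod \<tau> 0 s [b0]"
      using block[of s 0] morphism_simps(1)[OF mp[of 0 s]] by (simp add: b0_def)
    moreover have "ws 0 [0 \<rightarrow> length (subst_prod \<tau> 0 s [b0])] = ws 0 [0 \<rightarrow> k] @ ws 0 [k \<rightarrow> length (subst_prod \<tau> 0 s [b0])]"
      using s b0 by (intro subsequence_append') auto
    ultimately have u: "sublist u (subst_prod \<tau> 0 s [b0])"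
      using k sublist_order.order_trans by (metis sublist_append_rightI)
    obtain t where t: "t > s" "\<forall>a\<in>B. \<forall>b\<in>B. a \<in> set (subst_prod \<tau> s t [b])"
      using prim unfolding primitive_on_def by blast
    have "sublist u (subst_prod \<tau> 0 t [b])" if "b \<in> B" for b
    proof -
      have "b0 \<in> set (subst_prod \<tau> s t [b])" using t b0 that by blast
      then have "sublist [b0] (subst_prod \<tau> s t [b])"
        unfolding sublist_def by (metis append_Cons append_Nil split_list)
      then have "sublist (subst_prod \<tau> 0 s [b0]) (subst_prod \<tau> 0 s (subst_prod \<tau> s t [b]))"
        by (rule morphism_sublist[OF mp])
      then show ?thesis
        using u t(1) sublist_order.order_trans by (simp add: subst_prod_comp[of 0 s t])
    qed
    then show ?thesis by blast
  qed
  show "uniformly_recurrent (ws 0)"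
  proof (rule uniformly_recurrentI)
    fix u assume "u \<in> language (ws 0)"
    then obtain t where t: "\<forall>b\<in>B. sublist u (subst_prod \<tau> 0 t [b])" using everywhere by blast
    define D where "D = subst_prod \<tau> 0 t"
    define K where "K = Max (range (\<lambda>b. length (D [b])))"
    have K: "length (D [b]) \<le> K" for b unfolding K_def by (rule Max_ge) auto
    define p where "p m = length (D (ws t [0 \<rightarrow> m]))" for m
    have pS: "p (Suc m) = p m + length (D [ws t m])" for m
      unfolding p_def using morphism_simps(2)[OF mp[of 0 t]] by (simp add: D_def)
    have "\<exists>j\<in>occurrences (ws 0) u. i \<le> j \<and> j \<le> i + (K + K)" for i
    proof -
      have "i \<le> p i" unfolding p_def D_def using morphism_length[OF mp, of "ws t [0 \<rightarrow> i]"] by simp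
      \<comment> \<open>The first block that starts at or after position \<open>i\<close>.\<close>
      define m where "m = (LEAST m. i \<le> p m)"
      have m: "i \<le> p m" unfolding m_def by (rule LeastI[of _ i]) fact
      have "p m \<le> i + K"
      proof (cases m)
        case 0
        then show ?thesis using morphism_simps(1)[OF mp[of 0 t]] by (simp add: p_def D_def)
      next
        case (Suc m')
        then have "\<not> i \<le> p m'" using not_less_Least[of m' "\<lambda>m. i \<le> p m"] by (simp add: m_def)
        then show ?thesis using pS[of m'] K[of "ws t m'"] Suc by simp
      qed
      have "ws t m \<in> B" using B(1) by auto
      then obtain A A' where A: "D [ws t m] = A @ u @ A'" using t by (auto simp: D_def sublist_def)
      have "ws 0 [0 \<rightarrow> p (Suc m)] = ws 0 [0 \<rightarrow> p m] @ ws 0 [p m \<rightarrow> p (Suc m)]"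
        by (rule subsequence_append') (simp_all add: pS)
      also have "ws 0 [p m \<rightarrow> p (Suc m)] = D [ws t m]" unfolding p_def D_def by (rule block)
      finally have "ws 0 [0 \<rightarrow> p (Suc m)] = (ws 0 [0 \<rightarrow> p m] @ A) @ u @ A'" using A by simp
      from infix_of_prefix[OF this] have "p m + length A \<in> occurrences (ws 0) u"
        by (simp add: occurrences_def)
      moreover have "length A \<le> K" using K[of "ws t m"] A by simp
      ultimately show ?thesis using m \<open>p m \<le> i + K\<close> by (intro bexI[of _ "p m + length A"]) auto
    qed
    then show "\<exists>g. \<forall>i. \<exists>j\<in>occurrences (ws 0) u. i \<le> j \<and> j \<le> i + g" by blast
  qed
  have "b \<in> range (ws 0)" if "b \<in> B" for b
  proof -
    obtain t where t: "\<forall>a\<in>B. \<forall>b\<in>B. a \<in> set (subst_prod \<tau> 0 t [b])"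
      using prim unfolding primitive_on_def by blast
    have "ws 0 [0 \<rightarrow> length (subst_prod \<tau> 0 t [ws t 0])] = subst_prod \<tau> 0 t [ws t 0]"
      using block[of t 0] morphism_simps(1)[OF mp[of 0 t]] by simp
    moreover have "b \<in> set (subst_prod \<tau> 0 t [ws t 0])" using t that subsetD[OF B(1) rangeI] by blast
    ultimately have "b \<in> set (ws 0 [0 \<rightarrow> length (subst_prod \<tau> 0 t [ws t 0])])" by (simp only:)
    then show ?thesis unfolding set_subsequence by blast
  qed
  then show "range (ws 0) = B" using B(1) by blast
qed

section \<open>Primitive directive sequences\<close>

lemma set_c1: "set (c1 u) = (\<Union>a\<in>set u. set (c1_letter a))" by (simp add: c1_def)
lemma set_c2: "set (c2 u) = (\<Union>a\<in>set u. set (c2_letter a))" by (simp add: c2_def)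

lemma set_subst_C:
  assumes "c \<in> \<C>"
  shows "set u = UNIV \<Longrightarrow> set (c u) = UNIV"
    and "L2 \<in> set u \<Longrightarrow> {L1, L3} \<subseteq> set (c u)"
proof -
  have eq: "set (c u) = (\<Union>a\<in>set u. set (c [a]))" by (rule morphism_set[OF morphism_\<C>[OF assms]])
  show "{L1, L3} \<subseteq> set (c u)" if "L2 \<in> set u"
  proof -
    have "set (c [L2]) \<subseteq> set (c u)" using that unfolding eq by blast
    then show ?thesis using assms by (auto simp: \<C>_def)
  qed
  show "set (c u) = UNIV" if "set u = UNIV"
  proof -
    have "set (c [L1]) \<union> set (c [L2]) \<union> set (c [L3]) \<subseteq> set (c u)" unfolding eq that by blast
    moreover have "set (c [L1]) \<union> set (c [L2]) \<union> set (c [L3]) = UNIV"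
      using assms by (auto simp: \<C>_def UNIV_letter)
    ultimately show ?thesis by blast
  qed
qed

text \<open>
  Two different substitutions in a row turn the letters 1 and 3 into all letters, two equal ones
  only keep them.
\<close>
lemma set_subst_pair:
  assumes "c \<in> \<C>" "d \<in> \<C>" "{L1, L3} \<subseteq> set u"
  shows "{L1, L3} \<subseteq> set (c (d u))" "c \<noteq> d \<Longrightarrow> set (c (d u)) = UNIV"
proof -
  have "set (c (d u)) = (\<Union>a\<in>set u. set (c (d [a])))"
    using morphism_set[OF morphism_comp[OF morphism_\<C>[OF assms(1)] morphism_\<C>[OF assms(2)]], of u] by simp
  then have m: "set (c (d [L1])) \<union> set (c (d [L3])) \<subseteq> set (c (d u))" using assms(3) by blast
  have "{L1, L3} \<subseteq> set (c (d [L1])) \<union> set (c (d [L3]))"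
    using assms(1,2) by (auto simp: \<C>_def)
  then show "{L1, L3} \<subseteq> set (c (d u))" using m by blast
  show "set (c (d u)) = UNIV" if "c \<noteq> d"
  proof -
    have "set (c (d [L1])) \<union> set (c (d [L3])) = UNIV"
      using assms(1,2) that by (auto simp: \<C>_def UNIV_letter)
    then show ?thesis using m by blast
  qed
qed

text \<open>
  Starting from any letter, once both substitutions have been applied, the letters 1 and 3
  are present after at most one more step. Then the substitutions are read in pairs. As the
  sequence does not end in squares, a pair of different substitutions is met whatever the parity
  of the position at which the pairing began, and it produces all three letters.
\<close>
lemma not_squares_primitive:
  assumes \<sigma>: "range \<sigma> \<subseteq> \<C>" and ns: "\<sigma> \<notin> eventually_squares"
  shows "primitive \<sigma>"
  unfolding primitive_def
proof
  fix r
  have C: "\<sigma> n \<in> \<C>" for n using \<sigma> by blast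
  have mis: "\<exists>i. \<sigma> (N + 2 * i) \<noteq> \<sigma> (N + 2 * i + 1)" for N
    using assms unfolding eventually_squares_def by blast
  obtain i0 where i0: "\<sigma> (r + 2 * i0) \<noteq> \<sigma> (r + 2 * i0 + 1)" using mis by blast
  obtain i1 where i1: "\<sigma> (r + 1 + 2 * i1) \<noteq> \<sigma> (r + 1 + 2 * i1 + 1)" using mis by blast
  \<comment> \<open>Beyond \<open>T\<close> both mismatched pairs, one for each parity, are still to come on the way down to \<open>r\<close>.\<close>
  define T where "T = r + 2 * i0 + 2 * i1 + 4"
  obtain i2 where i2: "\<sigma> (Suc T + 2 * i2) \<noteq> \<sigma> (Suc T + 2 * i2 + 1)" using mis by blast
  define m where "m = T + 2 * i2"
  have m: "T \<le> m" "\<sigma> (Suc m) \<noteq> \<sigma> (Suc (Suc m))" using i2 by (simp_all add: m_def)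
  define s where "s = Suc (Suc (Suc m))"
  have full: "set (subst_prod \<sigma> r s [b]) = UNIV" for b
  proof -
    define S where "S t = set (subst_prod \<sigma> t s [b])" for t
    have S1: "S t = set (\<sigma> t (subst_prod \<sigma> (Suc t) s [b]))" if "t < s" for t
      using that by (simp add: S_def subst_prod_Cons)
    have S2: "S t = set (\<sigma> t (\<sigma> (Suc t) (subst_prod \<sigma> (Suc (Suc t)) s [b])))" if "Suc t < s" for t
      using that by (simp add: S_def subst_prod_Cons)
    have start: "\<exists>t. T \<le> t \<and> t \<le> Suc m \<and> {L1, L3} \<subseteq> S t"
    proof -
      have "subst_prod \<sigma> (Suc m) s [b] = \<sigma> (Suc m) (\<sigma> (Suc (Suc m)) [b])"
        by (simp add: s_def subst_prod_Cons subst_prod_refl)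
      moreover have "(\<sigma> (Suc m) = c1 \<and> \<sigma> (Suc (Suc m)) = c2) \<or> (\<sigma> (Suc m) = c2 \<and> \<sigma> (Suc (Suc m)) = c1)"
        using C[of "Suc m"] C[of "Suc (Suc m)"] m(2) unfolding \<C>_def by auto
      ultimately have "{L1, L3} \<subseteq> S (Suc m) \<or> L2 \<in> S (Suc m)"
        unfolding S_def by (cases b) auto
      moreover have "{L1, L3} \<subseteq> S m" if "L2 \<in> S (Suc m)"
        using set_subst_C(2)[OF C, of "subst_prod \<sigma> (Suc m) s [b]" m] that S1[of m]
        by (simp add: S_def s_def)
      ultimately show ?thesis using m(1) by (meson le_SucI order_refl)
    qed
    then obtain t where t: "T \<le> t" "t \<le> Suc m" "{L1, L3} \<subseteq> S t" by blast
    have down: "{L1, L3} \<subseteq> S (t - 2 * j)" if "2 * j \<le> t" for j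
      using that
    proof (induction j)
      case (Suc j)
      have e: "Suc (Suc (t - 2 * Suc j)) = t - 2 * j" using Suc.prems by simp
      have "Suc (t - 2 * Suc j) < s" using t(2) Suc.prems by (simp add: s_def)
      from S2[OF this] show ?case
        using set_subst_pair(1)[OF C C, of "subst_prod \<sigma> (t - 2 * j) s [b]"] Suc unfolding e by (simp add: S_def)
    qed (use t in simp)
    have UNIV_down: "S r = UNIV" if "r \<le> q" "q \<le> s" "S q = UNIV" for q
      using that
    proof (induction q rule: dec_induct)
      case (step q)
      then show ?case using S1[of q] set_subst_C(1)[OF C, of "subst_prod \<sigma> (Suc q) s [b]" q] by (simp add: S_def)
    qed simp
    have hit: "S r = UNIV" if q: "r \<le> q" "\<sigma> q \<noteq> \<sigma> (q + 1)" "q + 2 \<le> t" "even (t - q)" for q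
    proof -
      obtain j where j: "t - q = 2 * j" using q(4) by (elim evenE)
      then have "t - 2 * (j - 1) = Suc (Suc q)" "2 * (j - 1) \<le> t" using q(3) by auto
      then have "{L1, L3} \<subseteq> S (Suc (Suc q))" using down[of "j - 1"] by simp
      moreover have "Suc q < s" using q(3) t(2) by (simp add: s_def)
      ultimately have "S q = UNIV"
        using S2[of q] set_subst_pair(2)[OF C C] q(2) by (simp add: S_def)
      then show ?thesis using UNIV_down[of q] q \<open>Suc q < s\<close> by simp
    qed
    show ?thesis
    proof (cases "even (t - r)")
      case True
      have "even (t - (r + 2 * i0))" using True by (metis diff_diff_left dvd_diff_nat dvd_triv_left)
      then show ?thesis using hit[of "r + 2 * i0"] i0 t(1) by (simp add: S_def T_def)
    next
      case False
      have "t - (r + 1 + 2 * i1) = (t - r - 1) - 2 * i1" by simp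
      moreover have "even (t - r - 1)" using False by simp
      ultimately have "even (t - (r + 1 + 2 * i1))" by (metis dvd_diff_nat dvd_triv_left)
      then show ?thesis using hit[of "r + 1 + 2 * i1"] i1 t(1) by (simp add: S_def T_def)
    qed
  qed
  have "r < s" using m(1) by (simp add: s_def T_def)
  then show "\<exists>s>r. \<forall>a b. a \<in> set (subst_prod \<sigma> r s [b])" using full by blast
qed

section \<open>Directive sequences of squares\<close>

lemma set_square:
  assumes "c \<in> \<C>"
  shows "a \<noteq> L2 \<Longrightarrow> a \<in> set u \<Longrightarrow> a \<in> set (c (c u))"
    and "L2 \<in> set (c (c u)) \<longleftrightarrow> L2 \<in> set u"
proof -
  have "set (c (c u)) = (\<Union>a\<in>set u. set (c (c [a])))"
    using morphism_set[OF morphism_comp[OF morphism_\<C>[OF assms] morphism_\<C>[OF assms]], of u] by simp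
  moreover have "a \<in> set (c (c [a]))" if "a \<noteq> L2" for a using assms that by (cases a) (auto simp: \<C>_def)
  moreover have "L2 \<in> set (c (c [a])) \<longleftrightarrow> a = L2" for a using assms by (cases a) (auto simp: \<C>_def)
  ultimately show "a \<noteq> L2 \<Longrightarrow> a \<in> set u \<Longrightarrow> a \<in> set (c (c u))" "L2 \<in> set (c (c u)) \<longleftrightarrow> L2 \<in> set u"
    by auto
qed

text \<open>
  Each square maps the letter 2 to a word with exactly one 2 and creates no other. The square of
  \<open>c1\<close> puts a 1 in front of it, so the first occurrence of 2 in a word of the chain lies strictly
  earlier one level below, and never later for the square of \<open>c2\<close>. This cannot happen infinitely
  often.
\<close>
lemma no_L2_in_square_chain:
  assumes \<sigma>: "\<And>i. \<sigma> i \<in> \<C>" and ch: "word_chain (\<lambda>i. \<sigma> i \<circ> \<sigma> i) v" and inf: "\<And>i. \<exists>j\<ge>i. \<sigma> j = c1"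
  shows "v i k \<noteq> L2"
proof -
  have mor: "morphism (\<sigma> i \<circ> \<sigma> i)" for i using morphism_comp morphism_\<C> \<sigma> by blast
  have wi: "v i [0 \<rightarrow> length (\<sigma> i (\<sigma> i (v (Suc i) [0 \<rightarrow> k])))] = \<sigma> i (\<sigma> i (v (Suc i) [0 \<rightarrow> k]))" for i k
    using ch unfolding word_chain_def word_image_def by simp
  have len: "k \<le> length (\<sigma> i (\<sigma> i (v (Suc i) [0 \<rightarrow> k])))" for i k
    using morphism_length[OF mor, of "v (Suc i) [0 \<rightarrow> k]" i] by simp
  define S where "S i p \<longleftrightarrow> (\<exists>k\<le>p. v i k = L2)" for i p
  have in_prefix: "L2 \<in> set (v (Suc i) [0 \<rightarrow> q])" if "v i k = L2" "k < length (\<sigma> i (\<sigma> i (v (Suc i) [0 \<rightarrow> q])))" for i k q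
  proof -
    have "L2 \<in> set (v i [0 \<rightarrow> length (\<sigma> i (\<sigma> i (v (Suc i) [0 \<rightarrow> q])))])" using that by force
    then show ?thesis unfolding wi using set_square(2)[OF \<sigma>] by blast
  qed
  have keep: "S (Suc i) p" if "S i p" for i p
  proof -
    obtain k where k: "k \<le> p" "v i k = L2" using \<open>S i p\<close> by (auto simp: S_def)
    then have "L2 \<in> set (v (Suc i) [0 \<rightarrow> Suc p])" using in_prefix[of i k "Suc p"] len[of "Suc p" i] by simp
    then obtain k' where "k' < Suc p" "v (Suc i) k' = L2"
      unfolding set_subsequence by (metis atLeastLessThan_iff imageE)
    then show ?thesis by (auto simp: S_def less_Suc_eq_le)
  qed
  have drop: "\<exists>p'<p. S (Suc i) p'" if Sp: "S i p" and i: "\<sigma> i = c1" for i p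
  proof -
    define x where "x = v (Suc i) [0 \<rightarrow> p]"
    obtain k where k: "k \<le> p" "v i k = L2" using Sp by (auto simp: S_def)
    \<comment> \<open>Otherwise position \<open>k\<close> is the first one after the image of \<open>x\<close>, where a new image begins with 1.\<close>
    have "k < length (c1 (c1 x))"
    proof (rule ccontr)
      assume "\<not> ?thesis"
      then have l: "length (c1 (c1 x)) = k" "k = p" using len[of p i] k(1) i by (auto simp: x_def)
      have "v (Suc i) [0 \<rightarrow> Suc p] = x @ [v (Suc i) p]" by (simp add: x_def)
      then have "v i [0 \<rightarrow> length (c1 (c1 x) @ c1 (c1 [v (Suc i) p]))] = c1 (c1 x) @ c1 (c1 [v (Suc i) p])"
        using wi[of i "Suc p"] unfolding i by simp
      then have "v i [0 \<rightarrow> length (c1 (c1 x) @ c1 (c1 [v (Suc i) p]))] ! k = (c1 (c1 x) @ c1 (c1 [v (Suc i) p])) ! k"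
        by (rule arg_cong)
      moreover have "(c1 (c1 x) @ c1 (c1 [y])) ! k = L1" "k < length (c1 (c1 x) @ c1 (c1 [y]))" for y
        using l by (cases y; simp add: nth_append)+
      ultimately show False using k(2) by simp
    qed
    then have "L2 \<in> set x" using in_prefix[OF k(2), of p] i by (simp add: x_def)
    then obtain k' where "k' < p" "v (Suc i) k' = L2"
      unfolding x_def set_subsequence by (metis atLeastLessThan_iff imageE)
    then show ?thesis unfolding S_def by blast
  qed
  have "\<not> S i p" for i p
  proof (induction p arbitrary: i rule: less_induct)
    case (less p)
    show ?case
    proof
      assume "S i p"
      obtain j where j: "j \<ge> i" "\<sigma> j = c1" using inf by blast
      from j(1) have "S j p"
        by (induction j rule: dec_induct) (use \<open>S i p\<close> keep in auto)
      then show False using drop[OF _ j(2)] less by blast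
    qed
  qed
  then show ?thesis by (auto simp: S_def)
qed

text \<open>
  On the letters 1 and 3 both squares preserve each letter that is present; the square of \<open>c1\<close>
  produces 1 from 3, and that of \<open>c2\<close> produces 3 from 1.
\<close>
lemma square_chain_primitive_on:
  assumes \<sigma>: "\<And>i. \<sigma> i \<in> \<C>" and inf: "\<And>i. \<exists>j\<ge>i. \<sigma> j = c1" "\<And>i. \<exists>j\<ge>i. \<sigma> j = c2"
  shows "primitive_on {L1, L3} (\<lambda>i. \<sigma> i \<circ> \<sigma> i)"
  unfolding primitive_on_def
proof
  fix r
  let ?\<tau> = "\<lambda>i. \<sigma> i \<circ> \<sigma> i"
  obtain j where j: "j \<ge> r" "\<sigma> j = c1" using inf by blast
  obtain k where k: "k \<ge> r" "\<sigma> k = c2" using inf by blast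
  define s where "s = Suc (j + k)"
  have down: "a \<in> set (subst_prod ?\<tau> q s [b])" if "q \<le> t" "t \<le> s" "a \<in> set (subst_prod ?\<tau> t s [b])" "a \<noteq> L2" for a b q t
    using that
  proof (induction q rule: inc_induct)
    case (step q)
    then show ?case using set_square(1)[OF \<sigma>] by (simp add: subst_prod_Cons)
  qed simp
  have self: "b \<in> set (subst_prod ?\<tau> q s [b])" if "q \<le> s" "b \<noteq> L2" for b q
    using down[of q s b b] that by (simp add: subst_prod_refl)
  have 1: "L1 \<in> set (subst_prod ?\<tau> r s [L3])"
  proof -
    have "L3 \<in> set (subst_prod ?\<tau> (Suc j) s [L3])" by (rule self) (auto simp: s_def)
    then have "L1 \<in> set (c1 (c1 (subst_prod ?\<tau> (Suc j) s [L3])))" by (force simp: set_c1)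
    then have "L1 \<in> set (subst_prod ?\<tau> j s [L3])" using j(2) by (simp add: subst_prod_Cons s_def)
    then show ?thesis using down[of r j L1 L3] j by (simp add: s_def)
  qed
  have 3: "L3 \<in> set (subst_prod ?\<tau> r s [L1])"
  proof -
    have "L1 \<in> set (subst_prod ?\<tau> (Suc k) s [L1])" by (rule self) (auto simp: s_def)
    then have "L3 \<in> set (c2 (c2 (subst_prod ?\<tau> (Suc k) s [L1])))" by (force simp: set_c2)
    then have "L3 \<in> set (subst_prod ?\<tau> k s [L1])" using k(2) by (simp add: subst_prod_Cons s_def)
    then show ?thesis using down[of r k L3 L1] k by (simp add: s_def)
  qed
  have "r < s" "r \<le> s" using j by (auto simp: s_def)
  then show "\<exists>s>r. \<forall>a\<in>{L1, L3}. \<forall>b\<in>{L1, L3}. a \<in> set (subst_prod ?\<tau> r s [b])"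
    using 1 3 self[of r] by (intro exI[of _ s]) auto
qed

lemma bispecial_square_any:
  assumes L: "biextendable L" and c: "c \<in> \<C>" and X: "X = img c (img c L)"
    and U: "bispecial_in X U" "U \<noteq> []"
  shows "\<exists>z. length z < length U \<and> ext X U = ext L z"
proof -
  have len: "length z < length (c1 (c1 z) @ [L1])" for z
    using morphism_length[OF morphism_comp[OF morphism_c1 morphism_c1], of z] by simp
  show ?thesis
  proof (cases "c = c1")
    case True
    obtain z where "U = c1 (c1 z) @ [L1]" "ext X U = ext L z"
      by (rule bispecial_square[OF L _ U]) (simp add: X True)
    then show ?thesis using len by blast
  next
    case False
    then have c2: "c = c2" using c by (auto simp: \<C>_def)
    have "mirror U \<noteq> []" using U(2) by (simp add: mirror_def)
    have "mirror_lang X = img c1 (img c1 (mirror_lang L))" by (simp add: X c2 mirror_img_c2)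
    moreover have "bispecial_in (mirror_lang X) (mirror U)" using U(1) by (simp add: bispecial_mirror)
    ultimately obtain z where z: "mirror U = c1 (c1 z) @ [L1]" "ext (mirror_lang X) (mirror U) = ext (mirror_lang L) z"
      using \<open>mirror U \<noteq> []\<close> by (rule bispecial_square[OF biextendable_mirror[OF L]])
    then have "mirror_rel (ext X U) = mirror_rel (ext L (mirror z))" unfolding ext_mirror mirror_simps by blast
    then have "ext X U = ext L (mirror z)" by (metis mirror_rel_invol)
    moreover have "length (mirror z) < length U" using len[of z] arg_cong[OF z(1), of length] by simp
    ultimately show ?thesis by blast
  qed
qed

lemma ext_square_Nil_binary:
  assumes L: "biextendable L" "\<And>a. [a] \<in> L \<longleftrightarrow> a \<in> {L1, L3}" and c: "c \<in> \<C>"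
  shows "card (ext (img c (img c L)) []) + 1
    = card (Domain (ext (img c (img c L)) [])) + card (Range (ext (img c (img c L)) []))"
proof -
  have main: "ext (img c1 (img c1 L)) [] = {(L1, L1), (L3, L1), (L1, L3)}"
    if "biextendable L" "\<And>a. [a] \<in> L \<longleftrightarrow> a \<in> {L1, L3}" for L
    unfolding ext_square_Nil[OF that(1)] that(2) by auto
  have "mirror_letter a \<in> {L1, L3} \<longleftrightarrow> a \<in> {L1, L3}" for a by (cases a) auto
  then have m: "[a] \<in> mirror_lang L \<longleftrightarrow> a \<in> {L1, L3}" for a using L(2) by (simp add: mem_mirror_lang)
  have "mirror_rel (ext (img c2 (img c2 L)) []) = {(L1, L1), (L3, L1), (L1, L3)}"
    using main[OF biextendable_mirror[OF L(1)] m] ext_mirror[of "img c2 (img c2 L)" "[]"]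
    by (simp add: mirror_img_c2)
  then have "ext (img c2 (img c2 L)) [] = mirror_rel {(L1, L1), (L3, L1), (L1, L3)}" by (metis mirror_rel_invol)
  also have "\<dots> = {(L3, L3), (L3, L1), (L1, L3)}"
  proof -
    have "mirror_letter a = L1 \<longleftrightarrow> a = L3" "mirror_letter a = L3 \<longleftrightarrow> a = L1" for a by (cases a; simp)+
    then show ?thesis by (auto simp: mirror_rel_def)
  qed
  finally have "ext (img c2 (img c2 L)) [] = {(L3, L3), (L3, L1), (L1, L3)}" .
  then have "ext (img c (img c L)) [] = {(L1, L1), (L3, L1), (L1, L3)}
      \<or> ext (img c (img c L)) [] = {(L3, L3), (L3, L1), (L1, L3)}"
    using c main[OF L] unfolding \<C>_def by (elim insertE emptyE) simp_all
  then show ?thesis by (elim disjE) (simp_all add: card_insert_if)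
qed

text \<open>
  The Sturmian case: all bispecial words have the extension graph of the empty word at some level,
  a path with three edges.
\<close>
lemma square_chain_complexity:
  assumes \<sigma>: "\<And>i. \<sigma> i \<in> \<C>" and M: "\<And>i. M i = img (\<sigma> i) (img (\<sigma> i) (M (Suc i)))"
    and bi: "\<And>i. biextendable (M i)" and letters: "\<And>i a. [a] \<in> M i \<longleftrightarrow> a \<in> {L1, L3}"
  shows "card (level (M 0) n) = n + 1"
proof -
  have tree: "card (ext (M i) U) + 1 = card (lext (M i) U) + card (rext (M i) U)"
    if "bispecial_in (M i) U" for i U
    using that
  proof (induction "length U" arbitrary: i U rule: less_induct)
    case less
    show ?case
    proof (cases "U = []")
      case True
      have "card (ext (M i) []) + 1 = card (Domain (ext (M i) [])) + card (Range (ext (M i) []))"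
        using ext_square_Nil_binary[OF bi[of "Suc i"] letters \<sigma>[of i]] by (simp flip: M)
      then show ?thesis using True by (simp add: Domain_ext biextendable_right Range_ext bi)
    next
      case False
      obtain z where z: "length z < length U" "ext (M i) U = ext (M (Suc i)) z"
        using bispecial_square_any[OF bi \<sigma> M less.prems False] by blast
      have "lext (M i) U = lext (M (Suc i)) z" "rext (M i) U = rext (M (Suc i)) z"
        using z(2) Domain_ext[OF biextendable_right[OF bi]] Range_ext[OF bi] by metis+
      then show ?thesis using less.hyps[of z "Suc i"] less.prems z by (simp add: bispecial_in_def)
    qed
  qed
  have "level (M 0) 1 = {[L1], [L3]}"
    using letters[of _ 0] by (auto simp: level_def length_Suc_conv)
  then have "card (level (M 0) 1) = 2" by simp
  then show ?thesis using complexity_affine[OF bi[of 0] tree, of n] by simp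
qed

section \<open>Eventual growth by one is preserved by the substitutions\<close>

text \<open>
  Besides growth by one for large lengths, growth at all lengths is recorded; it provides right
  special words of every length and the bound \<open>k \<ge> 1\<close> in the form \<open>n + k\<close> of the complexity.
\<close>
definition unit_growth :: "letter list set \<Rightarrow> bool" where
  "unit_growth L \<longleftrightarrow> biextendable L
     \<and> (\<exists>n0. \<forall>n\<ge>n0. card (level L (Suc n)) = Suc (card (level L n)))
     \<and> (\<forall>n. card (level L n) < card (level L (Suc n)))"

definition right_special :: "letter list set \<Rightarrow> letter list \<Rightarrow> bool" where
  "right_special L u \<longleftrightarrow> card (rext L u) \<ge> 2"

lemma right_specialE:
  assumes "right_special L u"
  obtains x y where "x \<noteq> y" "u @ [x] \<in> L" "u @ [y] \<in> L"
proof -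
  have "\<not> is_singleton (rext L u)" "rext L u \<noteq> {}"
    using assms by (auto simp: right_special_def is_singleton_altdef)
  then show thesis using that by (auto simp: is_singleton_def rext_def)
qed

lemma right_specialI:
  assumes "x \<noteq> y" "u @ [x] \<in> L" "u @ [y] \<in> L" shows "right_special L u"
proof -
  have "card {x, y} \<le> card (rext L u)" using assms by (intro card_mono) (auto simp: rext_def)
  then show ?thesis using assms(1) by (simp add: right_special_def)
qed

lemma right_special_mem: "right_extendable L \<Longrightarrow> right_special L u \<Longrightarrow> u \<in> L"
  by (metis right_extendable_append right_specialE)

lemma rext_suffix: "right_extendable L \<Longrightarrow> rext L (p @ u) \<subseteq> rext L u"
  using right_extendable_append[of L p "u @ [_]"] by (auto simp: rext_def)

lemma right_special_suffix: "right_extendable L \<Longrightarrow> right_special L (p @ u) \<Longrightarrow> right_special L u"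
  using card_mono[OF finite_letter_set rext_suffix[of L p u]] by (auto simp: right_special_def)

lemma rext_pos: "right_extendable L \<Longrightarrow> u \<in> L \<Longrightarrow> card (rext L u) \<ge> 1"
  for L :: "letter list set"
  using right_extendable_ext[of L u] by (auto simp: Suc_le_eq card_gt_0_iff rext_def)

lemma growth_le: "right_extendable (L :: letter list set) \<Longrightarrow> card (level L n) \<le> card (level L (Suc n))"
  using sum_mono[of "level L n" "\<lambda>_. 1" "\<lambda>u. card (rext L u)"] rext_pos[of L]
  unfolding card_level_rext by (simp add: level_def)

lemma growth_less_if_right_special:
  assumes L: "right_extendable L" and u: "right_special L u" "length u = n"
  shows "card (level L n) < card (level L (Suc n))"
proof -
  have "(\<Sum>u\<in>level L n. 1) < (\<Sum>u\<in>level L n. card (rext L u))"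
  proof (rule sum_strict_mono_ex1)
    show "\<forall>x\<in>level L n. 1 \<le> card (rext L x)" using rext_pos[OF L] by (auto simp: level_def)
    show "\<exists>x\<in>level L n. 1 < card (rext L x)"
      using u right_special_mem[OF L u(1)] by (intro bexI[of _ u]) (auto simp: right_special_def level_def)
  qed simp
  then show ?thesis by (simp add: card_level_rext[OF L])
qed

text \<open>
  The growth is the number of right extensions in excess of one, summed over all words of the
  given length.
\<close>
lemma growth_one_iff:
  assumes L: "right_extendable L"
  shows "card (level L (Suc n)) = Suc (card (level L n)) \<longleftrightarrow>
    (\<exists>x\<in>level L n. card (rext L x) = 2 \<and> (\<forall>y\<in>level L n. x \<noteq> y \<longrightarrow> \<not> right_special L y))"
proof -
  have pos: "1 \<le> card (rext L u)" if "u \<in> level L n" for u using that rext_pos[OF L] by (auto simp: level_def)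
  have "(\<Sum>u\<in>level L n. card (rext L u) - 1) + card (level L n) = (\<Sum>u\<in>level L n. (card (rext L u) - 1) + 1)"
    by (simp only: sum.distrib) simp
  also have "\<dots> = (\<Sum>u\<in>level L n. card (rext L u))" using pos by (intro sum.cong) fastforce+
  also have "\<dots> = card (level L (Suc n))" by (simp add: card_level_rext[OF L])
  finally have "card (level L (Suc n)) = Suc (card (level L n)) \<longleftrightarrow> (\<Sum>u\<in>level L n. card (rext L u) - 1) = Suc 0"
    by linarith
  also have "\<dots> \<longleftrightarrow> (\<exists>x\<in>level L n. card (rext L x) - 1 = Suc 0 \<and> (\<forall>y\<in>level L n. x \<noteq> y \<longrightarrow> card (rext L y) - 1 = 0))"
    by (rule sum_eq_Suc0_iff) simp
  also have "\<dots> \<longleftrightarrow> (\<exists>x\<in>level L n. card (rext L x) = 2 \<and> (\<forall>y\<in>level L n. x \<noteq> y \<longrightarrow> \<not> right_special L y))"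
  proof (intro bex_cong refl conj_cong ball_cong imp_cong)
    fix x show "card (rext L x) - 1 = Suc 0 \<longleftrightarrow> card (rext L x) = 2" by auto
    show "card (rext L x) - 1 = 0 \<longleftrightarrow> \<not> right_special L x" by (auto simp: right_special_def)
  qed
  finally show ?thesis .
qed

text \<open>
  The shortest word whose image has \<open>U\<close> as a suffix, provided that \<open>U\<close> ends at the end of the image
  of a letter; a leading 3 is the second half of the image of 2.
\<close>
definition antecedent :: "letter list \<Rightarrow> letter list \<Rightarrow> bool" where
  "antecedent U v \<longleftrightarrow> U = c1 v \<or> (\<exists>q. U = L3 # c1 q \<and> v = L2 # q)"

lemma antecedent_unique: "antecedent U v \<Longrightarrow> antecedent U v' \<Longrightarrow> v = v'"
  unfolding antecedent_def using c1_inject c1_not_L3 by (metis list.inject)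

lemma antecedent_suffix: "antecedent U v \<Longrightarrow> \<exists>A. c1 v = A @ U"
  unfolding antecedent_def by auto

lemma antecedent_length: "antecedent U v \<Longrightarrow> length U \<le> 2 * length v"
  using antecedent_suffix[of U v] length_c(1)[of v] by auto

lemma antecedent_exists:
  assumes "c1 t = A @ U" obtains v q where "antecedent U v" "t = q @ v"
proof (cases "\<exists>U'. U = L3 # U'")
  case True
  then obtain U' where U': "U = L3 # U'" by blast
  obtain q1 q2 where "t = q1 @ L2 # q2" "U' = c1 q2" by (rule c1_split_L3[OF assms[unfolded U']])
  then show thesis using that[of "L2 # q2" q1] U' by (simp add: antecedent_def)
next
  case False
  then obtain q1 q2 where "t = q1 @ q2" "U = c1 q2" using c1_split[OF assms] by blast
  then show thesis using that[of q2 q1] by (simp add: antecedent_def)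
qed

lemma antecedent_ext:
  assumes L: "right_extendable L" and U: "U @ [y] \<in> img c1 L" "y \<noteq> L3"
  obtains v b where "antecedent U v" "v @ [b] \<in> L" "first1 b = y"
proof -
  obtain t A B where t: "t \<in> L" "c1 t = (A @ U) @ (y # B)" using U by (auto simp: img_iff)
  obtain t1 t2 where t1: "t = t1 @ t2" "A @ U = c1 t1" "y # B = c1 t2"
    by (rule c1_split[OF t(2)]) (use U(2) in auto)
  obtain b t3 where b: "t2 = b # t3" "first1 b = y" using hd_c1[OF t1(3)[symmetric]] by blast
  obtain v q where v: "antecedent U v" "t1 = q @ v" by (rule antecedent_exists[OF t1(2)[symmetric]])
  have "v @ [b] \<in> L"
    using t(1) right_extendable_append[OF L, of q "v @ b # t3"] right_extendable_append[OF L, of "v @ [b]" t3]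
    by (simp add: t1 b v)
  then show thesis using that v b by blast
qed

lemma antecedent_ext_L3:
  assumes L: "right_extendable L" and U: "W @ [L1, L3] \<in> img c1 L"
  obtains v where "antecedent W v" "v @ [L2] \<in> L"
proof -
  obtain t A B where t: "t \<in> L" "c1 t = (A @ W @ [L1]) @ L3 # B" using U by (auto simp: img_iff)
  obtain t1 t2 where t1: "t = t1 @ L2 # t2" "A @ W @ [L1] = c1 t1 @ [L1]" by (rule c1_split_L3[OF t(2)])
  then have "c1 t1 = A @ W" by simp
  then obtain v q where v: "antecedent W v" "t1 = q @ v" by (rule antecedent_exists)
  have "v @ [L2] \<in> L"
    using t(1) right_extendable_append[OF L, of q "v @ L2 # t2"] right_extendable_append[OF L, of "v @ [L2]" t2]
    by (simp add: t1 v)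
  then show thesis using that v by blast
qed

text \<open>
  The right extension 2 of \<open>U\<close> comes from the letter 3, the right extension 1 from one of the other
  two letters, and both follow the same antecedent.
\<close>
lemma right_special_antecedent_12:
  assumes L: "right_extendable L" and U: "U @ [L1] \<in> img c1 L" "U @ [L2] \<in> img c1 L"
  obtains v where "antecedent U v" "L3 \<in> rext L v" "L1 \<in> rext L v \<or> L2 \<in> rext L v"
proof -
  obtain v b where v: "antecedent U v" "v @ [b] \<in> L" "first1 b = L1" using antecedent_ext[OF L U(1)] by auto
  obtain v' b' where v': "antecedent U v'" "v' @ [b'] \<in> L" "first1 b' = L2" using antecedent_ext[OF L U(2)] by auto
  have "v' = v" using v v' antecedent_unique by blast
  moreover have "b' = L3" "b = L1 \<or> b = L2" using v(3) v'(3) by (cases b; cases b'; simp)+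
  ultimately show thesis using that v v' by (auto simp: rext_def)
qed

text \<open>
  Here \<open>U\<close> ends with a 1 that belongs to the image of 2 if 3 follows, and is the image of 1
  otherwise.
\<close>
lemma right_special_antecedent_3:
  assumes L: "right_extendable L" and U: "U \<noteq> []" "U @ [L3] \<in> img c1 L" "U @ [y] \<in> img c1 L" "y \<noteq> L3"
  obtains W v where "U = W @ [L1]" "antecedent W v" "L1 \<in> rext L v" "L2 \<in> rext L v"
proof -
  obtain W x where W: "U = W @ [x]" using U(1) by (cases U rule: rev_cases) auto
  have R: "right_extendable (img c1 L)" using right_extendable_img[OF morphism_c1 L] .
  have "[x, L3] \<in> img c1 L" using U(2) right_extendable_append[OF R, of W "[x, L3]"] by (simp add: W)
  then have x: "x = L1" using before_L3 by blast
  obtain v where v: "antecedent W v" "v @ [L2] \<in> L" using antecedent_ext_L3[OF L, of W] U(2) by (auto simp: W x)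
  obtain t A B where t: "t \<in> L" "c1 t = (A @ W) @ (L1 # y # B)" using U(3) by (auto simp: img_iff W x)
  obtain t1 t2 where t1: "t = t1 @ t2" "A @ W = c1 t1" "L1 # y # B = c1 t2"
    by (rule c1_split[OF t(2)]) auto
  obtain b t3 where b: "t2 = b # t3" "first1 b = L1" using hd_c1[OF t1(3)[symmetric]] by blast
  have "b = L1" using t1(3) b U(4) by (cases b) auto
  obtain v' q where v': "antecedent W v'" "t1 = q @ v'" by (rule antecedent_exists[OF t1(2)[symmetric]])
  have "v' = v" using v v' antecedent_unique by blast
  then have "v @ [L1] \<in> L"
    using t(1) right_extendable_append[OF L, of q "v @ b # t3"] right_extendable_append[OF L, of "v @ [b]" t3]
    by (simp add: t1 b v' \<open>b = L1\<close>)
  then show thesis using that[of W v] v W x by (simp add: rext_def)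
qed

text \<open>
  Unit growth leaves one right special word in each large length. Suffixes of right special
  words are right special, so these words are the suffixes of one left-infinite word, and their
  sets of right extensions, decreasing and of constant size, agree.
\<close>
lemma unit_growth_right_special:
  assumes "unit_growth L"
  obtains n0 x R where "\<And>n. n \<ge> n0 \<Longrightarrow> length (x n) = n \<and> rext L (x n) = R" "card R = 2"
    "\<And>u. length u \<ge> n0 \<Longrightarrow> right_special L u \<Longrightarrow> u = x (length u)"
    "\<And>m n. n0 \<le> m \<Longrightarrow> m \<le> n \<Longrightarrow> x m = drop (n - m) (x n)"
proof -
  have L: "right_extendable L" using assms by (auto simp: unit_growth_def)
  obtain n0 where n0: "\<And>n. n \<ge> n0 \<Longrightarrow> card (level L (Suc n)) = Suc (card (level L n))"
    using assms by (auto simp: unit_growth_def)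
  have "\<forall>n. \<exists>x. n \<ge> n0 \<longrightarrow> x \<in> level L n \<and> card (rext L x) = 2 \<and> (\<forall>y\<in>level L n. x \<noteq> y \<longrightarrow> \<not> right_special L y)"
    using n0 growth_one_iff[OF L] by meson
  then obtain x where x: "\<And>n. n \<ge> n0 \<Longrightarrow> x n \<in> level L n" "\<And>n. n \<ge> n0 \<Longrightarrow> card (rext L (x n)) = 2"
    "\<And>n y. n \<ge> n0 \<Longrightarrow> y \<in> level L n \<Longrightarrow> x n \<noteq> y \<Longrightarrow> \<not> right_special L y" by metis
  have uniq: "u = x (length u)" if "length u \<ge> n0" "right_special L u" for u
    using x(3)[OF that(1), of u] that right_special_mem[OF L that(2)] unfolding level_def by fastforce
  have rs: "right_special L (x n)" if "n \<ge> n0" for n using x(2)[OF that] by (simp add: right_special_def)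
  have nest: "x m = drop (n - m) (x n)" if "n0 \<le> m" "m \<le> n" for m n
  proof -
    have "length (x n) = n" using x(1)[of n] that by (simp add: level_def)
    then have "length (drop (n - m) (x n)) = m" using that by simp
    moreover have "right_special L (drop (n - m) (x n))"
      using right_special_suffix[OF L, of "take (n - m) (x n)" "drop (n - m) (x n)"] rs[of n] that by simp
    ultimately show ?thesis using uniq[of "drop (n - m) (x n)"] that by simp
  qed
  have same: "rext L (x n) = rext L (x n0)" if "n \<ge> n0" for n
  proof (rule card_subset_eq)
    show "rext L (x n) \<subseteq> rext L (x n0)"
      using rext_suffix[OF L, of "take (n - n0) (x n)" "drop (n - n0) (x n)"] nest[of n0 n] that by simp
    show "card (rext L (x n)) = card (rext L (x n0))" using x(2) that by simp
  qed simp
  show thesis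
  proof (rule that)
    show "length (x n) = n \<and> rext L (x n) = rext L (x n0)" if "n \<ge> n0" for n
      using x(1)[OF that] same[OF that] by (simp add: level_def)
    show "card (rext L (x n0)) = 2" by (rule x(2)) simp
  qed (fact uniq nest)+
qed

text \<open>
  Let \<open>R\<close> be the common set of right extensions of the long right special words \<open>x n\<close>. A long right
  special word of the image is a suffix of \<open>c1 (x n)\<close> if \<open>R\<close> contains 3, and of \<open>c1 (x n) @ [L1]\<close>
  if \<open>R\<close> consists of 1 and 2. Since only one of the two cases occurs, these words are again the
  suffixes of one left-infinite word.
\<close>
lemma unit_growth_img_c1:
  assumes G: "unit_growth L" shows "unit_growth (img c1 L)"
proof -
  let ?X = "img c1 L"
  have BL: "biextendable L" using G by (simp add: unit_growth_def)
  note L = biextendable_right[OF BL]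
  have BX: "biextendable ?X" by (rule biextendable_img[OF morphism_c1 BL])
  note X = biextendable_right[OF BX]
  obtain n0 x R where x: "\<And>n. n \<ge> n0 \<Longrightarrow> length (x n) = n \<and> rext L (x n) = R" and R: "card R = 2"
    and uniq: "\<And>u. length u \<ge> n0 \<Longrightarrow> right_special L u \<Longrightarrow> u = x (length u)"
    and nest: "\<And>m n. n0 \<le> m \<Longrightarrow> m \<le> n \<Longrightarrow> x m = drop (n - m) (x n)"
    by (rule unit_growth_right_special[OF G]) blast
  define p where "p = (if L3 \<in> R then [] else [L1])"
  have R_cases: "(L3 \<in> R \<and> (L1 \<in> R \<or> L2 \<in> R) \<and> \<not> (L1 \<in> R \<and> L2 \<in> R)) \<or> (L3 \<notin> R \<and> L1 \<in> R \<and> L2 \<in> R)"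
  proof -
    have "R \<subseteq> {L1, L2, L3}" using UNIV_letter by auto
    moreover have "R \<noteq> {L1, L2, L3}" "\<And>a. \<not> R \<subseteq> {a}" using R card_mono[of "{_}" R] by fastforce+
    ultimately show ?thesis by blast
  qed
  have ext_img: "c1 u @ [first1 b] \<in> ?X" if "u @ [b] \<in> L" for u b
  proof -
    have "c1_letter b = first1 b # tl (c1_letter b)" by (cases b) auto
    then have "c1 (u @ [b]) = [] @ (c1 u @ [first1 b]) @ tl (c1_letter b)" by simp
    then show ?thesis by (rule img_memI[OF that])
  qed
  have special: "right_special ?X (c1 (x n) @ p)" if n: "n \<ge> n0" for n
  proof (cases "L3 \<in> R")
    case True
    then have "x n @ [L3] \<in> L" "x n @ [L1] \<in> L \<or> x n @ [L2] \<in> L"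
      using x[OF n] R_cases by (auto simp: rext_def)
    then have "c1 (x n) @ [L2] \<in> ?X" "c1 (x n) @ [L1] \<in> ?X" using ext_img[of "x n" L3] ext_img[of "x n" L1] ext_img[of "x n" L2] by auto
    then show ?thesis using True by (intro right_specialI[of L1 L2]) (auto simp: p_def)
  next
    case False
    then have m: "x n @ [L1] \<in> L" "x n @ [L2] \<in> L" using x[OF n] R_cases by (auto simp: rext_def)
    obtain b where b: "x n @ [L1] @ [b] \<in> L" using right_extendable_ext[OF L m(1)] by auto
    have "c1 (x n) @ [L1] @ [first1 b] \<in> ?X" using ext_img[of "x n @ [L1]" b] b by simp
    moreover have "c1 (x n @ [L2]) = [] @ (c1 (x n) @ [L1, L3]) @ []" by simp
    then have "c1 (x n) @ [L1, L3] \<in> ?X" by (rule img_memI[OF m(2)])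
    ultimately show ?thesis using False by (intro right_specialI[of "first1 b" L3]) (auto simp: p_def)
  qed
  \<comment> \<open>The bound on the length of \<open>U\<close> makes its antecedent at least \<open>n0\<close> letters long.\<close>
  have long: "\<exists>m A. m \<ge> n0 \<and> c1 (x m) @ p = A @ U \<and> card (rext ?X U) = 2"
    if U: "right_special ?X U" "length U \<ge> 2 * n0 + 2" for U
  proof -
    have ne: "U \<noteq> []" using U(2) by auto
    have c12: "\<exists>m A. m \<ge> n0 \<and> L3 \<in> R \<and> c1 (x m) = A @ U" if U12: "U @ [L1] \<in> ?X" "U @ [L2] \<in> ?X"
    proof -
      obtain v where v: "antecedent U v" "L3 \<in> rext L v" "L1 \<in> rext L v \<or> L2 \<in> rext L v"
        by (rule right_special_antecedent_12[OF L U12])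
      have l: "length v \<ge> n0" using antecedent_length[OF v(1)] U(2) by simp
      have "right_special L v" using v(2,3) by (auto simp: rext_def intro: right_specialI)
      then have "v = x (length v)" by (rule uniq[OF l])
      then have "rext L v = R" "c1 (x (length v)) = c1 v" using x[OF l] by auto
      then show ?thesis using antecedent_suffix[OF v(1)] v(2) l by metis
    qed
    have c3: "\<exists>m A. m \<ge> n0 \<and> L3 \<notin> R \<and> c1 (x m) @ [L1] = A @ U" if U3: "U @ [L3] \<in> ?X" "U @ [y] \<in> ?X" "y \<noteq> L3" for y
    proof -
      obtain W v where v: "U = W @ [L1]" "antecedent W v" "L1 \<in> rext L v" "L2 \<in> rext L v"
        by (rule right_special_antecedent_3[OF L ne U3])
      have l: "length v \<ge> n0" using antecedent_length[OF v(2)] U(2) v(1) by simp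
      have "right_special L v" using v(3,4) by (auto simp: rext_def intro: right_specialI)
      then have "v = x (length v)" by (rule uniq[OF l])
      then have "rext L v = R" "c1 (x (length v)) = c1 v" using x[OF l] by auto
      then have "L3 \<notin> R" "c1 (x (length v)) = c1 v" using v(3,4) R_cases by auto
      moreover obtain A where "c1 v = A @ W" using antecedent_suffix[OF v(2)] by blast
      ultimately show ?thesis using l v(1) by (intro exI[of _ "length v"] exI[of _ A]) simp
    qed
    obtain a b where ab: "a \<noteq> b" "U @ [a] \<in> ?X" "U @ [b] \<in> ?X" by (rule right_specialE[OF U(1)])
    have "\<not> (U @ [L1] \<in> ?X \<and> U @ [L2] \<in> ?X \<and> U @ [L3] \<in> ?X)" using c12 c3[of L1] by blast
    then have "rext ?X U \<noteq> UNIV" by (auto simp: rext_def)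
    then have "card (rext ?X U) < card (UNIV :: letter set)" by (intro psubset_card_mono) auto
    then have card2: "card (rext ?X U) = 2" using U(1) by (simp add: right_special_def card_UNIV_letter)
    have "(U @ [L1] \<in> ?X \<and> U @ [L2] \<in> ?X) \<or> (\<exists>y. U @ [L3] \<in> ?X \<and> U @ [y] \<in> ?X \<and> y \<noteq> L3)"
      using ab by (cases a; cases b) auto
    then show ?thesis
    proof
      assume "U @ [L1] \<in> ?X \<and> U @ [L2] \<in> ?X"
      then show ?thesis using c12 card2 by (auto simp: p_def)
    next
      assume "\<exists>y. U @ [L3] \<in> ?X \<and> U @ [y] \<in> ?X \<and> y \<noteq> L3"
      then show ?thesis using c3 card2 by (auto simp: p_def)
    qed
  qed
  have exists: "\<exists>u. right_special ?X u \<and> length u = n" for n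
  proof -
    define y where "y = c1 (x (n0 + n)) @ p"
    have "n \<le> length y" using morphism_length[OF morphism_c1, of "x (n0 + n)"] x[of "n0 + n"] by (simp add: y_def)
    moreover have "right_special ?X y" unfolding y_def by (rule special) simp
    then have "right_special ?X (drop (length y - n) y)"
      using right_special_suffix[OF X, of "take (length y - n) y" "drop (length y - n) y"] by simp
    ultimately show ?thesis by (intro exI[of _ "drop (length y - n) y"]) simp
  qed
  have unique: "U = U'" if U: "right_special ?X U" "right_special ?X U'" "length U = n" "length U' = n" "n \<ge> 2 * n0 + 2" for U U' n
  proof -
    obtain m A m' A' where m: "m \<ge> n0" "c1 (x m) @ p = A @ U" "m' \<ge> n0" "c1 (x m') @ p = A' @ U'"
      using long[OF U(1)] long[OF U(2)] U by metis
    have suf: "\<exists>B. c1 (x k) @ p = B @ (c1 (x j) @ p)" if "n0 \<le> j" "j \<le> k" for j k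
    proof -
      have "x k = take (k - j) (x k) @ x j" using nest[OF that] by simp
      then have "c1 (x k) = c1 (take (k - j) (x k)) @ c1 (x j)" by (metis c1_simps(3))
      then show ?thesis by simp
    qed
    define k where "k = max m m'"
    obtain B where B: "c1 (x k) @ p = B @ U" using suf[OF m(1), of k] m(2) by (auto simp: k_def)
    obtain B' where B': "c1 (x k) @ p = B' @ U'" using suf[OF m(3), of k] m(4) by (auto simp: k_def)
    show ?thesis using B B' U(3,4) by (metis append_eq_append_conv)
  qed
  have "card (level ?X (Suc n)) = Suc (card (level ?X n))" if "n \<ge> 2 * n0 + 2" for n
    unfolding growth_one_iff[OF X]
  proof -
    obtain u where u: "right_special ?X u" "length u = n" using exists by blast
    have "card (rext ?X u) = 2" using long[OF u(1)] u(2) that by auto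
    moreover have "u \<in> level ?X n" using right_special_mem[OF X u(1)] u(2) by (simp add: level_def)
    ultimately show "\<exists>x\<in>level ?X n. card (rext ?X x) = 2 \<and> (\<forall>y\<in>level ?X n. x \<noteq> y \<longrightarrow> \<not> right_special ?X y)"
      using unique[OF u(1) _ u(2) _ that] by (intro bexI[of _ u]) (auto simp: level_def)
  qed
  moreover have "card (level ?X n) < card (level ?X (Suc n))" for n
    using exists growth_less_if_right_special[OF X] by blast
  ultimately show ?thesis using BX unfolding unit_growth_def by blast
qed

lemma unit_growth_mirror: "unit_growth L \<Longrightarrow> unit_growth (mirror_lang L)"
  by (simp add: unit_growth_def biextendable_mirror card_level_mirror)

text \<open>
  For \<open>c2\<close>, mirror images are used: unit growth only refers to the numbers of words and is
  invariant under reversal.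
\<close>
lemma unit_growth_img:
  assumes "c \<in> \<C>" "unit_growth L" shows "unit_growth (img c L)"
proof (cases "c = c1")
  case True
  then show ?thesis using unit_growth_img_c1 assms(2) by simp
next
  case False
  then have "c = c2" using assms(1) by (auto simp: \<C>_def)
  then have "unit_growth (mirror_lang (img c L))"
    using unit_growth_img_c1[OF unit_growth_mirror[OF assms(2)]] by (simp add: mirror_img_c2)
  then show ?thesis using unit_growth_mirror[of "mirror_lang (img c L)"] by simp
qed

lemma unit_growth_affine:
  assumes "unit_growth L"
  shows "\<exists>k\<ge>1. \<forall>\<^sub>F n in sequentially. card (level L n) = n + k"
proof -
  obtain n0 where n0: "\<And>n. n \<ge> n0 \<Longrightarrow> card (level L (Suc n)) = Suc (card (level L n))"
    using assms by (auto simp: unit_growth_def)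
  have "[] \<in> L" using assms right_extendable_Nil biextendable_right unfolding unit_growth_def by blast
  then have "level L 0 = {[]}" by (auto simp: level_def)
  then have "card (level L 0) = 1" by simp
  then have ge: "card (level L n) \<ge> n + 1" for n
  proof (induction n)
    case (Suc n)
    moreover have "card (level L n) < card (level L (Suc n))" using assms by (simp add: unit_growth_def)
    ultimately show ?case by simp
  qed simp
  define k where "k = card (level L n0) - n0"
  have "card (level L n) = n + k" if "n \<ge> n0" for n
    using that
  proof (induction n rule: dec_induct)
    case base
    then show ?case using ge[of n0] by (simp add: k_def)
  next
    case (step n)
    then show ?case using n0 by simp
  qed
  moreover have "k \<ge> 1" using ge[of n0] by (simp add: k_def)
  ultimately show ?thesis unfolding eventually_sequentially by blast
qed

section \<open>Eventually constant directive sequences\<close>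

lemma eventually_constant_complexity_if_periodic:
  fixes w :: "letter word"
  assumes q: "q \<ge> 1" "\<And>i. i \<ge> i0 \<Longrightarrow> w (i + q) = w i"
  shows "\<exists>k\<ge>1. \<forall>\<^sub>F n in sequentially. card (level (language w) n) = k"
proof -
  define f where "f n = card (level (language w) n)" for n
  note R = right_extendable_language[of w]
  have mono: "m \<le> n \<Longrightarrow> f m \<le> f n" for m n
    unfolding f_def by (rule lift_Suc_mono_le[of "\<lambda>n. card (level (language w) n)"]) (rule growth_le[OF R])
  have bounded: "f n \<le> i0 + q" for n
  proof -
    have "w [i \<rightarrow> i + n] \<in> (\<lambda>i. w [i \<rightarrow> i + n]) ` {..<i0 + q}" for i
    proof (induction i rule: less_induct)
      case (less i)
      show ?case
      proof (cases "i < i0 + q")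
        case False
        have "w [i \<rightarrow> i + n] = w [i - q \<rightarrow> (i - q) + n]"
        proof (rule nth_equalityI)
          fix k assume "k < length (w [i \<rightarrow> i + n])"
          then show "w [i \<rightarrow> i + n] ! k = w [i - q \<rightarrow> (i - q) + n] ! k"
            using q(2)[of "i - q + k"] False by (simp add: add.commute add.left_commute)
        qed simp
        moreover have "i - q < i" using q(1) False by simp
        ultimately show ?thesis using less.IH by metis
      qed blast
    qed
    moreover have "\<exists>i. u = w [i \<rightarrow> i + n]" if u: "u \<in> level (language w) n" for u
    proof -
      obtain i j where "u = w [i \<rightarrow> j]" "i \<le> j" "length u = n"
        using u by (auto simp: level_def language_def)
      moreover from this have "j = i + n" by auto
      ultimately show ?thesis by metis
    qed
    ultimately have "level (language w) n \<subseteq> (\<lambda>i. w [i \<rightarrow> i + n]) ` {..<i0 + q}" by blast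
    then have "f n \<le> card ((\<lambda>i. w [i \<rightarrow> i + n]) ` {..<i0 + q})"
      unfolding f_def by (intro card_mono) auto
    also have "\<dots> \<le> i0 + q" using card_image_le[of "{..<i0 + q}"] by simp
    finally show ?thesis .
  qed
  have "finite (range f)" using bounded by (intro finite_subset[of "range f" "{..i0 + q}"]) auto
  then have "Max (range f) \<in> range f" by (intro Max_in) auto
  then obtain n0 where n0: "f n0 = Max (range f)" by (metis imageE)
  have "f n = f n0" if "n \<ge> n0" for n
    using mono[OF that] Max_ge[OF \<open>finite (range f)\<close>, of "f n"] n0 by (metis le_antisym rangeI)
  moreover have "f n0 \<ge> 1"
  proof -
    have "level (language w) 0 = {[]}" using right_extendable_Nil[OF R] by (auto simp: level_def)
    then have "f 0 = 1" by (simp add: f_def)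
    then show ?thesis using mono[of 0 n0] by simp
  qed
  ultimately show ?thesis unfolding eventually_sequentially f_def by blast
qed

text \<open>
  From the image of the constant part on, the word is a repetition of the image of one letter.
\<close>
lemma periodic_if_image_of_eventually_constant:
  assumes c: "morphism c" and w: "word_image c v w" and v: "\<And>k. k \<ge> K \<Longrightarrow> v k = a"
  shows "\<exists>q\<ge>1. \<exists>i0. \<forall>i\<ge>i0. w (i + q) = w i"
proof -
  define q where "q = length (c [a])"
  define i0 where "i0 = length (c (v [0 \<rightarrow> K]))"
  have q: "q \<ge> 1" using morphism_simps(3)[OF c, of a] by (simp add: q_def Suc_le_eq)
  have pos: "length (c (v [0 \<rightarrow> K + m])) = i0 + m * q" for m
  proof (induction m)
    case (Suc m)
    have "v [0 \<rightarrow> K + Suc m] = v [0 \<rightarrow> K + m] @ [a]" using v[of "K + m"] by simp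
    then have "c (v [0 \<rightarrow> K + Suc m]) = c (v [0 \<rightarrow> K + m]) @ c [a]" using morphism_simps(2)[OF c] by simp
    then show ?case using Suc by (simp add: q_def)
  qed (simp add: i0_def)
  have block: "w [i0 + m * q \<rightarrow> i0 + Suc m * q] = c [a]" for m
    using word_image_block[OF c w, of "K + m"] pos[of m] pos[of "Suc m"] v[of "K + m"] by simp
  have val: "w (i0 + m * q + r) = c [a] ! r" if "r < q" for m r
    using arg_cong[OF block[of m], of "\<lambda>x. x ! r"] that by simp
  have "w (i + q) = w i" if "i \<ge> i0" for i
  proof -
    define m where "m = (i - i0) div q"
    define r where "r = (i - i0) mod q"
    have "r < q" using q by (simp add: r_def)
    have "i - i0 = m * q + r" by (simp add: m_def r_def)
    then have "i = i0 + m * q + r" using that by simp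
    then show ?thesis using val[OF \<open>r < q\<close>, of m] val[OF \<open>r < q\<close>, of "Suc m"] by (simp add: algebra_simps)
  qed
  then show ?thesis using q by blast
qed

text \<open>
  Let \<open>a\<close> be the letter fixed by \<open>c\<close>. The square of \<open>c\<close> attaches a letter \<open>a\<close> to each other letter,
  so the distance between two letters different from \<open>a\<close> decreases from level to level. Hence there
  is at most one such letter. Formally, a word \<open>x\<close> and its image have the same number of letters
  other than \<open>a\<close>, and the image is longer by that number.
\<close>
lemma constant_square_chain:
  assumes c: "c \<in> \<C>" and ch: "word_chain (\<lambda>i. c \<circ> c) v"
  obtains K a where "\<And>k. k \<ge> K \<Longrightarrow> v 0 k = a"
proof -
  define a where "a = (if c = c1 then L1 else L3)"
  define cnt where "cnt u = length (filter (\<lambda>x. x \<noteq> a) u)" for u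
  have cc: "(c = c1 \<and> a = L1) \<or> (c = c2 \<and> a = L3)" using c c1_neq_c2 by (auto simp: \<C>_def a_def)
  have "cnt (c (c u)) = cnt u \<and> length (c (c u)) = length u + cnt u" for u
  proof (induction u)
    case (Cons x u)
    then show ?case using cc by (cases x) (auto simp: cnt_def)
  qed (use cc in \<open>auto simp: cnt_def\<close>)
  then have cnt: "cnt (c (c u)) = cnt u" "length (c (c u)) = length u + cnt u" for u by blast+
  have cnt_mono: "cnt (v i [0 \<rightarrow> m]) \<le> cnt (v i [0 \<rightarrow> n])" if "m \<le> n" for i m n
    using subsequence_append'[of 0 m n "v i"] that by (simp add: cnt_def)
  have small: "cnt (v i [0 \<rightarrow> Suc p]) < 2" for i p
  proof (induction p arbitrary: i rule: less_induct)
    case (less p)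
    define x where "x = v (Suc i) [0 \<rightarrow> p]"
    have wi: "v i [0 \<rightarrow> length (c (c x))] = c (c x)"
      using ch unfolding word_chain_def word_image_def x_def by simp
    have x2: "cnt x < 2"
    proof (cases p)
      case 0
      then show ?thesis by (simp add: x_def cnt_def)
    next
      case (Suc p')
      then show ?thesis using less.IH[of p' "Suc i"] by (simp add: x_def)
    qed
    show ?case
    proof (cases "cnt x = 0")
      case True
      then have "v i [0 \<rightarrow> p] = c (c x)" using wi cnt(2)[of x] by (simp add: x_def)
      then have "cnt (v i [0 \<rightarrow> p]) = 0" using cnt(1)[of x] True by simp
      then show ?thesis by (simp add: cnt_def)
    next
      case False
      then have "Suc p \<le> length (c (c x))" using cnt(2)[of x] by (simp add: x_def)
      from cnt_mono[OF this, of i] have "cnt (v i [0 \<rightarrow> Suc p]) \<le> cnt (c (c x))" unfolding wi .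
      then show ?thesis using x2 cnt(1)[of x] by simp
    qed
  qed
  have one: "k = l" if "v 0 k \<noteq> a" "v 0 l \<noteq> a" for k l
  proof (rule ccontr)
    assume "k \<noteq> l"
    have two: "k' \<ge> l'" if "v 0 k' \<noteq> a" "v 0 l' \<noteq> a" for k' l'
    proof (rule ccontr)
      assume "\<not> l' \<le> k'"
      then have "v 0 [0 \<rightarrow> Suc l'] = v 0 [0 \<rightarrow> k'] @ [v 0 k'] @ v 0 [Suc k' \<rightarrow> l'] @ [v 0 l']"
        using subsequence_append'[of 0 k' "l'" "v 0"] subsequence_append'[of k' "Suc k'" "l'" "v 0"] by simp
      then have "cnt (v 0 [0 \<rightarrow> Suc l']) \<ge> 2" using that by (simp add: cnt_def)
      then show False using small[of 0 l'] by simp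
    qed
    show False using two[OF that] two[OF that(2,1)] \<open>k \<noteq> l\<close> by simp
  qed
  show thesis
  proof (cases "\<exists>k. v 0 k \<noteq> a")
    case True
    then obtain k where k: "v 0 k \<noteq> a" by blast
    show ?thesis by (rule that[of "Suc k" a]) (use one[OF k] in fastforce)
  next
    case False
    then show ?thesis by (intro that[of 0 a]) blast
  qed
qed

section \<open>The three regimes\<close>

lemma word_chain_squares:
  assumes "word_chain \<sigma> ws" "\<And>i. \<sigma> (N + 2 * i) = \<sigma> (N + 2 * i + 1)"
  shows "word_chain (\<lambda>i. \<sigma> (N + 2 * i) \<circ> \<sigma> (N + 2 * i)) (\<lambda>i. ws (N + 2 * i))"
  unfolding word_chain_def
proof
  fix i
  have "word_image (\<sigma> (N + 2 * i)) (ws (Suc (N + 2 * i))) (ws (N + 2 * i))"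
    "word_image (\<sigma> (Suc (N + 2 * i))) (ws (Suc (Suc (N + 2 * i)))) (ws (Suc (N + 2 * i)))"
    using assms(1) unfolding word_chain_def by blast+
  from word_image_comp[OF this]
  show "word_image (\<sigma> (N + 2 * i) \<circ> \<sigma> (N + 2 * i)) (ws (N + 2 * Suc i)) (ws (N + 2 * i))"
    using assms(2)[of i] by simp
qed

lemma singleton_in_language: "[a] \<in> language w \<longleftrightarrow> a \<in> range w"
proof
  assume "[a] \<in> language w"
  then obtain k where "sublist [a] (w [0 \<rightarrow> k])" by (auto simp: language_iff)
  then have "a \<in> set (w [0 \<rightarrow> k])" by (auto simp only: sublist_def set_append list.set)
  then show "a \<in> range w" by auto
next
  assume "a \<in> range w"
  then obtain k where "[a] = w [k \<rightarrow> Suc k]" by auto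
  then show "[a] \<in> language w" unfolding language_def by fastforce
qed

lemma complexity_eventually_constant:
  assumes "\<C>_adic \<sigma> w" "\<sigma> \<in> eventually_constant"
  shows "\<exists>k\<ge>1. \<forall>\<^sub>F n in sequentially. complexity w n = k"
proof -
  obtain N where \<sigma>: "\<And>n. \<sigma> n \<in> \<C>" and N: "\<And>n. n \<ge> N \<Longrightarrow> \<sigma> n = \<sigma> N"
    using assms(2) by (auto simp: eventually_constant_def)
  obtain ws where ws: "ws 0 = w" "word_chain \<sigma> ws" by (rule word_chain_if_adic[OF assms(1)])
  have "word_chain (\<lambda>i. \<sigma> (N + 2 * i) \<circ> \<sigma> (N + 2 * i)) (\<lambda>i. ws (N + 2 * i))"
    by (rule word_chain_squares[OF ws(2)]) (metis N le_add1 trans_le_add1)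
  moreover have "\<sigma> (N + 2 * i) = \<sigma> N" for i by (rule N) simp
  ultimately have "word_chain (\<lambda>i. \<sigma> N \<circ> \<sigma> N) (\<lambda>i. ws (N + 2 * i))" by simp
  then obtain K a where K: "\<And>k. k \<ge> K \<Longrightarrow> ws (N + 2 * 0) k = a"
    using constant_square_chain[OF \<sigma>] by blast
  have "word_image (subst_prod \<sigma> 0 N) (ws N) w" using word_chain_prod[OF ws(2), of 0 N] ws(1) by simp
  moreover have "morphism (subst_prod \<sigma> 0 N)" by (intro morphism_subst_prod morphism_\<C> \<sigma>)
  moreover have "ws N k = a" if "k \<ge> K" for k using K[OF that] by simp
  ultimately have "\<exists>q\<ge>1. \<exists>i0. \<forall>i\<ge>i0. w (i + q) = w i"
    using periodic_if_image_of_eventually_constant[of "subst_prod \<sigma> 0 N" "ws N" w K a] by simp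
  then obtain q i0 where "q \<ge> 1" "\<And>i. i \<ge> i0 \<Longrightarrow> w (i + q) = w i" by blast
  then show ?thesis unfolding complexity_level by (rule eventually_constant_complexity_if_periodic)
qed

text \<open>
  Pairing the substitutions from \<open>N\<close> on gives the Sturmian case at level \<open>N\<close>; from there unit growth is
  carried up to level 0.
\<close>
lemma complexity_eventually_squares:
  assumes "\<C>_adic \<sigma> w" "\<sigma> \<in> eventually_squares - eventually_constant"
  shows "\<exists>k\<ge>1. \<forall>\<^sub>F n in sequentially. complexity w n = n + k"
proof -
  obtain N where \<sigma>: "\<And>n. \<sigma> n \<in> \<C>" and N: "\<And>i. \<sigma> (N + 2 * i) = \<sigma> (N + 2 * i + 1)"
    using assms(2) by (auto simp: eventually_squares_def)
  obtain ws where ws: "ws 0 = w" "word_chain \<sigma> ws" by (rule word_chain_if_adic[OF assms(1)])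
  define \<rho> where "\<rho> i = \<sigma> (N + 2 * i)" for i
  define v where "v i = ws (N + 2 * i)" for i
  have \<rho>: "\<rho> i \<in> \<C>" for i using \<sigma> by (simp add: \<rho>_def)
  have ch: "word_chain (\<lambda>i. \<rho> i \<circ> \<rho> i) v" using word_chain_squares[OF ws(2) N] by (simp add: \<rho>_def v_def[abs_def])
  have inf: "\<exists>j\<ge>i. \<rho> j = c" if c: "c \<in> \<C>" for i c
  proof (rule ccontr)
    assume no: "\<not> ?thesis"
    \<comment> \<open>If \<open>c\<close> stops occurring at paired positions, only the other substitution \<open>d\<close> is left.\<close>
    obtain d where d: "\<And>n. \<sigma> n \<noteq> c \<Longrightarrow> \<sigma> n = d" using \<sigma> c unfolding \<C>_def by blast
    have "\<sigma> n = d" if "n \<ge> N + 2 * i" for n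
    proof -
      define j where "j = (n - N) div 2"
      have "n = N + 2 * j \<or> n = N + 2 * j + 1" "j \<ge> i" using that unfolding j_def by linarith+
      moreover have "\<sigma> (N + 2 * j) \<noteq> c" using no \<open>j \<ge> i\<close> by (auto simp: \<rho>_def)
      ultimately show ?thesis using N[of j] d by metis
    qed
    then have "\<forall>n\<ge>N + 2 * i. \<sigma> n = \<sigma> (N + 2 * i)" by simp
    then have "\<sigma> \<in> eventually_constant" using \<sigma> unfolding eventually_constant_def by blast
    then show False using assms(2) by blast
  qed
  have C: "c1 \<in> \<C>" "c2 \<in> \<C>" by (simp_all add: \<C>_def)
  have mor: "morphism (\<rho> i \<circ> \<rho> i)" for i using morphism_comp morphism_\<C> \<rho> by blast
  have letters: "range (v i) \<subseteq> {L1, L3}" for i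
  proof
    fix x assume "x \<in> range (v i)"
    then have "x \<noteq> L2" using no_L2_in_square_chain[OF \<rho> ch inf[OF C(1)]] by auto
    then show "x \<in> {L1, L3}" by (cases x) auto
  qed
  have rec: "uniformly_recurrent (v r) \<and> range (v r) = {L1, L3}" for r
  proof -
    have ch': "word_chain (\<lambda>i. \<rho> (i + r) \<circ> \<rho> (i + r)) (\<lambda>i. v (i + r))"
      using ch unfolding word_chain_def by simp
    have "primitive_on {L1, L3} (\<lambda>i. \<rho> (i + r) \<circ> \<rho> (i + r))"
    proof (rule square_chain_primitive_on[of "\<lambda>i. \<rho> (i + r)"])
      have "\<exists>j\<ge>i. \<rho> (j + r) = c" if "c \<in> \<C>" for i c
        using inf[OF that, of "i + r"] by (metis add_leE le_add_diff_inverse2 add_le_cancel_right)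
      then show "\<exists>j\<ge>i. \<rho> (j + r) = c1" "\<exists>j\<ge>i. \<rho> (j + r) = c2" for i using C by blast+
    qed (rule \<rho>)
    then show ?thesis
      using primitive_uniformly_recurrent[OF ch' mor letters, of L1 L3] by simp
  qed
  define M where "M i = language (v i)" for i
  have M: "M i = img (\<rho> i) (img (\<rho> i) (M (Suc i)))" for i
    using word_chain_language[OF ch mor, of i] by (simp add: M_def img_comp[OF morphism_\<C>[OF \<rho>]])
  have bi: "biextendable (M i)" for i using rec[of i] by (simp add: M_def biextendable_if_recurrent)
  have single: "[a] \<in> M i \<longleftrightarrow> a \<in> {L1, L3}" for i a
    using rec[of i] by (simp add: M_def singleton_in_language)
  have "card (level (M 0) n) = n + 1" for n by (rule square_chain_complexity[where \<sigma> = \<rho>, OF \<rho> M bi single])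
  then have "unit_growth (M 0)" using bi[of 0] by (simp add: unit_growth_def)
  then have base: "unit_growth (language (ws N))" by (simp add: M_def v_def)
  have "unit_growth (language (ws n))" if "n \<le> N" for n
    using that
  proof (induction n rule: inc_induct)
    case (step n)
    then show ?case
      using unit_growth_img[OF \<sigma>] word_chain_language[OF ws(2) morphism_\<C>[OF \<sigma>], of n] by simp
  qed (rule base)
  then have "unit_growth (language w)" using ws(1) by blast
  then show ?thesis unfolding complexity_level by (rule unit_growth_affine)
qed

lemma bispecial_iff: "bispecial w u \<longleftrightarrow> bispecial_in (language w) u"
proof -
  have "u \<in> language w" if "card {a. a # u \<in> language w} > 1"
  proof -
    have "{a. a # u \<in> language w} \<noteq> {}" using that by force
    then obtain a where "a # u \<in> language w" by blast
    then show ?thesis by (rule right_extendable_Cons[OF right_extendable_language])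
  qed
  then show ?thesis by (auto simp: bispecial_def bispecial_in_def left_ext_def right_ext_def lext_def rext_def)
qed

lemma ext_graph:
  assumes "biextendable (language w)"
  shows "ext_graph_verts w u = Domain (ext (language w) u) <+> Range (ext (language w) u)"
    and "ext_graph_edges w u = rel_edges (ext (language w) u)"
  unfolding Domain_ext[OF right_extendable_language] Range_ext[OF assms]
  by (simp_all add: ext_graph_verts_def left_ext_def right_ext_def lext_def rext_def
      ext_graph_edges_def rel_edges_def bi_ext_def ext_def)

lemma level_one_full:
  assumes "\<And>a. [a] \<in> L" shows "card (level (L :: letter list set) 1) = 3"
proof -
  have "level L 1 = (\<lambda>a. [a]) ` UNIV" using assms by (auto simp: level_def length_Suc_conv)
  then show ?thesis by (simp add: card_image inj_on_def card_UNIV_letter)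
qed

lemma primitive_dendric:
  assumes "\<C>_adic \<sigma> w" "primitive \<sigma>"
  shows "uniformly_recurrent w \<and> dendric w \<and> range w = UNIV" "complexity w n = 2 * n + 1"
proof -
  have \<sigma>: "\<sigma> n \<in> \<C>" for n using assms(1) by (auto simp: \<C>_adic_def)
  obtain ws where ws: "ws 0 = w" "word_chain \<sigma> ws" by (rule word_chain_if_adic[OF assms(1)])
  have rec: "uniformly_recurrent (ws r) \<and> range (ws r) = UNIV" for r
  proof -
    have ch: "word_chain (\<lambda>n. \<sigma> (n + r)) (\<lambda>n. ws (n + r))" using ws(2) unfolding word_chain_def by simp
    have "\<exists>s>q. \<forall>a b. a \<in> set (subst_prod (\<lambda>n. \<sigma> (n + r)) q s [b])" for q
    proof -
      obtain s where s: "s > q + r" "\<forall>a b. a \<in> set (subst_prod \<sigma> (q + r) s [b])"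
        using assms(2) unfolding primitive_def by blast
      then show ?thesis by (intro exI[of _ "s - r"]) (simp add: subst_prod_shift)
    qed
    then have "primitive_on UNIV (\<lambda>n. \<sigma> (n + r))" by (simp add: primitive_on_def)
    then show ?thesis
      using primitive_uniformly_recurrent[OF ch morphism_\<C>[OF \<sigma>] subset_UNIV UNIV_I[of L1] UNIV_I[of L2]] by simp
  qed
  have chain: "directed_chain \<sigma> (\<lambda>r. language (ws r))"
    unfolding directed_chain_def full_language_def
  proof (intro allI conjI)
    fix n
    show "\<sigma> n \<in> \<C>" by (rule \<sigma>)
    show "biextendable (language (ws n))" using rec[of n] biextendable_if_recurrent by blast
    show "[a] \<in> language (ws n)" for a using rec[of n] by (simp add: singleton_in_language)
    show "language (ws n) = img (\<sigma> n) (language (ws (Suc n)))"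
      by (rule word_chain_language[OF ws(2) morphism_\<C>[OF \<sigma>]])
  qed
  have bi: "biextendable (language w)" using rec[of 0] biextendable_if_recurrent ws(1) by blast
  have tree: "rel_tree (ext (language w) u)" if "bispecial_in (language w) u" for u
    using good_bispecial[OF chain, of 0 u] that ws(1) by (simp add: good_def)
  have "dendric w"
    unfolding dendric_def bispecial_iff ext_graph[OF bi] using tree is_tree_if_rel_tree by blast
  then show "uniformly_recurrent w \<and> dendric w \<and> range w = UNIV" using rec[of 0] ws(1) by blast
  have "card (ext (language w) u) + 1 = card (lext (language w) u) + card (rext (language w) u)"
    if "bispecial_in (language w) u" for u
    using tree[OF that] by (simp add: rel_tree_def Domain_ext[OF right_extendable_language] Range_ext[OF bi])
  from complexity_affine[OF bi this, of n]
  show "complexity w n = 2 * n + 1"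
    using level_one_full[of "language w"] rec[of 0] ws(1) by (simp add: complexity_level singleton_in_language)
qed

lemma dendric_complexity_ge:
  fixes w :: "letter word"
  assumes "uniformly_recurrent w" "dendric w" "range w = UNIV"
  shows "2 * n + 1 \<le> complexity w n"
proof -
  have bi: "biextendable (language w)" using biextendable_if_recurrent assms(1) .
  have "card (lext (language w) u) + card (rext (language w) u) \<le> card (ext (language w) u) + 1"
    if "bispecial_in (language w) u" for u
  proof -
    have "is_tree (ext_graph_verts w u) (ext_graph_edges w u)"
      using assms(2) that by (simp add: dendric_def bispecial_iff)
    then have "rel_connected (ext (language w) u)"
      by (simp add: is_tree_def ext_graph[OF bi] rel_connected_iff_graph)
    from rel_connected_card[OF this] show ?thesis
      by (simp add: Domain_ext[OF right_extendable_language] Range_ext[OF bi])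
  qed
  from complexity_ge_affine[OF bi this, of n]
  show ?thesis using level_one_full[of "language w"] assms(3) by (simp add: complexity_level singleton_in_language)
qed

theorem theorem10p1:
  fixes w :: "letter word"
    and \<sigma> :: "nat \<Rightarrow> letter list \<Rightarrow> letter list"
  assumes "\<C>_adic \<sigma> w"
  shows "((\<exists>k\<ge>1. \<forall>\<^sub>F n in sequentially. complexity w n = k)
            \<longleftrightarrow> \<sigma> \<in> eventually_constant)
       \<and> ((\<exists>k\<ge>1. \<forall>\<^sub>F n in sequentially. complexity w n = n + k)
            \<longleftrightarrow> \<sigma> \<in> eventually_squares - eventually_constant)
       \<and> ((\<forall>n. complexity w n = 2 * n + 1) \<longleftrightarrow> primitive \<sigma>)
       \<and> (primitive \<sigma> \<longleftrightarrow> uniformly_recurrent w \<and> dendric w \<and> range w = UNIV)"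
proof -
  let ?p = "complexity w"
  have range: "range \<sigma> \<subseteq> \<C>" using assms by (simp add: \<C>_adic_def)
  let ?A = "\<exists>k\<ge>1. \<forall>\<^sub>F n in sequentially. ?p n = k"
  let ?B = "\<exists>k\<ge>1. \<forall>\<^sub>F n in sequentially. ?p n = n + k"
  let ?D = "\<forall>n. ?p n = 2 * n + 1"
  let ?U = "uniformly_recurrent w \<and> dendric w \<and> range w = UNIV"
  have excl: "\<not> (?A \<and> ?B)" "\<not> (?A \<and> (\<forall>n. 2 * n + 1 \<le> ?p n))" "\<not> (?B \<and> (\<forall>n. 2 * n + 1 \<le> ?p n))"
  proof -
    show "\<not> (?A \<and> ?B)"
    proof
      assume "?A \<and> ?B"
      then obtain k l a b where "\<And>n. n \<ge> a \<Longrightarrow> ?p n = k" "\<And>n. n \<ge> b \<Longrightarrow> ?p n = n + l"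
        unfolding eventually_sequentially by metis
      from this(1)[of "a + b"] this(1)[of "Suc (a + b)"] this(2)[of "a + b"] this(2)[of "Suc (a + b)"]
      show False by simp
    qed
    show "\<not> (?A \<and> (\<forall>n. 2 * n + 1 \<le> ?p n))"
    proof
      assume *: "?A \<and> (\<forall>n. 2 * n + 1 \<le> ?p n)"
      then obtain k a where "\<And>n. n \<ge> a \<Longrightarrow> ?p n = k" unfolding eventually_sequentially by metis
      from this[of "a + k"] have "?p (a + k) = k" by simp
      moreover have "2 * (a + k) + 1 \<le> ?p (a + k)" using * by blast
      ultimately show False by simp
    qed
    show "\<not> (?B \<and> (\<forall>n. 2 * n + 1 \<le> ?p n))"
    proof
      assume *: "?B \<and> (\<forall>n. 2 * n + 1 \<le> ?p n)"
      then obtain k a where "\<And>n. n \<ge> a \<Longrightarrow> ?p n = n + k" unfolding eventually_sequentially by metis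
      from this[of "a + k"] have "?p (a + k) = a + k + k" by simp
      moreover have "2 * (a + k) + 1 \<le> ?p (a + k)" using * by blast
      ultimately show False by simp
    qed
  qed
  have A: "\<sigma> \<in> eventually_constant \<Longrightarrow> ?A" by (rule complexity_eventually_constant[OF assms])
  have B: "\<sigma> \<in> eventually_squares - eventually_constant \<Longrightarrow> ?B" by (rule complexity_eventually_squares[OF assms])
  have P: "primitive \<sigma> \<Longrightarrow> ?U" "primitive \<sigma> \<Longrightarrow> ?D" using primitive_dendric[OF assms] by blast+
  have ge: "?U \<Longrightarrow> \<forall>n. 2 * n + 1 \<le> ?p n" "?D \<Longrightarrow> \<forall>n. 2 * n + 1 \<le> ?p n" using dendric_complexity_ge by auto
  have tri: "\<sigma> \<in> eventually_constant \<or> \<sigma> \<in> eventually_squares - eventually_constant \<or> primitive \<sigma>"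
    using not_squares_primitive[OF range] by blast
  show ?thesis using tri A B P ge excl by argo
qed

end
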